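(* Let $n=2$. A continuous, translation invariant Minkowski valuation $\Phi:\mathcal{K}^2\to\mathcal{K}^2$ satisfies (VC) and is $\mathrm{SO}(2)$-covariant if and only if there are $g\in\mathrm{SO}(2)$ and $a,b\geq 0$ with $a+b>0$ such that $\Phi(K)=a\,g(K-s(K))+b\,g(-K+s(K))$ for all $K\in\mathcal{K}^2$.
   Context: $\mathcal{K}^2$ is the space of convex bodies in $\mathbb{R}^2$ with Hausdorff metric and Minkowski addition; $-K=\{-x:x\in K\}$. A Minkowski valuation satisfies $\Phi(K)+\Phi(L)=\Phi(K\cup L)+\Phi(K\cap L)$ whenever $K,L,K\cup L\in\mathcal{K}^2$. Translation invariant: $\Phi(K+t)=\Phi(K)$; $\mathrm{SO}(2)$-covariant: $\Phi(gK)=g\Phi(K)$ for all $g\in\mathrm{SO}(2)$. The Steiner point is $s(K)=\frac{1}{\pi}\int_{\mathbb{S}^{1}}h(K,u)u\,du$ with $h(K,u)=\max_{x\in K}\langle u,x\rangle$. (VC): there are $c,C>0$ with $cV_2(K)\le V_2(\Phi(K))\le CV_2(K)$ for all $K$, $V_2$ the area. *)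

theory Defs
  imports "HOL-Analysis.Analysis" "HOL-Library.Set_Algebras"
begin

type_synonym pt = "real^2"

definition convex_body :: "pt set \<Rightarrow> bool" where
  "convex_body K \<longleftrightarrow> K \<noteq> {} \<and> compact K \<and> convex K"

text \<open>Hausdorff distance (used on nonempty compact sets).\<close>
definition hausdorff_dist :: "pt set \<Rightarrow> pt set \<Rightarrow> real" where
  "hausdorff_dist K L = max (SUP x\<in>K. infdist x L) (SUP y\<in>L. infdist y K)"

definition hausdorff_continuous :: "(pt set \<Rightarrow> pt set) \<Rightarrow> bool" where
  "hausdorff_continuous \<Phi> \<longleftrightarrow>
     (\<forall>K. convex_body K \<longrightarrow> (\<forall>e>0. \<exists>d>0. \<forall>L. convex_body L \<longrightarrow>
         hausdorff_dist K L < d \<longrightarrow> hausdorff_dist (\<Phi> K) (\<Phi> L) < e))"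

definition minkowski_valuation :: "(pt set \<Rightarrow> pt set) \<Rightarrow> bool" where
  "minkowski_valuation \<Phi> \<longleftrightarrow>
     (\<forall>K L. convex_body K \<longrightarrow> convex_body L \<longrightarrow> convex_body (K \<union> L) \<longrightarrow>
        \<Phi> K + \<Phi> L = \<Phi> (K \<union> L) + \<Phi> (K \<inter> L))"

definition translation_invariant :: "(pt set \<Rightarrow> pt set) \<Rightarrow> bool" where
  "translation_invariant \<Phi> \<longleftrightarrow>
     (\<forall>K t. convex_body K \<longrightarrow> \<Phi> ((\<lambda>x. x + t) ` K) = \<Phi> K)"

definition SO2 :: "(real^2^2) set" where
  "SO2 = {g. orthogonal_matrix g \<and> det g = 1}"

definition SO2_covariant :: "(pt set \<Rightarrow> pt set) \<Rightarrow> bool" where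
  "SO2_covariant \<Phi> \<longleftrightarrow>
     (\<forall>K g. convex_body K \<longrightarrow> g \<in> SO2 \<longrightarrow> \<Phi> ((\<lambda>x. g *v x) ` K) = (\<lambda>x. g *v x) ` \<Phi> K)"

definition area :: "pt set \<Rightarrow> real" where
  "area K = measure lebesgue K"

definition VC :: "(pt set \<Rightarrow> pt set) \<Rightarrow> bool" where
  "VC \<Phi> \<longleftrightarrow> (\<exists>c C. c > 0 \<and> C > 0 \<and>
     (\<forall>K. convex_body K \<longrightarrow> c * area K \<le> area (\<Phi> K) \<and> area (\<Phi> K) \<le> C * area K))"

definition support_fun :: "pt set \<Rightarrow> pt \<Rightarrow> real" where
  "support_fun K u = (SUP x\<in>K. inner u x)"

definition unit_dir :: "real \<Rightarrow> pt" where
  "unit_dir \<theta> = vector [cos \<theta>, sin \<theta>]"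

definition steiner_point :: "pt set \<Rightarrow> pt" where
  "steiner_point K = (1 / pi) *\<^sub>R
     integral {0..2*pi} (\<lambda>\<theta>. support_fun K (unit_dir \<theta>) *\<^sub>R unit_dir \<theta>)"

end

(*
  Let h(K,.) be the support function. Condition (VC) forces Phi to map points to {0} and segments to
  centred segments; covariance and additivity along a line then give a rotation g and a constant
  kappa > 0 with h(Phi[p,q], gx) = kappa |<q - p, x>|. Biadditivity on parallelograms leaves a quadratic term, which (VC)
  excludes by an area comparison. Since a triangle T and -T tile a parallelogram, h(Phi T, gx) + h(Phi T, -gx)
  is known, and sublinearity makes h(Phi T, g.) piecewise linear: it equals a h(T,.) + b h(-T,.) plus
  a linear term, where a + b = 2 kappa. Cutting T through a vertex shows that a does not depend on T.

  The linear term is identified by the vanishing of the Steiner point z(T) of Phi T (read in the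
  frame g). As z vanishes on segments and parallelograms and is homogeneous, cutting a rectangle into
  four right triangles, as in the usual picture of the addition theorem, gives for the right triangle
  with hypotenuse 1 and angle t the equation n(s + t) = e^{is} n(t) + e^{it} n(s). So e^{-it} n(t) is
  additive and continuous and vanishes at pi/2, hence n = 0, and every triangle is a signed union of
  two right triangles. Radon's theorem carries the formula from triangles to polygons, and continuity
  to all convex bodies.
*)

theory Submission
  imports Defs
begin

section \<open>Support functions and crossing convex hulls\<close>

text \<open>Minkowski sums cannot be subtracted, so the valuation property is read off support
  functions, where it is an identity between real numbers. It is applied in a single shape: the hull
  of \<open>A \<union> B \<union> C\<close> is cut along the hull of \<open>C\<close>, which every
  segment joining the hulls of \<open>A\<close> and \<open>B\<close> meets. The obstacle is that
  centrally symmetric bodies see only even functions. Segments and parallelograms fix a + b, but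
  neither a - b nor the linear term of a triangle. Sublinearity leaves exactly these three real
  parameters, and they need different arguments: a is constant because a cut through a vertex leaves
  one edge untouched, while the linear term has to be computed. The Steiner point is the right test
  for it, being linear in the support function, zero on even functions, and faithful on linear ones.
  (VC) enters three times: its upper bound makes the images of points and segments thin, its lower
  bound gives kappa > 0, and its upper bound removes the quadratic term on parallelograms.\<close>

lemma support_fun_eqI:
  assumes "m \<in> K" "inner u m = r" "\<And>y. y \<in> K \<Longrightarrow> inner u y \<le> r"
  shows "support_fun K u = r"
  unfolding support_fun_def using assms by (intro cSup_eq_maximum) auto

lemma support_fun_attained:
  assumes "convex_body K"
  obtains m where "m \<in> K" "inner u m = support_fun K u" "\<And>y. y \<in> K \<Longrightarrow> inner u y \<le> support_fun K u"
proof -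
  have "\<exists>m\<in>K. \<forall>y\<in>K. inner u y \<le> inner u m"
    using assms unfolding convex_body_def
    by (intro continuous_attains_sup) (auto intro: continuous_intros)
  then obtain m where m: "m \<in> K" "\<And>y. y \<in> K \<Longrightarrow> inner u y \<le> inner u m" by blast
  from support_fun_eqI[OF m(1) refl m(2)] m show thesis by (intro that[of m]) auto
qed

lemma support_fun_ge: "convex_body K \<Longrightarrow> y \<in> K \<Longrightarrow> inner u y \<le> support_fun K u"
  by (metis support_fun_attained)

lemma support_fun_le:
  assumes "convex_body K" "\<And>y. y \<in> K \<Longrightarrow> inner u y \<le> r"
  shows "support_fun K u \<le> r"
  using support_fun_attained[OF assms(1), of u] assms(2) by metis

lemma support_fun_plus:
  assumes "convex_body K" "convex_body L"
  shows "support_fun (K + L) u = support_fun K u + support_fun L u"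
proof -
  obtain m where m: "m \<in> K" "inner u m = support_fun K u" using assms by (metis support_fun_attained)
  obtain n where n: "n \<in> L" "inner u n = support_fun L u" using assms by (metis support_fun_attained)
  show ?thesis
  proof (rule support_fun_eqI[of "m + n"])
    show "m + n \<in> K + L" using m n by (auto intro: set_plus_intro)
    show "inner u (m + n) = support_fun K u + support_fun L u" using m n by (simp add: inner_add_right)
    fix y assume "y \<in> K + L"
    then obtain a b where "y = a + b" "a \<in> K" "b \<in> L" by (auto elim: set_plus_elim)
    then show "inner u y \<le> support_fun K u + support_fun L u"
      using assms by (auto simp: inner_add_right intro!: add_mono support_fun_ge)
  qed
qed

lemma support_fun_add_le:
  assumes "convex_body K"
  shows "support_fun K (x + y) \<le> support_fun K x + support_fun K y"
  using assms by (intro support_fun_le) (auto simp: inner_add_left intro!: add_mono support_fun_ge)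

lemma support_fun_scale:
  assumes "convex_body K" "r \<ge> 0"
  shows "support_fun K (r *\<^sub>R x) = r * support_fun K x"
proof -
  obtain m where "m \<in> K" "inner x m = support_fun K x" using assms by (metis support_fun_attained)
  then show ?thesis
    using assms by (intro support_fun_eqI[of m]) (auto intro!: mult_left_mono support_fun_ge)
qed

lemma support_fun_zero: "convex_body K \<Longrightarrow> support_fun K 0 = 0"
  using support_fun_scale[of K 0 0] by simp

lemma support_fun_translation:
  assumes "convex_body K"
  shows "support_fun ((\<lambda>x. x + t) ` K) u = support_fun K u + inner u t"
proof -
  obtain m where "m \<in> K" "inner u m = support_fun K u" using assms by (metis support_fun_attained)
  then show ?thesis using assms
    by (intro support_fun_eqI[of "m + t"]) (auto simp: inner_add_right intro!: add_mono support_fun_ge)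
qed

lemma support_fun_matrix_image:
  assumes "convex_body K"
  shows "support_fun ((\<lambda>x. g *v x) ` K) u = support_fun K (transpose g *v u)"
proof -
  have *: "inner u (g *v y) = inner (transpose g *v u) y" for y
    by (metis dot_lmul_matrix inner_commute transpose_matrix_vector)
  obtain m where "m \<in> K" "inner (transpose g *v u) m = support_fun K (transpose g *v u)"
    using assms by (metis support_fun_attained)
  then show ?thesis using assms
    by (intro support_fun_eqI[of "g *v m"]) (auto simp: * intro!: add_mono support_fun_ge)
qed

lemma support_fun_uminus_image:
  assumes "convex_body K"
  shows "support_fun (uminus ` K) u = support_fun K (- u)"
proof -
  obtain m where "m \<in> K" "inner (- u) m = support_fun K (- u)"
    using assms by (metis support_fun_attained)
  then show ?thesis using assms
    by (intro support_fun_eqI[of "- m"]) (auto intro: support_fun_ge[of K _ "- u", simplified])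
qed

lemma support_fun_scaleR_image:
  assumes "convex_body K" "r \<ge> 0"
  shows "support_fun ((\<lambda>x. r *\<^sub>R x) ` K) u = r * support_fun K u"
proof -
  obtain m where "m \<in> K" "inner u m = support_fun K u" using assms by (metis support_fun_attained)
  then show ?thesis using assms
    by (intro support_fun_eqI[of "r *\<^sub>R m"]) (auto intro!: mult_left_mono support_fun_ge)
qed

lemma subset_if_support_fun_le:
  assumes K: "convex_body K" and L: "convex_body L"
    and le: "\<And>u. support_fun K u \<le> support_fun L u"
  shows "K \<subseteq> L"
proof
  fix x assume x: "x \<in> K"
  show "x \<in> L"
  proof (rule ccontr)
    assume "x \<notin> L"
    then obtain a b where ab: "inner a x < b" "\<And>y. y \<in> L \<Longrightarrow> b < inner a y"
      using separating_hyperplane_closed_point[of L x] L compact_imp_closed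
      unfolding convex_body_def by blast
    have "support_fun L (-a) \<le> - b" using ab(2) by (intro support_fun_le[OF L]) (auto intro: less_imp_le)
    moreover have "inner (-a) x \<le> support_fun K (-a)" by (rule support_fun_ge[OF K x])
    ultimately show False using ab(1) le[of "-a"] by simp
  qed
qed

lemma convex_body_eqI:
  assumes "convex_body K" "convex_body L" "\<And>u. support_fun K u = support_fun L u"
  shows "K = L"
  using assms by (intro equalityI subset_if_support_fun_le) auto

lemma convex_body_plus:
  assumes K: "convex_body K" and L: "convex_body L"
  shows "convex_body (K + L)"
proof -
  have "K + L = {x + y | x y. x \<in> K \<and> y \<in> L}" by (auto simp: set_plus_def)
  then have "compact (K + L)" using compact_sums[of K L] K L by (simp add: convex_body_def)
  then show ?thesis using K L by (auto simp: convex_body_def convex_set_plus intro: set_plus_intro)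
qed

lemma convex_body_hull: "finite S \<Longrightarrow> S \<noteq> {} \<Longrightarrow> convex_body (convex hull S)"
  unfolding convex_body_def by (simp add: finite_imp_compact_convex_hull)

lemma convex_body_linear_image:
  "linear f \<Longrightarrow> convex_body K \<Longrightarrow> convex_body (f ` K)"
  unfolding convex_body_def
  by (auto intro: convex_linear_image compact_continuous_image linear_continuous_on simp: linear_conv_bounded_linear)

lemma convex_body_scaleR: "convex_body K \<Longrightarrow> convex_body ((\<lambda>x. r *\<^sub>R x) ` K)"
  by (rule convex_body_linear_image) auto

lemma convex_body_translation: "convex_body K \<Longrightarrow> convex_body ((\<lambda>x. x + t) ` K)"
  unfolding convex_body_def using convex_translation[of K t] compact_translation[of K t]
  by (auto simp: add.commute)

lemma convex_body_Int_nonempty: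
  assumes "convex_body K" "convex_body L" "K \<inter> L \<noteq> {}"
  shows "convex_body (K \<inter> L)"
  using assms unfolding convex_body_def by (auto intro: convex_Int compact_Int)

text \<open>A segment joining maximizers of \<^term>\<open>inner u\<close> over the two bodies runs inside the union,
  hence meets the intersection.\<close>
lemma support_fun_Int_aux:
  assumes K: "convex_body K" and L: "convex_body L" and KL: "convex (K \<union> L)"
    and le: "support_fun L u \<le> support_fun K u"
  shows "K \<inter> L \<noteq> {} \<and> support_fun (K \<inter> L) u = support_fun L u"
proof -
  obtain k where k: "k \<in> K" "inner u k = support_fun K u" using K by (metis support_fun_attained)
  obtain l where l: "l \<in> L" "inner u l = support_fun L u" using L by (metis support_fun_attained)
  have seg: "closed_segment k l \<subseteq> K \<union> L" using KL k l by (intro closed_segment_subset) auto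
  have "K \<inter> L \<inter> closed_segment k l \<noteq> {}"
  proof
    assume e: "K \<inter> L \<inter> closed_segment k l = {}"
    have "closed K" "closed L" using K L unfolding convex_body_def by (auto intro: compact_imp_closed)
    then have "K \<inter> closed_segment k l = {} \<or> L \<inter> closed_segment k l = {}"
      using seg e connected_closedD[OF connected_segment(1)[of k l], of K L] by blast
    then show False using k l by auto
  qed
  then obtain m where m: "m \<in> K" "m \<in> L" "m \<in> closed_segment k l" by blast
  then obtain t where t: "0 \<le> t" "t \<le> 1" "m = (1 - t) *\<^sub>R k + t *\<^sub>R l" by (auto simp: in_segment)
  have "inner u m = (1 - t) * support_fun K u + t * support_fun L u"
    using k l t by (simp add: inner_add_right)
  moreover have "(1 - t) * support_fun K u \<ge> (1 - t) * support_fun L u" using t le by (intro mult_left_mono) auto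
  ultimately have "inner u m \<ge> support_fun L u" by (simp add: algebra_simps)
  moreover have "inner u m \<le> support_fun L u" by (rule support_fun_ge[OF L m(2)])
  ultimately have "inner u m = support_fun L u" by simp
  then show ?thesis using m L by (auto intro!: support_fun_eqI[of m] support_fun_ge)
qed

text \<open>In each direction the union takes the larger and the intersection the smaller of the two
  values, the latter by \<open>support_fun_Int_aux\<close>. The case split only decides which body
  plays which role.\<close>

lemma support_fun_Un_Int:
  assumes K: "convex_body K" and L: "convex_body L" and KL: "convex (K \<union> L)"
  shows "support_fun (K \<union> L) u + support_fun (K \<inter> L) u = support_fun K u + support_fun L u"
proof -
  have *: "support_fun (K \<union> L) u + support_fun (K \<inter> L) u = support_fun K u + support_fun L u"
    if K: "convex_body K" and L: "convex_body L" and KL: "convex (K \<union> L)"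
      and le: "support_fun L u \<le> support_fun K u" for K L
  proof -
    obtain k where k: "k \<in> K" "inner u k = support_fun K u" using K by (metis support_fun_attained)
    have "support_fun (K \<union> L) u = support_fun K u"
      using k K L le by (intro support_fun_eqI[of k]) (auto intro: support_fun_ge order_trans[OF support_fun_ge])
    then show ?thesis using support_fun_Int_aux[OF that] by simp
  qed
  show ?thesis
    using *[OF K L KL] *[OF L K] KL by (cases "support_fun L u \<le> support_fun K u") (auto simp: Un_commute Int_commute)
qed

lemma support_fun_hull:
  assumes "finite S" "S \<noteq> {}"
  shows "support_fun (convex hull S) u = Max (inner u ` S)"
proof -
  have "Max (inner u ` S) \<in> inner u ` S" using assms by simp
  then obtain m where m: "m \<in> S" "inner u m = Max (inner u ` S)" by force
  have "convex hull S \<subseteq> {y. inner u y \<le> Max (inner u ` S)}"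
    using assms by (intro hull_minimal) (auto simp: convex_halfspace_le)
  then show ?thesis using m by (intro support_fun_eqI[of m]) (auto simp: hull_inc)
qed

section \<open>Hausdorff distance and hulls of finite sets\<close>

lemma hausdorff_dist_le:
  assumes "K \<noteq> {}" "L \<noteq> {}"
    "\<And>x. x \<in> K \<Longrightarrow> \<exists>y\<in>L. dist x y \<le> e" "\<And>y. y \<in> L \<Longrightarrow> \<exists>x\<in>K. dist y x \<le> e"
  shows "hausdorff_dist K L \<le> e"
proof -
  have "infdist x L \<le> e" if "x \<in> K" for x using assms(3)[OF that] infdist_le order_trans by blast
  moreover have "infdist x K \<le> e" if "x \<in> L" for x using assms(4)[OF that] infdist_le order_trans by blast
  ultimately show ?thesis unfolding hausdorff_dist_def using assms(1,2)
    by (auto intro!: cSUP_least)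
qed

text \<open>The vertices form a finite \<open>e\<close>-net chosen inside \<open>K\<close>. Their
  hull stays in \<open>K\<close> by convexity, so only one of the two distances needs the
  net.\<close>

lemma hausdorff_dense_polygons:
  assumes K: "convex_body K" and e: "e > 0"
  obtains S where "finite S" "S \<noteq> {}" "hausdorff_dist K (convex hull S) \<le> e"
proof -
  obtain S where S: "finite S" "S \<subseteq> K" "K \<subseteq> (\<Union>x\<in>S. ball x e)"
    using compactE_image[of K K "\<lambda>x. ball x e"] K e unfolding convex_body_def by force
  have ne: "S \<noteq> {}" using S K unfolding convex_body_def by auto
  have sub: "convex hull S \<subseteq> K" using S K unfolding convex_body_def by (intro hull_minimal) auto
  have "hausdorff_dist K (convex hull S) \<le> e"
  proof (rule hausdorff_dist_le)
    fix x assume "x \<in> K"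
    then obtain s where "s \<in> S" "dist s x < e" using S by auto
    then show "\<exists>y\<in>convex hull S. dist x y \<le> e" by (intro bexI[of _ s]) (auto simp: dist_commute hull_inc)
  next
    fix y assume "y \<in> convex hull S"
    then show "\<exists>x\<in>K. dist y x \<le> e" using sub e by (intro bexI[of _ y]) auto
  qed (use K ne in \<open>auto simp: convex_body_def\<close>)
  then show thesis using that S ne by blast
qed

text \<open>A maximizer in one body has a nearest point in the other, and moving there changes
  \<open>inner u\<close> by at most the distance, as \<open>u\<close> is a unit vector.\<close>

lemma support_fun_le_hausdorff:
  assumes K: "convex_body K" and L: "convex_body L" and u: "norm u = 1"
  shows "\<bar>support_fun K u - support_fun L u\<bar> \<le> hausdorff_dist K L"
proof -
  have *: "support_fun K u - support_fun L u \<le> (SUP x\<in>K. infdist x L)"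
    if K: "convex_body K" and L: "convex_body L" for K L
  proof -
    obtain k where k: "k \<in> K" "inner u k = support_fun K u" using K by (metis support_fun_attained)
    have "compact ((\<lambda>x. infdist x L) ` K)"
      using K unfolding convex_body_def by (intro compact_continuous_image continuous_intros) auto
    then have "infdist k L \<le> (SUP x\<in>K. infdist x L)"
      using k by (intro cSUP_upper bounded_imp_bdd_above compact_imp_bounded)
    moreover obtain y where y: "y \<in> L" "infdist k L = dist k y"
      using L infdist_attains_inf[of L k] unfolding convex_body_def by (auto intro: compact_imp_closed)
    moreover have "support_fun K u - support_fun L u \<le> inner u (k - y)"
      using k support_fun_ge[OF L y(1), of u] by (simp add: inner_diff_right)
    moreover have "inner u (k - y) \<le> dist k y"
      using norm_cauchy_schwarz[of u "k - y"] u by (simp add: dist_norm)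
    ultimately show ?thesis by linarith
  qed
  show ?thesis using *[OF K L] *[OF L K] unfolding hausdorff_dist_def by linarith
qed

text \<open>The neighbourhood \<open>?L\<close> of the second hull is convex as a Minkowski sum and
  contains every \<open>p i\<close>, hence the whole first hull.\<close>

lemma hull_near_hull:
  fixes p q :: "'i \<Rightarrow> pt"
  assumes I: "finite I" "I \<noteq> {}" and d: "\<And>i. i \<in> I \<Longrightarrow> dist (p i) (q i) \<le> e" and e: "e \<ge> 0"
    and x: "x \<in> convex hull (p ` I)"
  shows "\<exists>y\<in>convex hull (q ` I). dist x y \<le> e"
proof -
  let ?L = "convex hull (q ` I) + cball 0 e"
  have "p i \<in> ?L" if "i \<in> I" for i
  proof -
    have "q i + (p i - q i) \<in> ?L"
      using that d[OF that] by (intro set_plus_intro) (auto simp: hull_inc dist_norm norm_minus_commute)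
    then show ?thesis by simp
  qed
  then have "convex hull (p ` I) \<subseteq> ?L"
    by (intro hull_minimal) (auto simp: convex_set_plus)
  then obtain y z where "x = y + z" "y \<in> convex hull (q ` I)" "norm z \<le> e"
    using x by (auto elim!: set_plus_elim dest!: subsetD)
  then show ?thesis by (intro bexI[of _ y]) (auto simp: dist_norm)
qed

lemma hausdorff_dist_hull_le:
  assumes "finite I" "I \<noteq> {}" "\<And>i. i \<in> I \<Longrightarrow> dist (p i) (q i) \<le> e" "e \<ge> 0"
  shows "hausdorff_dist (convex hull (p ` I)) (convex hull (q ` I)) \<le> e"
  using hull_near_hull[of I p q e] hull_near_hull[of I q p e] assms
  by (intro hausdorff_dist_le) (auto simp: dist_commute)

text \<open>A point of the large hull lies on a segment from some \<open>c\<close> in the hull of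
  \<open>C\<close> to some \<open>y\<close> between \<open>a\<close> and \<open>b\<close>. The
  crossing point \<open>m\<close> splits the segment from \<open>a\<close> to \<open>b\<close>, and
  \<open>y\<close> lies in one of the two halves.\<close>

lemma hull_Un_crossing:
  fixes A B C :: "pt set"
  assumes ne: "A \<noteq> {}" "B \<noteq> {}" "C \<noteq> {}"
    and cross: "\<And>a b. a \<in> convex hull A \<Longrightarrow> b \<in> convex hull B \<Longrightarrow> closed_segment a b \<inter> convex hull C \<noteq> {}"
  shows "convex hull (A \<union> C) \<union> convex hull (B \<union> C) = convex hull (A \<union> B \<union> C)" (is "?A \<union> ?B = ?U")
proof
  show "?A \<union> ?B \<subseteq> ?U" by (intro Un_least hull_mono) auto
  have Un: "convex hull (S \<union> T) =
      {u *\<^sub>R s + v *\<^sub>R t | u v s t. u \<ge> 0 \<and> v \<ge> 0 \<and> u + v = 1 \<and> s \<in> convex hull S \<and> t \<in> convex hull T}"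
    if "S \<noteq> {}" "T \<noteq> {}" for S T :: "pt set"
    using convex_hull_union_two[of "convex hull S" "convex hull T"] that hull_Un[of convex S T]
    by (auto simp: convex_Inter)
  show "?U \<subseteq> ?A \<union> ?B"
  proof
    fix x assume "x \<in> ?U"
    then obtain u v y c where x: "x = u *\<^sub>R y + v *\<^sub>R c" "y \<in> convex hull (A \<union> B)" "c \<in> convex hull C"
        "u \<ge> 0" "v \<ge> 0" "u + v = 1"
      using Un[of "A \<union> B" C] ne by auto
    obtain u' v' a b where y: "y = u' *\<^sub>R a + v' *\<^sub>R b" "a \<in> convex hull A" "b \<in> convex hull B"
        "u' \<ge> 0" "v' \<ge> 0" "u' + v' = 1"
      using Un[of A B] ne x(2) by auto
    have "y \<in> closed_segment a b"
      using y by (auto simp: in_segment intro!: exI[of _ v'])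
    moreover obtain m where m: "m \<in> closed_segment a b" "m \<in> convex hull C" using cross[OF y(2,3)] by blast
    ultimately have "y \<in> closed_segment a m \<or> y \<in> closed_segment m b"
      using Un_closed_segment[OF m(1)] by blast
    moreover have sub: "convex hull A \<subseteq> ?A" "convex hull C \<subseteq> ?A" "convex hull B \<subseteq> ?B" "convex hull C \<subseteq> ?B"
      by (intro hull_mono; blast)+
    moreover have "closed_segment a m \<subseteq> ?A" "closed_segment m b \<subseteq> ?B"
      using m(2) y sub by (intro closed_segment_subset; auto)+
    ultimately have "y \<in> ?A \<or> y \<in> ?B" "c \<in> ?A" "c \<in> ?B" using x(3) by blast+
    then show "x \<in> ?A \<union> ?B"
      using x(1,4-6) convexD[of ?A y c u v] convexD[of ?B y c u v] by auto
  qed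
qed

text \<open>Weighting the two representations of a common point by the parameters of the crossing point
  turns \<^term>\<open>a\<close> and \<^term>\<open>b\<close> into that crossing point.\<close>
lemma hull_Int_crossing:
  fixes A B C :: "pt set"
  assumes ne: "A \<noteq> {}" "B \<noteq> {}" "C \<noteq> {}"
    and cross: "\<And>a b. a \<in> convex hull A \<Longrightarrow> b \<in> convex hull B \<Longrightarrow> closed_segment a b \<inter> convex hull C \<noteq> {}"
  shows "convex hull (A \<union> C) \<inter> convex hull (B \<union> C) = convex hull C"
proof
  show "convex hull C \<subseteq> convex hull (A \<union> C) \<inter> convex hull (B \<union> C)"
    by (intro Int_greatest hull_mono) auto
  have Un: "\<exists>r s c. 0 \<le> r \<and> r \<le> 1 \<and> s \<in> convex hull S \<and> c \<in> convex hull C \<and> x = (1-r) *\<^sub>R s + r *\<^sub>R c"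
    if "S \<noteq> {}" "x \<in> convex hull (S \<union> C)" for S x
  proof -
    have "x \<in> {u *\<^sub>R s + v *\<^sub>R t | u v s t. u \<ge> 0 \<and> v \<ge> 0 \<and> u + v = 1 \<and> s \<in> convex hull S \<and> t \<in> convex hull C}"
      using convex_hull_union_two[of "convex hull S" "convex hull C"] that ne hull_Un[of convex S C]
      by (auto simp: convex_Inter)
    then obtain u v s t where x: "x = u *\<^sub>R s + v *\<^sub>R t" "u \<ge> 0" "v \<ge> 0" "u + v = 1" "s \<in> convex hull S" "t \<in> convex hull C"
      by blast
    then have "u = 1 - v" by simp
    then show ?thesis using x by (intro exI[of _ v] exI[of _ s] exI[of _ t]) auto
  qed
  show "convex hull (A \<union> C) \<inter> convex hull (B \<union> C) \<subseteq> convex hull C"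
  proof
    fix x assume x: "x \<in> convex hull (A \<union> C) \<inter> convex hull (B \<union> C)"
    obtain r a c where r: "0 \<le> r" "r \<le> 1" "c \<in> convex hull C" "x = (1-r) *\<^sub>R a + r *\<^sub>R c" "a \<in> convex hull A"
      using Un[of A x] x ne by blast
    obtain t b d where t: "0 \<le> t" "t \<le> 1" "d \<in> convex hull C" "x = (1-t) *\<^sub>R b + t *\<^sub>R d" "b \<in> convex hull B"
      using Un[of B x] x ne by blast
    obtain m where m: "m \<in> closed_segment a b" "m \<in> convex hull C" using cross[OF r(5) t(5)] by blast
    obtain l where l: "0 \<le> l" "l \<le> 1" "m = (1-l) *\<^sub>R a + l *\<^sub>R b" using m(1) by (auto simp: in_segment)
    show "x \<in> convex hull C"
    proof (cases "r = 1 \<or> t = 1")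
      case True then show ?thesis using r t by auto
    next
      case False
      define \<alpha> where "\<alpha> = (1-l)/(1-r)"
      define \<beta> where "\<beta> = l/(1-t)"
      have ab: "\<alpha> \<ge> 0" "\<beta> \<ge> 0" "\<alpha>*(1-r) = 1-l" "\<beta>*(1-t) = l"
        using False r t l by (auto simp: \<alpha>_def \<beta>_def)
      have pos: "\<alpha> + \<beta> > 0" using ab l by (smt (verit) mult_eq_0_iff)
      have *: "(\<alpha> + \<beta>) *\<^sub>R x = (\<alpha>*r) *\<^sub>R c + (\<beta>*t) *\<^sub>R d + m"
      proof -
        have "(\<alpha> + \<beta>) *\<^sub>R x = \<alpha> *\<^sub>R ((1-r) *\<^sub>R a + r *\<^sub>R c) + \<beta> *\<^sub>R ((1-t) *\<^sub>R b + t *\<^sub>R d)"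
          using r(4) t(4) by (simp add: scaleR_add_left)
        also have "\<dots> = (\<alpha>*(1-r)) *\<^sub>R a + (\<alpha>*r) *\<^sub>R c + (\<beta>*(1-t)) *\<^sub>R b + (\<beta>*t) *\<^sub>R d"
          by (simp add: scaleR_add_right)
        finally show ?thesis using ab l(3) by (simp add: add_ac)
      qed
      have sum: "\<alpha>*r + \<beta>*t + 1 = \<alpha> + \<beta>" using ab(3,4) by (simp add: algebra_simps)
      have "x = (1/(\<alpha>+\<beta>)) *\<^sub>R ((\<alpha> + \<beta>) *\<^sub>R x)" using pos by simp
      then have xe: "x = (\<alpha>*r/(\<alpha>+\<beta>)) *\<^sub>R c + (\<beta>*t/(\<alpha>+\<beta>)) *\<^sub>R d + (1/(\<alpha>+\<beta>)) *\<^sub>R m"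
        unfolding * by (simp add: scaleR_add_right)
      have "\<alpha>*r/(\<alpha>+\<beta>) + \<beta>*t/(\<alpha>+\<beta>) + 1/(\<alpha>+\<beta>) = 1"
        using sum pos by (simp add: add_divide_distrib[symmetric])
      then have "x \<in> convex hull {c, d, m}" unfolding convex_hull_3 xe
        using r t ab pos by fastforce
      moreover have "convex hull {c, d, m} \<subseteq> convex hull C"
        using r t m(2) by (intro hull_minimal) auto
      ultimately show ?thesis by blast
    qed
  qed
qed

section \<open>Rotations and the Steiner point\<close>

definition rot :: "real \<Rightarrow> real^2^2" where
  "rot \<theta> = vector [vector [cos \<theta>, - sin \<theta>], vector [sin \<theta>, cos \<theta>]]"

lemma rot_apply:
  "rot \<theta> *v x = vector [cos \<theta> * x$1 - sin \<theta> * x$2, sin \<theta> * x$1 + cos \<theta> * x$2]"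
  by (simp add: rot_def vec_eq_iff forall_2 matrix_vector_mult_def sum_2 vector_2)

lemma rot_rot: "rot a *v (rot b *v x) = rot (a + b) *v x"
  by (simp add: rot_apply vec_eq_iff forall_2 vector_2 cos_add sin_add algebra_simps)

lemma rot_0 [simp]: "rot 0 *v x = x"
  by (simp add: rot_apply vec_eq_iff forall_2 vector_2)

lemma rot_pi: "rot pi *v x = - x"
  by (simp add: rot_apply vec_eq_iff forall_2 vector_2)

lemma rot_eq_cos_sin: "rot \<theta> *v w = cos \<theta> *\<^sub>R w + sin \<theta> *\<^sub>R (rot (pi/2) *v w)"
  by (simp add: rot_apply vec_eq_iff forall_2 vector_2)

lemma rot_minus: "rot a *v (- x) = - (rot a *v x)"
  by (simp add: rot_apply vec_eq_iff forall_2 vector_2)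

lemma transpose_rot: "transpose (rot a) = rot (- a)"
  by (simp add: rot_def vec_eq_iff forall_2 vector_2 transpose_def)

lemma rot_unit_dir: "rot a *v unit_dir b = unit_dir (a + b)"
  by (simp add: rot_apply unit_dir_def vec_eq_iff forall_2 vector_2 cos_add sin_add algebra_simps)

lemma inner_rot: "inner (rot a *v x) y = inner x (rot (- a) *v y)"
  by (simp add: rot_apply inner_vec_def sum_2 vector_2 algebra_simps)

lemma norm_rot [simp]: "norm (rot a *v x) = norm x"
proof -
  have "inner (rot a *v x) (rot a *v x) = inner x x" by (simp add: inner_rot rot_rot)
  then show ?thesis by (simp add: norm_eq_sqrt_inner)
qed

lemma SO2_eq_range_rot: "SO2 = range rot"
proof
  show "range rot \<subseteq> SO2"
    unfolding SO2_def orthogonal_matrix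
    by (auto simp: rot_def vec_eq_iff forall_2 vector_2 transpose_def matrix_matrix_mult_def sum_2 mat_def det_2
        power2_eq_square[symmetric] sin_squared_eq)
  show "SO2 \<subseteq> range rot"
  proof
    fix g assume "g \<in> SO2"
    then have o: "transpose g ** g = mat 1" and d: "det g = 1" unfolding SO2_def orthogonal_matrix by auto
    from o have e: "g$1$1 * g$1$1 + g$2$1 * g$2$1 = 1" "g$1$1 * g$1$2 + g$2$1 * g$2$2 = 0"
      "g$1$2 * g$1$2 + g$2$2 * g$2$2 = 1"
      by (simp_all add: vec_eq_iff forall_2 transpose_def matrix_matrix_mult_def sum_2 mat_def)
    have d': "g$1$1 * g$2$2 - g$1$2 * g$2$1 = 1" using d by (simp add: det_2)
    \<comment> \<open>Inserting the squared norm 1 of the first column lets orthogonality and the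
      determinant be substituted; the second column turns out to be the first one turned by a
      quarter.\<close>
    have "g$2$2 = (g$1$1 * g$1$1 + g$2$1 * g$2$1) * g$2$2" using e by simp
    also have "\<dots> = g$1$1 * (g$1$1 * g$2$2 - g$1$2 * g$2$1) + g$2$1 * (g$1$1 * g$1$2 + g$2$1 * g$2$2)"
      by (simp add: algebra_simps)
    finally have a: "g$2$2 = g$1$1" using d' e by simp
    have "g$1$2 = (g$1$1 * g$1$1 + g$2$1 * g$2$1) * g$1$2" using e by simp
    also have "\<dots> = g$1$1 * (g$1$1 * g$1$2 + g$2$1 * g$2$2) - g$2$1 * (g$1$1 * g$2$2 - g$1$2 * g$2$1)"
      by (simp add: algebra_simps)
    finally have b: "g$1$2 = - g$2$1" using d' e by simp
    obtain t where "g$1$1 = cos t" "g$2$1 = sin t"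
      using sincos_total_2pi[of "g$1$1" "g$2$1"] e(1) by (auto simp: power2_eq_square)
    then have "g = rot t" using a b by (simp add: rot_def vec_eq_iff forall_2 vector_2)
    then show "g \<in> range rot" by blast
  qed
qed

section \<open>The Steiner point as a linear functional\<close>

lemma unit_dir_eq: "unit_dir \<theta> = cos \<theta> *\<^sub>R axis 1 1 + sin \<theta> *\<^sub>R axis 2 1"
  by (simp add: unit_dir_def vec_eq_iff forall_2 vector_2 axis_def)

lemma norm_unit_dir [simp]: "norm (unit_dir \<theta>) = 1"
  by (simp add: unit_dir_def norm_eq_sqrt_inner inner_vec_def sum_2 vector_2 power2_eq_square[symmetric])

lemma unit_dir_periodic: "unit_dir (\<theta> + 2 * pi) = unit_dir \<theta>"
  by (simp add: unit_dir_def)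

lemma continuous_on_unit_dir [continuous_intros]:
  fixes S :: "real set"
  shows "continuous_on S f \<Longrightarrow> continuous_on S (\<lambda>x. unit_dir (f x))"
  unfolding unit_dir_eq by (intro continuous_intros)

text \<open>Defined for functions instead of bodies, so that it also applies to linear functions and
  to differences that are not support functions.\<close>

definition steiner :: "(pt \<Rightarrow> real) \<Rightarrow> pt" where
  "steiner f = (1 / pi) *\<^sub>R integral {0..2*pi} (\<lambda>\<theta>. f (unit_dir \<theta>) *\<^sub>R unit_dir \<theta>)"

lemma steiner_point_eq: "steiner_point K = steiner (support_fun K)"
  by (simp add: steiner_point_def steiner_def)

lemma continuous_on_steiner_integrand:
  assumes "continuous_on UNIV f"
  shows "continuous_on S (\<lambda>\<theta>. f (unit_dir \<theta>) *\<^sub>R unit_dir \<theta>)"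
  by (intro continuous_intros continuous_on_compose2[OF assms]) auto

lemma integrable_steiner:
  assumes "continuous_on UNIV f"
  shows "(\<lambda>\<theta>. f (unit_dir \<theta>) *\<^sub>R unit_dir \<theta>) integrable_on {a..b}"
  by (intro integrable_continuous_real continuous_on_steiner_integrand assms)

lemma steiner_add:
  assumes "continuous_on UNIV f" "continuous_on UNIV g"
  shows "steiner (\<lambda>x. f x + g x) = steiner f + steiner g"
  unfolding steiner_def using assms
  by (simp add: scaleR_add_left integral_add integrable_steiner scaleR_add_right)

lemma steiner_cmul: "steiner (\<lambda>x. c * f x) = c *\<^sub>R steiner f"
  unfolding steiner_def scaleR_scaleR[symmetric] integral_cmul by (simp add: mult.commute)

lemma steiner_diff:
  assumes "continuous_on UNIV f" "continuous_on UNIV g"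
  shows "steiner (\<lambda>x. f x - g x) = steiner f - steiner g"
  unfolding steiner_def using assms
  by (simp add: scaleR_diff_left integral_diff integrable_steiner scaleR_diff_right)

text \<open>This is where the factor 1/pi comes from: over a period the squares of cosine and sine
  integrate to pi, their product to 0. It allows a linear term to be recovered from a Steiner
  point.\<close>

lemma steiner_inner: "steiner (\<lambda>x. inner x p) = p"
proof -
  have c: "((\<lambda>\<theta>. cos \<theta> * cos \<theta>) has_integral pi) {0..2*pi}"
  proof -
    have "((\<lambda>\<theta>. cos \<theta> * cos \<theta>) has_integral
       (\<lambda>\<theta>. (\<theta> + sin \<theta> * cos \<theta>) / 2) (2*pi) - (\<lambda>\<theta>. (\<theta> + sin \<theta> * cos \<theta>) / 2) 0) {0..2*pi}"
    proof (rule fundamental_theorem_of_calculus)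
      fix x :: real
      have "(1 + (cos x * cos x - sin x * sin x)) / 2 = cos x * cos x"
        using sin_cos_squared_add[of x] by (simp add: power2_eq_square)
      then show "((\<lambda>\<theta>. (\<theta> + sin \<theta> * cos \<theta>) / 2) has_vector_derivative cos x * cos x) (at x within {0..2*pi})"
        unfolding has_real_derivative_iff_has_vector_derivative[symmetric]
        by (auto intro!: derivative_eq_intros)
    qed simp
    then show ?thesis by simp
  qed
  have s: "((\<lambda>\<theta>. sin \<theta> * sin \<theta>) has_integral pi) {0..2*pi}"
  proof -
    have "((\<lambda>\<theta>. 1 - cos \<theta> * cos \<theta>) has_integral (2 * pi - pi)) {0..2*pi}"
      using has_integral_const_real[of "1::real" 0 "2*pi"] by (intro has_integral_diff c) simp
    moreover have "1 - cos \<theta> * cos \<theta> = sin \<theta> * sin \<theta>" for \<theta> :: real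
      using sin_cos_squared_add[of \<theta>] by (simp add: power2_eq_square algebra_simps)
    ultimately show ?thesis by simp
  qed
  have sc: "((\<lambda>\<theta>. sin \<theta> * cos \<theta>) has_integral 0) {0..2*pi}"
  proof -
    have "((\<lambda>\<theta>. sin \<theta> * cos \<theta>) has_integral
       (\<lambda>\<theta>. (sin \<theta>)\<^sup>2 / 2) (2*pi) - (\<lambda>\<theta>. (sin \<theta>)\<^sup>2 / 2) 0) {0..2*pi}"
      by (rule fundamental_theorem_of_calculus)
        (auto intro!: derivative_eq_intros simp: has_real_derivative_iff_has_vector_derivative[symmetric])
    then show ?thesis by simp
  qed
  have "((\<lambda>\<theta>. (p$1 * (cos \<theta> * cos \<theta>) + p$2 * (sin \<theta> * cos \<theta>)) *\<^sub>R axis 1 1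
      + (p$1 * (sin \<theta> * cos \<theta>) + p$2 * (sin \<theta> * sin \<theta>)) *\<^sub>R axis 2 1 :: pt)
      has_integral (p$1 * pi + p$2 * 0) *\<^sub>R axis 1 1 + (p$1 * 0 + p$2 * pi) *\<^sub>R axis 2 1) {0..2*pi}"
    by (intro has_integral_add has_integral_scaleR_left has_integral_mult_right c s sc)
  moreover have "(p$1 * (cos \<theta> * cos \<theta>) + p$2 * (sin \<theta> * cos \<theta>)) *\<^sub>R axis 1 1
      + (p$1 * (sin \<theta> * cos \<theta>) + p$2 * (sin \<theta> * sin \<theta>)) *\<^sub>R axis 2 1
      = inner (unit_dir \<theta>) p *\<^sub>R unit_dir \<theta>" for \<theta>
    by (simp add: unit_dir_def inner_vec_def sum_2 vec_eq_iff forall_2 vector_2 axis_def algebra_simps)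
  moreover have "(p$1 * pi + p$2 * 0) *\<^sub>R axis 1 1 + (p$1 * 0 + p$2 * pi) *\<^sub>R axis 2 1 = pi *\<^sub>R p"
    by (simp add: vec_eq_iff forall_2 axis_def)
  ultimately have "((\<lambda>\<theta>. inner (unit_dir \<theta>) p *\<^sub>R unit_dir \<theta>) has_integral pi *\<^sub>R p) {0..2*pi}"
    by simp
  then show ?thesis unfolding steiner_def by (simp add: integral_unique)
qed

lemma integral_periodic_shift:
  fixes F :: "real \<Rightarrow> pt"
  assumes c: "continuous_on UNIV F" and p: "\<And>x. F (x + P) = F x" and P: "P > 0"
  shows "integral {0..P} (\<lambda>x. F (x + a)) = integral {0..P} F"
proof -
  have int: "F integrable_on {u..v}" for u v
    using c by (intro integrable_continuous_real) (auto intro: continuous_on_subset)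
  have sh: "integral {u..v} (\<lambda>x. F (x + d)) = integral {u + d..v + d} F" for u v d
    using integral_shift_Icc_real[of "u" "v" F d] by (simp add: add.commute o_def)
  have pos: "integral {0..P} (\<lambda>x. F (x + a)) = integral {0..P} F" if a: "a \<ge> 0" for a
  proof -
    have "integral {0..a} F + integral {a..a+P} F = integral {0..a+P} F"
      using a P by (intro Henstock_Kurzweil_Integration.integral_combine int) auto
    moreover have "integral {0..P} F + integral {P..a+P} F = integral {0..a+P} F"
      using a P by (intro Henstock_Kurzweil_Integration.integral_combine int) auto
    moreover have "integral {P..a+P} F = integral {0..a} F"
      using sh[of 0 a P] by (simp add: p)
    ultimately have "integral {a..a+P} F = integral {0..P} F" by (metis add.commute add_left_imp_eq)
    then show ?thesis using sh[of 0 P a] by (simp add: add.commute)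
  qed
  \<comment> \<open>Adding enough periods reduces a negative shift to a nonnegative one.\<close>
  have per: "F (x + real n * P) = F x" for x n
  proof (induction n)
    case (Suc n) then show ?case using p[of "x + real n * P"] by (simp add: algebra_simps)
  qed simp
  obtain n where n: "real n * P > - a" using reals_Archimedean3[OF P] by blast
  have "integral {0..P} (\<lambda>x. F (x + (a + real n * P))) = integral {0..P} F"
    using n by (intro pos) auto
  then show ?thesis using per[of "_ + a" n] by (simp add: add.assoc)
qed

text \<open>Shifting the angle moves the rotation from the argument of \<open>f\<close> to the
  vector \<open>unit_dir\<close>, where it leaves the integral by linearity.\<close>

lemma steiner_rot:
  assumes "continuous_on UNIV f"
  shows "steiner (\<lambda>x. f (rot (- a) *v x)) = rot a *v steiner f"
proof -
  let ?F = "\<lambda>\<theta>. f (unit_dir \<theta>) *\<^sub>R unit_dir \<theta>"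
  let ?G = "\<lambda>\<theta>. f (unit_dir \<theta>) *\<^sub>R unit_dir (\<theta> + a)"
  have bl: "bounded_linear (\<lambda>x. rot a *v x)"
    by (rule matrix_vector_mul_bounded_linear)
  have "integral {0..2*pi} ((\<lambda>x. rot a *v x) \<circ> ?F) = rot a *v integral {0..2*pi} ?F"
    by (rule integral_linear[OF integrable_steiner[OF assms] bl])
  moreover have "((\<lambda>x. rot a *v x) \<circ> ?F) = ?G"
    by (auto simp: matrix_vector_mult_scaleR rot_unit_dir add.commute)
  moreover have "integral {0..2*pi} (\<lambda>\<theta>. ?G (\<theta> + (- a))) = integral {0..2*pi} ?G"
    by (rule integral_periodic_shift)
      (auto intro!: continuous_intros continuous_on_compose2[OF assms] simp: unit_dir_periodic
         add.commute add.left_commute simp flip: add.assoc)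
  ultimately show ?thesis unfolding steiner_def
    by (simp add: rot_unit_dir matrix_vector_mult_scaleR)
qed

lemma steiner_uminus:
  assumes "continuous_on UNIV f"
  shows "steiner (\<lambda>x. f (- x)) = - steiner f"
proof -
  have "rot (- pi) *v x = - x" for x by (simp add: rot_apply vec_eq_iff forall_2 vector_2)
  then show ?thesis using steiner_rot[OF assms, of pi] by (simp add: rot_pi)
qed

lemma steiner_even:
  assumes "continuous_on UNIV f" "\<And>x. f (- x) = f x"
  shows "steiner f = 0"
proof -
  have "steiner f = - steiner f" using steiner_uminus[OF assms(1)] assms(2) by simp
  then show ?thesis by (simp add: vec_eq_iff)
qed

text \<open>The constant is the length 2 * pi of the circle times the factor 1/pi.\<close>

lemma steiner_bound:
  assumes f: "continuous_on UNIV f" and g: "continuous_on UNIV g"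
    and e: "\<And>x. norm x = 1 \<Longrightarrow> \<bar>f x - g x\<bar> \<le> e"
  shows "norm (steiner f - steiner g) \<le> 2 * e"
proof -
  have "norm (integral {0..2*pi} (\<lambda>\<theta>. (f (unit_dir \<theta>) - g (unit_dir \<theta>)) *\<^sub>R unit_dir \<theta>)) \<le> e * (2*pi - 0)"
    using f g e
    by (intro integral_bound continuous_on_steiner_integrand[of "\<lambda>x. f x - g x"] continuous_intros) auto
  then have "norm (steiner (\<lambda>x. f x - g x)) \<le> 2 * e"
    unfolding steiner_def by (simp add: field_simps)
  then show ?thesis using f g by (simp add: steiner_diff)
qed

lemma continuous_on_support_fun:
  assumes K: "convex_body K"
  shows "continuous_on UNIV (support_fun K)"
proof -
  obtain R where R: "\<And>y. y \<in> K \<Longrightarrow> norm y \<le> R" "R > 0"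
    using K compact_imp_bounded bounded_pos unfolding convex_body_def by metis
  have l: "support_fun K x - support_fun K y \<le> R * dist x y" for x y
  proof -
    have "support_fun K x \<le> support_fun K (x - y) + support_fun K y"
      using support_fun_add_le[OF K, of "x - y" y] by simp
    moreover have "support_fun K (x - y) \<le> R * dist x y"
    proof (rule support_fun_le[OF K])
      fix k assume "k \<in> K"
      then have "norm (x - y) * norm k \<le> norm (x - y) * R" by (intro mult_left_mono R) auto
      then show "inner (x - y) k \<le> R * dist x y"
        using norm_cauchy_schwarz[of "x - y" k] by (simp add: dist_norm mult.commute)
    qed
    ultimately show ?thesis by linarith
  qed
  have "R-lipschitz_on UNIV (support_fun K)"
  proof (rule lipschitz_onI)
    fix x y show "dist (support_fun K x) (support_fun K y) \<le> R * dist x y"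
      using l[of x y] l[of y x] by (simp add: dist_real_def dist_commute abs_le_iff)
  qed (use R in auto)
  then show ?thesis by (rule lipschitz_on_continuous_on)
qed

lemma continuous_on_support_fun_comp [continuous_intros]:
  "convex_body K \<Longrightarrow> continuous_on S f \<Longrightarrow> continuous_on S (\<lambda>x. support_fun K (f x))"
  using continuous_on_compose2[OF continuous_on_support_fun, of K S f] by auto

section \<open>Additive functions, areas and parametrized polygons\<close>

text \<open>Cauchy's equation: rational fractions of \<open>M\<close> follow from additivity, the
  others by continuity. The interval excludes 0 because the dissections to which it is applied need
  positive parameters.\<close>

lemma additive_interval:
  fixes f :: "real \<Rightarrow> 'a::real_normed_vector"
  assumes add: "\<And>s t. 0 < s \<Longrightarrow> 0 < t \<Longrightarrow> s + t \<le> M \<Longrightarrow> f (s + t) = f s + f t"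
    and cont: "continuous_on {0<..M} f" and s: "0 < s" "s \<le> M"
  shows "f s = (s / M) *\<^sub>R f M"
proof -
  have M: "M > 0" using s by simp
  have mult: "f (real (Suc k) * x) = real (Suc k) *\<^sub>R f x" if "x > 0" "real (Suc k) * x \<le> M" for k x
    using that
  proof (induction k)
    case (Suc k)
    have e: "real (Suc (Suc k)) * x = real (Suc k) * x + x" by (simp add: algebra_simps)
    have le: "real (Suc k) * x \<le> M" using Suc.prems e by linarith
    have "f (real (Suc k) * x + x) = f (real (Suc k) * x) + f x"
      using Suc.prems e by (intro add) (auto intro!: mult_pos_pos)
    then show ?case using Suc.IH[OF Suc.prems(1) le] e by (simp add: algebra_simps scaleR_2)
  qed simp
  have mult': "f (real n * x) = real n *\<^sub>R f x" if "n > 0" "x > 0" "real n * x \<le> M" for n x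
    using mult[of x "n - 1"] that by (simp add: of_nat_diff)
  have frac: "f (M * (real k / real n)) = (real k / real n) *\<^sub>R f M" if kn: "0 < k" "k \<le> n" for k n
  proof -
    have "real n * (M / real n) = M" using kn by simp
    then have "f M = real n *\<^sub>R f (M / real n)" using mult'[of n "M / real n"] M kn by simp
    moreover have "f (real k * (M / real n)) = real k *\<^sub>R f (M / real n)"
    proof (rule mult')
      have "real k * M \<le> real n * M" using kn M by (intro mult_right_mono) auto
      then show "real k * (M / real n) \<le> M" using kn by (simp add: divide_le_eq mult.commute)
    qed (use kn M in auto)
    moreover have "M * (real k / real n) = real k * (M / real n)" by simp
    ultimately show ?thesis using kn by (simp add: mult.commute)
  qed
  \<comment> \<open>Rounding down keeps \<open>k n / n\<close> at most \<open>s / M\<close>, so the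
    approximations never pass \<open>M\<close>; they are positive from some \<open>n\<close> on
    because \<open>s\<close> is.\<close>
  define k where "k n = nat \<lfloor>real n * (s / M)\<rfloor>" for n
  have k_bounds: "real (k n) \<le> real n * (s / M)" "real n * (s / M) - 1 \<le> real (k n)" for n
  proof -
    have "real n * (s / M) \<ge> 0" using s M by simp
    then have e: "real (k n) = of_int \<lfloor>real n * (s / M)\<rfloor>" unfolding k_def by (rule of_nat_nat[OF iffD2[OF zero_le_floor]])
    show "real (k n) \<le> real n * (s / M)" unfolding e by (rule of_int_floor_le)
    show "real n * (s / M) - 1 \<le> real (k n)" unfolding e by (rule less_imp_le[OF real_of_int_floor_gt_diff_one])
  qed
  have kle: "k n \<le> n" for n
  proof -
    have "real n * (s / M) \<le> real n * 1" using s M by (intro mult_left_mono) auto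
    then have "real (k n) \<le> real n" using k_bounds(1)[of n] by simp
    then show ?thesis by simp
  qed
  have lim: "(\<lambda>n. real (k n) / real n) \<longlonglongrightarrow> s / M"
  proof (rule tendsto_sandwich)
    show "\<forall>\<^sub>F n in sequentially. s / M - 1 / real n \<le> real (k n) / real n"
      using eventually_gt_at_top[of 0]
    proof eventually_elim
      case (elim n)
      have "(real n * (s / M) - 1) / real n \<le> real (k n) / real n"
        using k_bounds by (intro divide_right_mono) auto
      then show ?case using elim by (simp add: diff_divide_distrib)
    qed
    show "\<forall>\<^sub>F n in sequentially. real (k n) / real n \<le> s / M"
      using eventually_gt_at_top[of 0]
    proof eventually_elim
      case (elim n)
      have "real (k n) / real n \<le> real n * (s / M) / real n"
        using k_bounds by (intro divide_right_mono) auto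
      then show ?case using elim by simp
    qed
    show "(\<lambda>n. s / M - 1 / real n) \<longlonglongrightarrow> s / M"
      using tendsto_diff[OF tendsto_const lim_1_over_n, of "s / M"] by simp
  qed simp
  have ev: "\<forall>\<^sub>F n in sequentially. 0 < k n"
  proof -
    have "s / M > 0" using s M by simp
    then show ?thesis by (rule eventually_mono[OF order_tendstoD(1)[OF lim]]) (auto intro: gr0I)
  qed
  have "(\<lambda>n. M * (real (k n) / real n)) \<longlonglongrightarrow> M * (s / M)" by (rule tendsto_mult[OF tendsto_const lim])
  then have "(\<lambda>n. f (M * (real (k n) / real n))) \<longlonglongrightarrow> f s"
  proof (intro continuous_on_tendsto_compose[OF cont])
    show "\<forall>\<^sub>F n in sequentially. M * (real (k n) / real n) \<in> {0<..M}"
      using ev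
    proof eventually_elim
      case (elim n)
      have "real (k n) / real n \<le> 1" "real (k n) / real n > 0" using kle[of n] elim by (auto simp: divide_le_eq)
      then have "M * (real (k n) / real n) \<le> M * 1" "M * (real (k n) / real n) > 0"
        using M by (intro mult_left_mono mult_pos_pos; auto)+
      then show ?case by simp
    qed
  qed (use s M in auto)
  moreover have "(\<lambda>n. (real (k n) / real n) *\<^sub>R f M) \<longlonglongrightarrow> (s / M) *\<^sub>R f M" by (rule tendsto_scaleR[OF lim tendsto_const])
  moreover have "\<forall>\<^sub>F n in sequentially. f (M * (real (k n) / real n)) = (real (k n) / real n) *\<^sub>R f M"
    using ev by eventually_elim (use frac kle in auto)
  ultimately show ?thesis
    by (intro LIMSEQ_unique[of "\<lambda>n. f (M * (real (k n) / real n))"]) (simp_all add: tendsto_cong)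
qed

text \<open>The interval up to \<open>max s 1\<close> contains both \<open>s\<close> and 1, and
  their values are multiples of one common value.\<close>

lemma additive_ray:
  fixes f :: "real \<Rightarrow> 'a::real_normed_vector"
  assumes add: "\<And>s t. 0 < s \<Longrightarrow> 0 < t \<Longrightarrow> f (s + t) = f s + f t"
    and cont: "continuous_on {0<..} f" and s: "0 < s"
  shows "f s = s *\<^sub>R f 1"
proof -
  let ?M = "max s 1"
  have *: "f t = (t / ?M) *\<^sub>R f ?M" if "0 < t" "t \<le> ?M" for t
    using that by (intro additive_interval add) (auto intro: continuous_on_subset[OF cont])
  have "f 1 = (1 / ?M) *\<^sub>R f ?M" "f s = (s / ?M) *\<^sub>R f ?M" by (rule *; use s in simp)+
  moreover have "s / ?M = s * (1 / ?M)" by simp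
  ultimately show ?thesis by (metis scaleR_scaleR)
qed

section \<open>Determinants and areas\<close>

definition cross :: "pt \<Rightarrow> pt \<Rightarrow> real" where
  "cross x y = x$1 * y$2 - x$2 * y$1"

lemma cross_rot [simp]: "cross (rot a *v x) (rot a *v y) = cross x y"
proof -
  have "cross (rot a *v x) (rot a *v y) = (sin a * sin a + cos a * cos a) * cross x y"
    unfolding cross_def rot_apply vector_2 by algebra
  then show ?thesis by (simp add: sin_cos_squared_add3 add.commute)
qed

lemma area_eq_content: "convex_body K \<Longrightarrow> area K = measure lborel K"
  unfolding area_def convex_body_def by (intro measure_completion) (simp add: compact_imp_closed borel_closed)

lemma area_triangle: "area (convex hull {p, q, r}) = \<bar>cross (q - p) (r - p)\<bar> / 2"
  by (simp add: area_eq_content convex_body_hull content_triangle cross_def algebra_simps abs_minus_commute)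

lemma area_mono: "convex_body K \<Longrightarrow> convex_body L \<Longrightarrow> K \<subseteq> L \<Longrightarrow> area K \<le> area L"
  unfolding area_def convex_body_def by (intro measure_mono_fmeasurable) (auto intro: lmeasurable_compact fmeasurableD)

lemma area_affine: "area ((\<lambda>x. r *\<^sub>R x + t) ` K) = r\<^sup>2 * area K"
  unfolding area_def using measure_lebesgue_affine[of r t K] by simp

lemma area_scaleR: "area ((\<lambda>x. r *\<^sub>R x) ` K) = r\<^sup>2 * area K"
  using area_affine[of r 0 K] by simp

lemma area_translation: "area ((\<lambda>x. x + t) ` K) = area K"
  using area_affine[of 1 t K] by simp

lemma area_rot: "convex_body K \<Longrightarrow> area ((\<lambda>x. rot a *v x) ` K) = area K"
proof -
  assume K: "convex_body K"
  have "det (rot a) = 1"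
    using SO2_eq_range_rot unfolding SO2_def by blast
  then show ?thesis unfolding area_def using K
    by (subst measure_linear_image) (auto simp: convex_body_def lmeasurable_compact)
qed

lemma area_nonneg: "area K \<ge> 0" by (simp add: area_def)

lemma area_segment: "area (convex hull {p, q}) = 0"
  using area_triangle[of p q q] by (simp add: cross_def)

lemma area_point: "area {p} = 0"
  using area_segment[of p p] by simp

text \<open>A convex body contains the triangle spanned by any three of its points. This is how area
  0, obtained from (VC), restricts the images of points and segments.\<close>

lemma cross_eq_0_if_area_eq_0:
  assumes K: "convex_body K" and a: "area K = 0" and pqr: "p \<in> K" "q \<in> K" "r \<in> K"
  shows "cross (q - p) (r - p) = 0"
proof -
  have "convex hull {p, q, r} \<subseteq> K" using K pqr unfolding convex_body_def by (intro hull_minimal) auto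
  then have "area (convex hull {p, q, r}) \<le> area K" using K by (intro area_mono convex_body_hull) auto
  then show ?thesis using a by (simp add: area_triangle)
qed

lemma cross_eq_0_imp:
  assumes "cross x y = 0" "x \<noteq> 0"
  obtains t where "y = t *\<^sub>R x"
proof (cases "x$1 = 0")
  case True
  then have "x$2 \<noteq> 0" using assms by (auto simp: vec_eq_iff forall_2)
  then show thesis using assms True by (intro that[of "y$2 / x$2"]) (auto simp: vec_eq_iff forall_2 cross_def field_simps)
next
  case False
  then show thesis using assms by (intro that[of "y$1 / x$1"]) (auto simp: vec_eq_iff forall_2 cross_def field_simps)
qed

lemma polar_form:
  obtains r a where "r \<ge> 0" "v = r *\<^sub>R unit_dir a"
proof (cases "v = 0")
  case True then show thesis using that[of 0 0] by simp
next
  case False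
  then have n: "norm v > 0" by simp
  have sq: "(v$1)\<^sup>2 + (v$2)\<^sup>2 = (norm v)\<^sup>2"
    by (simp only: power2_norm_eq_inner inner_vec_def sum_2) (simp only: inner_real_def power2_eq_square)
  have "(v$1 / norm v)\<^sup>2 + (v$2 / norm v)\<^sup>2 = ((v$1)\<^sup>2 + (v$2)\<^sup>2) / (norm v)\<^sup>2"
    by (simp add: power_divide add_divide_distrib)
  also have "\<dots> = 1" unfolding sq using n by simp
  finally obtain a where a: "v$1 / norm v = cos a" "v$2 / norm v = sin a"
    using sincos_total_2pi[of "v$1 / norm v" "v$2 / norm v"] by blast
  have "v$1 = norm v * cos a" "v$2 = norm v * sin a" using n by (simp_all flip: a)
  then have "v = norm v *\<^sub>R unit_dir a"
    by (simp only: unit_dir_def vec_eq_iff forall_2 vector_2 vector_scaleR_component) simp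
  then show thesis using that[of "norm v" a] by simp
qed

text \<open>The index set consists of the parametrized vertices themselves.\<close>
lemma continuous_on_hull_image:
  fixes F :: "pt set \<Rightarrow> 'b::metric_space" and I :: "(real \<Rightarrow> pt) set"
  assumes F: "\<And>K e. convex_body K \<Longrightarrow> e > 0 \<Longrightarrow>
      \<exists>d>0. \<forall>L. convex_body L \<longrightarrow> hausdorff_dist K L < d \<longrightarrow> dist (F K) (F L) < e"
    and I: "finite I" "I \<noteq> {}" and c: "\<And>p. p \<in> I \<Longrightarrow> continuous_on S p"
  shows "continuous_on S (\<lambda>s. F (convex hull ((\<lambda>p. p s) ` I)))"
  unfolding continuous_on_iff
proof (intro ballI allI impI)
  fix x e assume x: "x \<in> S" and e: "(e::real) > 0"
  let ?K = "\<lambda>s. convex hull ((\<lambda>p. p s) ` I)"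
  have body: "convex_body (?K s)" for s using I by (intro convex_body_hull) auto
  obtain d where d: "d > 0" "\<And>L. convex_body L \<Longrightarrow> hausdorff_dist (?K x) L < d \<Longrightarrow> dist (F (?K x)) (F L) < e"
    using F[OF body e] by blast
  have "\<forall>p\<in>I. \<exists>c>0. \<forall>y\<in>S. dist y x < c \<longrightarrow> dist (p y) (p x) < d / 2"
    using c x d(1) unfolding continuous_on_iff by (meson half_gt_zero)
  then obtain c where c: "\<And>p. p \<in> I \<Longrightarrow> c p > 0" "\<And>p y. p \<in> I \<Longrightarrow> y \<in> S \<Longrightarrow> dist y x < c p \<Longrightarrow> dist (p y) (p x) < d / 2"
    by metis
  show "\<exists>d>0. \<forall>x'\<in>S. dist x' x < d \<longrightarrow> dist (F (?K x')) (F (?K x)) < e"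
  proof (intro exI[of _ "Min (c ` I)"] conjI ballI impI)
    show "Min (c ` I) > 0" using I c by simp
    fix y assume y: "y \<in> S" "dist y x < Min (c ` I)"
    have "dist (p x) (p y) \<le> d / 2" if "p \<in> I" for p
      using c(2)[OF that y(1)] y(2) I that by (simp add: dist_commute)
    then have "hausdorff_dist (?K x) (?K y) \<le> d / 2"
      using I d by (intro hausdorff_dist_hull_le) auto
    then show "dist (F (?K y)) (F (?K x)) < e" using d body by (subst dist_commute) auto
  qed
qed

section \<open>Images of points and segments\<close>

locale rotation_endo =
  fixes \<Phi> :: "pt set \<Rightarrow> pt set"
  assumes maps: "convex_body K \<Longrightarrow> convex_body (\<Phi> K)"
    and cont: "hausdorff_continuous \<Phi>"
    and tinv: "translation_invariant \<Phi>"
    and val: "minkowski_valuation \<Phi>"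
    and vc: "VC \<Phi>"
    and cov: "SO2_covariant \<Phi>"
begin

abbreviation H :: "pt set \<Rightarrow> pt \<Rightarrow> real" where "H K \<equiv> support_fun (\<Phi> K)"

lemma H_Un_Int:
  assumes "convex_body K" "convex_body L" "convex_body (K \<union> L)" "K \<inter> L \<noteq> {}"
  shows "H (K \<union> L) x + H (K \<inter> L) x = H K x + H L x"
proof -
  have "\<Phi> K + \<Phi> L = \<Phi> (K \<union> L) + \<Phi> (K \<inter> L)" using val assms unfolding minkowski_valuation_def by blast
  moreover have "convex_body (K \<inter> L)" using assms by (intro convex_body_Int_nonempty)
  ultimately show ?thesis
    using support_fun_plus[OF maps maps, of K L x] support_fun_plus[OF maps maps, of "K \<union> L" "K \<inter> L" x] assms
    by simp
qed

text \<open>The only gateway to the valuation property: all later cuts of segments, parallelograms,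
  triangles and polygons are instances with suitable vertex sets.\<close>

lemma H_hull_crossing:
  assumes fin: "finite A" "finite B" "finite C" and ne: "A \<noteq> {}" "B \<noteq> {}" "C \<noteq> {}"
    and cross: "\<And>a b. a \<in> convex hull A \<Longrightarrow> b \<in> convex hull B \<Longrightarrow> closed_segment a b \<inter> convex hull C \<noteq> {}"
  shows "H (convex hull (A \<union> B \<union> C)) x + H (convex hull C) x = H (convex hull (A \<union> C)) x + H (convex hull (B \<union> C)) x"
proof -
  let ?A = "convex hull (A \<union> C)" and ?B = "convex hull (B \<union> C)"
  have "convex_body (convex hull (A \<union> B \<union> C))" "convex_body ?A" "convex_body ?B"
    using fin ne by (auto intro!: convex_body_hull)
  then show ?thesis
    using H_Un_Int[of ?A ?B x] hull_Un_crossing[OF ne cross] hull_Int_crossing[OF ne cross] ne by simp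
qed

lemma H_translation: "convex_body K \<Longrightarrow> H ((\<lambda>x. x + t) ` K) = H K"
  using tinv unfolding translation_invariant_def by simp

lemma H_hull_translation:
  assumes "finite S" "S \<noteq> {}"
  shows "H (convex hull ((\<lambda>x. x + t) ` S)) = H (convex hull S)"
  using H_translation[OF convex_body_hull[OF assms], of t] convex_hull_translation[of t S]
  by (simp add: add.commute)

lemma H_rot:
  assumes "convex_body K"
  shows "H ((\<lambda>x. rot a *v x) ` K) x = H K (rot (- a) *v x)"
proof -
  have "\<Phi> ((\<lambda>x. rot a *v x) ` K) = (\<lambda>x. rot a *v x) ` \<Phi> K"
    using cov assms SO2_eq_range_rot unfolding SO2_covariant_def by blast
  then show ?thesis using assms maps by (simp add: support_fun_matrix_image transpose_rot)
qed

lemma H_hull_rot: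
  assumes "finite S" "S \<noteq> {}"
  shows "H (convex hull ((\<lambda>x. rot a *v x) ` S)) x = H (convex hull S) (rot (- a) *v x)"
  using H_rot[OF convex_body_hull[OF assms], of a x] convex_hull_linear_image[of "\<lambda>x. rot a *v x" S]
  by simp

lemma H_hull_uminus:
  assumes "finite S" "S \<noteq> {}"
  shows "H (convex hull (uminus ` S)) x = H (convex hull S) (- x)"
proof -
  have "rot (- pi) *v x = - x" by (simp add: rot_apply vec_eq_iff forall_2 vector_2)
  then show ?thesis using H_hull_rot[OF assms, of pi x] by (simp add: rot_pi)
qed

text \<open>One radius \<open>d\<close> serves all unit vectors, which is needed to pass to Steiner
  points.\<close>

lemma H_continuous:
  assumes K: "convex_body K" and e: "e > 0"
  shows "\<exists>d>0. \<forall>L. convex_body L \<longrightarrow> hausdorff_dist K L < d \<longrightarrow> (\<forall>x. norm x = 1 \<longrightarrow> dist (H K x) (H L x) < e)"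
proof -
  obtain d where d: "d > 0" "\<And>L. convex_body L \<Longrightarrow> hausdorff_dist K L < d \<Longrightarrow> hausdorff_dist (\<Phi> K) (\<Phi> L) < e"
    using cont K e unfolding hausdorff_continuous_def by blast
  then show ?thesis
    using support_fun_le_hausdorff[OF maps[OF K] maps] by (fastforce simp: dist_real_def)
qed

lemma H_continuous_point:
  assumes K: "convex_body K" and e: "e > 0"
  shows "\<exists>d>0. \<forall>L. convex_body L \<longrightarrow> hausdorff_dist K L < d \<longrightarrow> dist (H K x) (H L x) < e"
proof (cases "x = 0")
  case True
  then show ?thesis using K e maps by (auto simp: support_fun_zero intro!: exI[of _ 1])
next
  case False
  have *: "H L x = norm x * H L (x /\<^sub>R norm x)" if "convex_body L" for L
    using that support_fun_scale[of "\<Phi> L" "norm x" "x /\<^sub>R norm x"] maps False by simp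
  obtain d where d: "d > 0" "\<And>L. convex_body L \<Longrightarrow> hausdorff_dist K L < d \<Longrightarrow>
      (\<forall>y. norm y = 1 \<longrightarrow> dist (H K y) (H L y) < e / norm x)"
    using H_continuous[OF K, of "e / norm x"] e False by auto
  have "dist (H K x) (H L x) < e" if L: "convex_body L" "hausdorff_dist K L < d" for L
  proof -
    have "dist (H K (x /\<^sub>R norm x)) (H L (x /\<^sub>R norm x)) < e / norm x" using d(2)[OF L] False by simp
    then have "norm x * dist (H K (x /\<^sub>R norm x)) (H L (x /\<^sub>R norm x)) < norm x * (e / norm x)"
      using False by (intro mult_strict_left_mono) auto
    moreover have "dist (H K x) (H L x) = norm x * dist (H K (x /\<^sub>R norm x)) (H L (x /\<^sub>R norm x))"
      unfolding dist_real_def by (subst *[OF K], subst *[OF L(1)])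
        (simp only: right_diff_distrib[symmetric] abs_mult abs_norm_cancel)
    ultimately show ?thesis using False by simp
  qed
  then show ?thesis using d(1) by blast
qed

lemma continuous_on_H_hull:
  fixes I :: "(real \<Rightarrow> pt) set"
  assumes "finite I" "I \<noteq> {}" "\<And>p. p \<in> I \<Longrightarrow> continuous_on S p"
  shows "continuous_on S (\<lambda>s. H (convex hull ((\<lambda>p. p s) ` I)) x)"
  by (rule continuous_on_hull_image[where F="\<lambda>K. H K x"]) (use H_continuous_point assms in auto)

lemma area_Phi_eq_0: "convex_body K \<Longrightarrow> area K = 0 \<Longrightarrow> area (\<Phi> K) = 0"
  using vc area_nonneg[of "\<Phi> K"] unfolding VC_def by force

text \<open>By covariance \<open>\<Phi> {0}\<close> is invariant under rotations, and by (VC) it has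
  area 0. A point \<open>y\<close> together with its quarter turn and its half turn spans a triangle
  of area |y|^2, so \<open>y\<close> is 0.\<close>

lemma Phi_point: "\<Phi> {p} = {0}"
proof -
  have b: "convex_body {q}" for q using convex_body_hull[of "{q}"] by simp
  have "\<Phi> {p} = \<Phi> {0}" using tinv b[of 0] unfolding translation_invariant_def by force
  moreover have "\<Phi> {0} = {0}"
  proof -
    have rotinv: "rot a *v y \<in> \<Phi> {0}" if "y \<in> \<Phi> {0}" for a y
    proof -
      have "\<Phi> ((\<lambda>x. rot a *v x) ` {0}) = (\<lambda>x. rot a *v x) ` \<Phi> {0}"
        using cov b SO2_eq_range_rot unfolding SO2_covariant_def by blast
      then have "\<Phi> {0} = (\<lambda>x. rot a *v x) ` \<Phi> {0}" by simp
      then show ?thesis using that by blast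
    qed
    have "y = 0" if y: "y \<in> \<Phi> {0}" for y
    proof -
      have "cross (rot pi *v y - y) (rot (pi/2) *v y - y) = 0"
        using cross_eq_0_if_area_eq_0[OF maps[OF b] area_Phi_eq_0[OF b area_point] y rotinv[OF y] rotinv[OF y]] .
      moreover have "cross (rot pi *v y - y) (rot (pi/2) *v y - y) = - 2 * (y$1 * y$1 + y$2 * y$2)"
        by (simp add: cross_def rot_apply vector_2) algebra
      ultimately have "- 2 * (y$1 * y$1 + y$2 * y$2) = 0" by metis
      then have "y$1 * y$1 + y$2 * y$2 = 0" unfolding mult_eq_0_iff by auto
      then have "y$1 = 0 \<and> y$2 = 0" by (rule iffD1[OF sum_squares_eq_zero_iff])
      then show ?thesis by (simp add: vec_eq_iff forall_2)
    qed
    moreover have "\<Phi> {0} \<noteq> {}" using maps[OF b] unfolding convex_body_def by blast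
    ultimately show ?thesis by blast
  qed
  ultimately show ?thesis by simp
qed

lemma H_point: "H {p} x = 0"
  unfolding Phi_point by (simp add: support_fun_def)

text \<open>The cut runs through the single point \<open>m\<close>, whose image {0} contributes
  nothing.\<close>

lemma H_split_segment:
  assumes "m \<in> closed_segment p q"
  shows "H (convex hull {p, q}) x = H (convex hull {p, m}) x + H (convex hull {m, q}) x"
proof -
  have "H (convex hull ({p} \<union> {q} \<union> {m})) x + H (convex hull {m}) x = H (convex hull ({p} \<union> {m})) x + H (convex hull ({q} \<union> {m})) x"
    by (rule H_hull_crossing) (use assms in auto)
  moreover have "convex hull ({p} \<union> {q} \<union> {m}) = convex hull {p, q}"
  proof -
    have "convex hull (insert m {p, q}) = convex hull {p, q}"
      using assms by (intro hull_redundant) (simp add: segment_convex_hull)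
    moreover have "{p} \<union> {q} \<union> {m} = insert m {p, q}" by auto
    ultimately show ?thesis by simp
  qed
  ultimately show ?thesis by (simp add: H_point insert_commute)
qed

lemma H_segment_translation: "H (convex hull {p, q}) = H (convex hull {0, q - p})"
  using H_hull_translation[of "{0, q - p}" p] by simp

lemma H_segment_scale:
  assumes "s \<ge> 0"
  shows "H (convex hull {0, s *\<^sub>R v}) x = s * H (convex hull {0, v}) x"
proof (cases "s = 0")
  case True then show ?thesis by (simp add: H_point)
next
  case False
  have "(\<lambda>s. H (convex hull {0, s *\<^sub>R v}) x) s = s *\<^sub>R (\<lambda>s. H (convex hull {0, s *\<^sub>R v}) x) 1"
  proof (rule additive_ray)
    fix s t :: real assume st: "0 < s" "0 < t"
    have "s *\<^sub>R v \<in> closed_segment 0 ((s + t) *\<^sub>R v)"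
      using st by (auto simp: in_segment intro!: exI[of _ "s / (s + t)"])
    from H_split_segment[OF this, of x] show "H (convex hull {0, (s + t) *\<^sub>R v}) x = H (convex hull {0, s *\<^sub>R v}) x + H (convex hull {0, t *\<^sub>R v}) x"
      using H_segment_translation[of "s *\<^sub>R v" "(s + t) *\<^sub>R v"] by (simp add: scaleR_add_left)
  next
    have "continuous_on {0<..} (\<lambda>s. H (convex hull ((\<lambda>p. p s) ` {\<lambda>s. 0, \<lambda>s. s *\<^sub>R v})) x)"
      by (rule continuous_on_H_hull) (auto intro!: continuous_intros)
    then show "continuous_on {0<..} (\<lambda>s. H (convex hull {0, s *\<^sub>R v}) x)" by simp
  qed (use assms False in auto)
  then show ?thesis by simp
qed

text \<open>Since \<open>- S\<close> is a translate of \<open>S\<close>, the image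
  \<open>\<Phi> S\<close> is centrally symmetric. As it also has area 0, it is the segment from
  \<open>- w\<close> to \<open>w\<close> for a point \<open>w\<close> of largest norm; the polar
  coordinates of \<open>w\<close> become \<kappa> and \<gamma>.\<close>

lemma H_unit_segment:
  obtains r a where "r \<ge> 0" "\<And>x. H (convex hull {0, unit_dir 0}) x = r * \<bar>inner x (unit_dir a)\<bar>"
proof -
  define S where "S = convex hull {0, unit_dir 0}"
  have S: "convex_body S" unfolding S_def by (rule convex_body_hull) auto
  have PS: "convex_body (\<Phi> S)" by (rule maps[OF S])
  have even: "H S (- x) = H S x" for x
    using H_hull_uminus[of "{0, unit_dir 0}" x] H_hull_translation[of "{0, unit_dir 0}" "- unit_dir 0"]
    by (simp add: S_def insert_commute)
  have "uminus ` \<Phi> S = \<Phi> S"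
    using PS convex_body_linear_image[OF bounded_linear.linear[OF bounded_linear_minus[OF bounded_linear_ident]] PS]
    by (intro convex_body_eqI) (simp_all add: support_fun_uminus_image even)
  then have sym: "- y \<in> \<Phi> S" if "y \<in> \<Phi> S" for y using that by blast
  have "\<exists>w\<in>\<Phi> S. \<forall>y\<in>\<Phi> S. norm y \<le> norm w"
    using PS unfolding convex_body_def
    by (intro continuous_attains_sup continuous_on_norm continuous_on_id) simp_all
  then obtain w where w: "w \<in> \<Phi> S" "\<And>y. y \<in> \<Phi> S \<Longrightarrow> norm y \<le> norm w" by blast
  have a0: "area (\<Phi> S) = 0" using area_Phi_eq_0[OF S] area_segment by (simp add: S_def)
  have H: "H S x = \<bar>inner x w\<bar>" for x
  proof -
    have le: "inner x y \<le> \<bar>inner x w\<bar>" if y: "y \<in> \<Phi> S" for y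
    proof (cases "w = 0")
      case True then show ?thesis using w(2)[OF y] by simp
    next
      case False
      have "cross (w - - w) (y - - w) = 0"
        by (rule cross_eq_0_if_area_eq_0[OF PS a0 sym[OF w(1)] w(1) y])
      then have "cross w y = 0" by (simp add: cross_def algebra_simps)
      then obtain t where t: "y = t *\<^sub>R w" using False by (rule cross_eq_0_imp)
      have "\<bar>t\<bar> \<le> 1" using w(2)[OF y] False by (simp add: t)
      then have "\<bar>t\<bar> * \<bar>inner x w\<bar> \<le> 1 * \<bar>inner x w\<bar>" by (intro mult_right_mono) auto
      then have "\<bar>inner x y\<bar> \<le> \<bar>inner x w\<bar>" by (simp add: t abs_mult)
      then show ?thesis by linarith
    qed
    show ?thesis
    proof (cases "inner x w \<ge> 0")
      case True then show ?thesis using w(1) le by (intro support_fun_eqI[of w]) auto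
    next
      case False then show ?thesis using sym[OF w(1)] le by (intro support_fun_eqI[of "- w"]) auto
    qed
  qed
  obtain r a where "r \<ge> 0" "w = r *\<^sub>R unit_dir a" by (rule polar_form)
  then show thesis using H by (intro that[of r a]) (auto simp: S_def abs_mult)
qed

text \<open>Every segment is a rotated, scaled and translated copy of the unit one, and because
  plane rotations commute the same \<open>r\<close> and \<open>a\<close> serve for all of
  them.\<close>

lemma H_segment:
  obtains r a where "r \<ge> 0" "\<And>p q x. H (convex hull {p, q}) (rot a *v x) = r * \<bar>inner x (q - p)\<bar>"
proof -
  obtain r a where r: "r \<ge> 0" "\<And>x. H (convex hull {0, unit_dir 0}) x = r * \<bar>inner x (unit_dir a)\<bar>"
    using H_unit_segment by blast
  have "H (convex hull {p, q}) (rot a *v x) = r * \<bar>inner x (q - p)\<bar>" for p q x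
  proof -
    obtain s b where s: "s \<ge> 0" "q - p = s *\<^sub>R unit_dir b" by (rule polar_form)
    have "H (convex hull {p, q}) (rot a *v x) = s * H (convex hull {0, unit_dir b}) (rot a *v x)"
      using s by (simp add: H_segment_translation[of p q] H_segment_scale)
    also have "H (convex hull {0, unit_dir b}) (rot a *v x) = H (convex hull {0, unit_dir 0}) (rot (- b) *v (rot a *v x))"
      using H_hull_rot[of "{0, unit_dir 0}" b "rot a *v x"] by (simp add: rot_unit_dir)
    also have "\<dots> = r * \<bar>inner x (unit_dir b)\<bar>"
      by (simp add: r(2) inner_rot rot_unit_dir)
    finally show ?thesis using s by (simp add: abs_mult)
  qed
  then show thesis using r(1) that by blast
qed

end

section \<open>Parallelograms\<close>

definition par :: "pt \<Rightarrow> pt \<Rightarrow> pt set" where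
  "par u v = convex hull {0, u, v, u + v}"

lemma convex_body_par: "convex_body (par u v)"
  unfolding par_def by (rule convex_body_hull) auto

lemma par_commute: "par u v = par v u"
  by (simp add: par_def insert_commute add.commute)

lemma par_scaleR: "par (s *\<^sub>R u) (s *\<^sub>R v) = (\<lambda>x. s *\<^sub>R x) ` par u v"
  using convex_hull_linear_image[of "\<lambda>x. s *\<^sub>R x" "{0, u, v, u + v}"]
  by (simp add: par_def scaleR_add_right)

lemma par_crossing:
  assumes s: "s > 0" "t > 0" and a: "a \<in> convex hull {0, v}"
    and b: "b \<in> convex hull {(s + t) *\<^sub>R u, (s + t) *\<^sub>R u + v}"
  shows "closed_segment a b \<inter> convex hull {s *\<^sub>R u, s *\<^sub>R u + v} \<noteq> {}"
proof -
  obtain \<alpha> where \<alpha>: "a = \<alpha> *\<^sub>R v" "0 \<le> \<alpha>" "\<alpha> \<le> 1" using a by (auto simp: convex_hull_2_alt)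
  obtain \<beta> where \<beta>: "b = (s + t) *\<^sub>R u + \<beta> *\<^sub>R v" "0 \<le> \<beta>" "\<beta> \<le> 1" using b by (auto simp: convex_hull_2_alt)
  \<comment> \<open>The parameter at which a segment between the two outer sides has coordinate
    \<open>s\<close> along \<open>u\<close>.\<close>
  define l where "l = s / (s + t)"
  have l: "0 \<le> l" "l \<le> 1" "l * (s + t) = s" using s by (auto simp: l_def)
  define \<mu> where "\<mu> = (1 - l) * \<alpha> + l * \<beta>"
  have "l * \<beta> \<ge> 0" "(1 - l) * \<alpha> \<ge> 0" "l * \<beta> \<le> l * 1" "(1 - l) * \<alpha> \<le> (1 - l) * 1"
    using l \<alpha> \<beta> by (auto intro!: mult_left_mono simp del: mult_1_right)
  then have \<mu>: "0 \<le> \<mu>" "\<mu> \<le> 1" by (auto simp: \<mu>_def)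
  have "(1 - l) *\<^sub>R a + l *\<^sub>R b = ((1 - l) * \<alpha>) *\<^sub>R v + ((l * (s + t)) *\<^sub>R u + (l * \<beta>) *\<^sub>R v)"
    by (simp only: \<alpha>(1) \<beta>(1) scaleR_add_right scaleR_scaleR)
  also have "\<dots> = s *\<^sub>R u + \<mu> *\<^sub>R v" unfolding l(3) \<mu>_def by (simp add: scaleR_add_left)
  finally have e: "(1 - l) *\<^sub>R a + l *\<^sub>R b = s *\<^sub>R u + \<mu> *\<^sub>R v" .
  have "s *\<^sub>R u + \<mu> *\<^sub>R v \<in> closed_segment a b" unfolding in_segment using l e by metis
  moreover have "s *\<^sub>R u + \<mu> *\<^sub>R v \<in> convex hull {s *\<^sub>R u, s *\<^sub>R u + v}"
    using \<mu> by (auto simp: convex_hull_2_alt)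
  ultimately show ?thesis by blast
qed

text \<open>The frame supplied by \<open>H_segment\<close>: \<open>\<gamma>\<close> is the angle of
  the rotation g, and \<open>2 * \<kappa>\<close> will be a + b. That \<open>\<kappa>\<close> is not
  0 is derived later from (VC).\<close>

locale rotation_endo_frame = rotation_endo +
  fixes \<kappa> \<gamma> :: real
  assumes kappa_nonneg: "\<kappa> \<ge> 0"
    and H_seg: "H (convex hull {p, q}) (rot \<gamma> *v x) = \<kappa> * \<bar>inner x (q - p)\<bar>"
begin

text \<open>The support function of \<open>\<Phi> K\<close> turned back by \<open>\<gamma>\<close>;
  in this frame the image of a segment is parallel to the segment.\<close>

definition eta :: "pt set \<Rightarrow> pt \<Rightarrow> real" where
  "eta K x = H K (rot \<gamma> *v x)"

lemma H_eq_eta: "H K x = eta K (rot (- \<gamma>) *v x)"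
  by (simp add: eta_def rot_rot)

lemma eta_add_le: "convex_body K \<Longrightarrow> eta K (x + y) \<le> eta K x + eta K y"
  unfolding eta_def by (simp add: matrix_vector_right_distrib support_fun_add_le maps)

lemma eta_scaleR: "convex_body K \<Longrightarrow> r \<ge> 0 \<Longrightarrow> eta K (r *\<^sub>R x) = r * eta K x"
  unfolding eta_def by (simp add: matrix_vector_mult_scaleR support_fun_scale maps)

lemma continuous_on_eta [continuous_intros]: "convex_body K \<Longrightarrow> continuous_on UNIV (eta K)"
  unfolding eta_def
  by (intro continuous_on_support_fun_comp maps matrix_vector_mul_bounded_linear[THEN linear_continuous_on])

lemma eta_crossing:
  assumes "finite A" "finite B" "finite C" "A \<noteq> {}" "B \<noteq> {}" "C \<noteq> {}"
    and "\<And>a b. a \<in> convex hull A \<Longrightarrow> b \<in> convex hull B \<Longrightarrow> closed_segment a b \<inter> convex hull C \<noteq> {}"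
  shows "eta (convex hull (A \<union> B \<union> C)) x + eta (convex hull C) x = eta (convex hull (A \<union> C)) x + eta (convex hull (B \<union> C)) x"
  unfolding eta_def by (rule H_hull_crossing[OF assms])

lemma eta_hull_translation:
  "finite S \<Longrightarrow> S \<noteq> {} \<Longrightarrow> eta (convex hull ((\<lambda>x. x + t) ` S)) = eta (convex hull S)"
  unfolding eta_def by (simp add: H_hull_translation)

lemma eta_hull_rot:
  "finite S \<Longrightarrow> S \<noteq> {} \<Longrightarrow> eta (convex hull ((\<lambda>x. rot a *v x) ` S)) x = eta (convex hull S) (rot (- a) *v x)"
  unfolding eta_def by (simp add: H_hull_rot rot_rot add.commute)

lemma eta_hull_uminus:
  "finite S \<Longrightarrow> S \<noteq> {} \<Longrightarrow> eta (convex hull (uminus ` S)) x = eta (convex hull S) (- x)"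
  unfolding eta_def by (simp add: H_hull_uminus rot_minus)

lemma eta_segment: "eta (convex hull {p, q}) x = \<kappa> * \<bar>inner x (q - p)\<bar>"
  unfolding eta_def by (rule H_seg)

lemma continuous_on_eta_hull:
  fixes I :: "(real \<Rightarrow> pt) set"
  assumes "finite I" "I \<noteq> {}" "\<And>p. p \<in> I \<Longrightarrow> continuous_on S p"
  shows "continuous_on S (\<lambda>s. eta (convex hull ((\<lambda>p. p s) ` I)) x)"
  unfolding eta_def by (rule continuous_on_H_hull[OF assms])

text \<open>The parallelogram is sliced along a translate of its side \<open>v\<close>; the extra
  summand on the left belongs to this slice.\<close>

lemma eta_par_split:
  assumes "s > 0" "t > 0"
  shows "eta (par ((s + t) *\<^sub>R u) v) x + \<kappa> * \<bar>inner x v\<bar> = eta (par (s *\<^sub>R u) v) x + eta (par (t *\<^sub>R u) v) x"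
proof -
  let ?A = "{0, v}" and ?B = "{(s + t) *\<^sub>R u, (s + t) *\<^sub>R u + v}" and ?C = "{s *\<^sub>R u, s *\<^sub>R u + v}"
  have c: "eta (convex hull (?A \<union> ?B \<union> ?C)) x + eta (convex hull ?C) x = eta (convex hull (?A \<union> ?C)) x + eta (convex hull (?B \<union> ?C)) x"
    by (rule eta_crossing) (use par_crossing[OF assms] in auto)
  have 1: "convex hull (?A \<union> ?B \<union> ?C) = par ((s + t) *\<^sub>R u) v"
  proof -
    have l: "s *\<^sub>R u \<in> convex hull {0, (s + t) *\<^sub>R u}" "s *\<^sub>R u + v \<in> convex hull {v, (s + t) *\<^sub>R u + v}"
      using assms by (auto simp: convex_hull_2_alt intro!: exI[of _ "s / (s + t)"])
    have "?C \<subseteq> convex hull {0, (s + t) *\<^sub>R u, v, (s + t) *\<^sub>R u + v}"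
      using l hull_mono[of "{0, (s + t) *\<^sub>R u}" "{0, (s + t) *\<^sub>R u, v, (s + t) *\<^sub>R u + v}" convex]
        hull_mono[of "{v, (s + t) *\<^sub>R u + v}" "{0, (s + t) *\<^sub>R u, v, (s + t) *\<^sub>R u + v}" convex] by blast
    then have "convex hull (?C \<union> {0, (s + t) *\<^sub>R u, v, (s + t) *\<^sub>R u + v}) = convex hull {0, (s + t) *\<^sub>R u, v, (s + t) *\<^sub>R u + v}"
      by (intro subset_antisym hull_minimal hull_mono) (auto simp: hull_inc)
    moreover have "?A \<union> ?B \<union> ?C = ?C \<union> {0, (s + t) *\<^sub>R u, v, (s + t) *\<^sub>R u + v}" by auto
    ultimately show ?thesis by (simp add: par_def)
  qed
  have 2: "?A \<union> ?C = {0, s *\<^sub>R u, v, s *\<^sub>R u + v}" by auto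
  have 3: "?B \<union> ?C = (\<lambda>x. x + s *\<^sub>R u) ` {0, t *\<^sub>R u, v, t *\<^sub>R u + v}"
    by (auto simp: scaleR_add_left add_ac)
  have 4: "eta (convex hull (?B \<union> ?C)) = eta (convex hull {0, t *\<^sub>R u, v, t *\<^sub>R u + v})"
    unfolding 3 by (rule eta_hull_translation) auto
  show ?thesis
    using c unfolding 1 4 unfolding 2 by (simp add: eta_segment par_def)
qed

lemma continuous_on_eta_par:
  "continuous_on S f \<Longrightarrow> continuous_on S g \<Longrightarrow> continuous_on S (\<lambda>s::real. eta (par (f s) (g s)) x)"
proof -
  assume "continuous_on S f" "continuous_on S g"
  then have "continuous_on S (\<lambda>s. eta (convex hull ((\<lambda>p. p s) ` {\<lambda>s. 0, f, g, \<lambda>s. f s + g s})) x)"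
    by (intro continuous_on_eta_hull) (auto intro: continuous_on_add)
  then show ?thesis by (simp add: par_def)
qed

text \<open>Removing the contribution of the side \<open>v\<close> turns the slicing identity into
  Cauchy's equation in \<open>s\<close>.\<close>

lemma eta_par_scale_left:
  assumes "s > 0"
  shows "eta (par (s *\<^sub>R u) v) x - \<kappa> * \<bar>inner x v\<bar> = s * (eta (par u v) x - \<kappa> * \<bar>inner x v\<bar>)"
proof -
  have "(\<lambda>s. eta (par (s *\<^sub>R u) v) x - \<kappa> * \<bar>inner x v\<bar>) s = s *\<^sub>R (\<lambda>s. eta (par (s *\<^sub>R u) v) x - \<kappa> * \<bar>inner x v\<bar>) 1"
    by (rule additive_ray)
      (use eta_par_split[of _ _ u v x] assms in \<open>auto intro!: continuous_on_eta_par continuous_intros simp: algebra_simps\<close>)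
  then show ?thesis by simp
qed

text \<open>One side is scaled after the other. The deviation of \<open>eta\<close> from the sum of
  the two sides is homogeneous in each of them, hence quadratic in \<open>s\<close>.\<close>

lemma eta_par_scale:
  assumes s: "s > 0"
  shows "eta (par (s *\<^sub>R u) (s *\<^sub>R v)) x = s * (\<kappa> * \<bar>inner x u\<bar> + \<kappa> * \<bar>inner x v\<bar>)
    + s\<^sup>2 * (eta (par u v) x - \<kappa> * \<bar>inner x u\<bar> - \<kappa> * \<bar>inner x v\<bar>)"
proof -
  have "eta (par (s *\<^sub>R u) (s *\<^sub>R v)) x = s * \<kappa> * \<bar>inner x v\<bar> + s * (eta (par u (s *\<^sub>R v)) x - s * \<kappa> * \<bar>inner x v\<bar>)"
    using eta_par_scale_left[OF s, of u "s *\<^sub>R v" x] s by (simp add: abs_mult algebra_simps)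
  moreover have "eta (par u (s *\<^sub>R v)) x = \<kappa> * \<bar>inner x u\<bar> + s * (eta (par u v) x - \<kappa> * \<bar>inner x u\<bar>)"
    using eta_par_scale_left[OF s, of v u x] unfolding par_commute[of _ u] by simp
  ultimately show ?thesis by (simp add: algebra_simps power2_eq_square)
qed

text \<open>For \<kappa> = 0 only the quadratic term of \<open>eta_par_scale\<close> survives. The
  image of a square of side \<open>s\<close> then has area of order s^4, which for small
  \<open>s\<close> violates the lower bound in (VC).\<close>

lemma kappa_pos: "\<kappa> > 0"
proof (rule ccontr)
  assume "\<not> \<kappa> > 0"
  then have k: "\<kappa> = 0" using kappa_nonneg by simp
  let ?P = "\<lambda>s. par (s *\<^sub>R unit_dir 0) (s *\<^sub>R unit_dir (pi/2))"
  obtain c where c: "c > 0" "\<And>K. convex_body K \<Longrightarrow> c * area K \<le> area (\<Phi> K)"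
    using vc unfolding VC_def by blast
  have scale: "\<Phi> (?P s) = (\<lambda>x. s\<^sup>2 *\<^sub>R x) ` \<Phi> (?P 1)" if "s > 0" for s
    using eta_par_scale[OF that, of "unit_dir 0" "unit_dir (pi/2)"]
    by (intro convex_body_eqI maps convex_body_par convex_body_scaleR)
       (simp add: support_fun_scaleR_image maps convex_body_par H_eq_eta k)
  have low: "area (?P s) \<ge> s\<^sup>2 / 2" for s
  proof -
    have "area (convex hull {0, s *\<^sub>R unit_dir 0, s *\<^sub>R unit_dir (pi/2)}) \<le> area (?P s)"
      by (intro area_mono convex_body_par convex_body_hull) (auto simp: par_def intro!: hull_mono)
    then show ?thesis by (simp add: area_triangle cross_def unit_dir_def vector_2 power2_eq_square)
  qed
  define A where "A = area (\<Phi> (?P 1))"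
  have *: "c / 2 \<le> s\<^sup>2 * A" if s: "s > 0" for s
  proof -
    have "c * (s\<^sup>2 / 2) \<le> c * area (?P s)" using c low by (intro mult_left_mono) auto
    also have "\<dots> \<le> area (\<Phi> (?P s))" by (rule c(2)[OF convex_body_par])
    also have "\<dots> = (s\<^sup>2)\<^sup>2 * A" unfolding scale[OF s] area_scaleR A_def by simp
    finally have "s\<^sup>2 * (c / 2) \<le> s\<^sup>2 * (s\<^sup>2 * A)" by (simp add: power2_eq_square mult_ac)
    then show ?thesis by (rule mult_left_le_imp_le) (use s in simp)
  qed
  have A: "A \<ge> 0" by (simp add: A_def area_nonneg)
  \<comment> \<open>Chosen so that s^2 * A is at most c / 4, below the required c / 2; the summand 1
    covers the case A = 0.\<close>
  define s where "s = sqrt (c / (4 * (A + 1)))"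
  have s: "s > 0" "s\<^sup>2 = c / (4 * (A + 1))" using c A by (auto simp: s_def)
  have "c / 2 \<le> c / (4 * (A + 1)) * A" using *[OF s(1)] s(2) by simp
  also have "\<dots> = c / 4 * (A / (A + 1))" using A by (simp add: field_simps)
  also have "\<dots> \<le> c / 4 * 1" using A c by (intro mult_left_mono) auto
  finally show False using c by simp
qed

lemma eta_par_even: "eta (par u v) (- x) = eta (par u v) x"
proof -
  have "(\<lambda>x. x + (u + v)) ` (uminus ` {0, u, v, u + v}) = {0, u, v, u + v}" by auto
  then show ?thesis
    using eta_hull_translation[of "uminus ` {0, u, v, u + v}" "u + v"] eta_hull_uminus[of "{0, u, v, u + v}" x]
    by (simp add: par_def)
qed

lemma even_nonneg:
  assumes "convex_body K" "\<And>x. eta K (- x) = eta K x"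
  shows "eta K x \<ge> 0"
  using eta_add_le[OF assms(1), of x "- x"] assms eta_scaleR[OF assms(1), of 0 0] by simp

text \<open>A nonzero quadratic part in \<open>eta_par_scale\<close> would make the image of a dilated parallelogram
  contain triangles of area of order \<open>s\<^sup>3\<close>.\<close>
lemma eta_par:
  assumes uv: "cross u v \<noteq> 0"
  shows "eta (par u v) x = \<kappa> * \<bar>inner x u\<bar> + \<kappa> * \<bar>inner x v\<bar>"
proof -
  define G where "G x = eta (par u v) x - \<kappa> * \<bar>inner x u\<bar> - \<kappa> * \<bar>inner x v\<bar>" for x
  let ?P = "\<lambda>s. par (s *\<^sub>R u) (s *\<^sub>R v)"
  let ?g = "\<lambda>x. rot \<gamma> *v x"
  have F: "eta (?P s) x = s * (\<kappa> * \<bar>inner x u\<bar> + \<kappa> * \<bar>inner x v\<bar>) + s\<^sup>2 * G x" if "s > 0" for s x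
    using eta_par_scale[OF that] by (simp add: G_def)
  \<comment> \<open>For large \<open>s\<close> a negative quadratic term would outweigh the linear
    one, although \<open>eta\<close> is nonnegative on symmetric bodies.\<close>
  have G0: "G x \<ge> 0" for x
  proof (rule ccontr)
    assume neg: "\<not> G x \<ge> 0"
    define B where "B = \<kappa> * \<bar>inner x u\<bar> + \<kappa> * \<bar>inner x v\<bar>"
    have B: "B \<ge> 0" using kappa_nonneg by (simp add: B_def)
    define s where "s = (B + 1) / - G x"
    have s: "s > 0" using B neg by (simp add: s_def divide_pos_neg)
    have "0 \<le> s * B + s\<^sup>2 * G x"
      using even_nonneg[OF convex_body_par eta_par_even, of "s *\<^sub>R u" "s *\<^sub>R v" x] F[OF s, of x] by (simp add: B_def)
    then have "0 \<le> s * (B + s * G x)" by (simp add: power2_eq_square algebra_simps)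
    then have "0 \<le> B + s * G x" using s by (simp add: zero_le_mult_iff)
    moreover have "s * G x = - (B + 1)" using neg by (simp add: s_def field_simps)
    ultimately show False by simp
  qed
  obtain C where C: "\<And>K. convex_body K \<Longrightarrow> area (\<Phi> K) \<le> C * area K"
    using vc unfolding VC_def by blast
  define D where "D = C * area (par u v)"
  have area: "area (\<Phi> (?P s)) \<le> s\<^sup>2 * D" for s
    using C[OF convex_body_par, of "s *\<^sub>R u" "s *\<^sub>R v"] by (simp add: par_scaleR area_scaleR D_def mult_ac)
  \<comment> \<open>As \<open>G\<close> is nonnegative, the image contains the images of both sides,
    which are segments from \<open>- ?w\<close> to \<open>?w\<close>. With any further point
    \<open>y\<close> such a segment spans a triangle whose area (VC) bounds.\<close>
  have cr: "s * \<kappa> * \<bar>cross (?g w) y\<bar> \<le> s\<^sup>2 * D"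
    if s: "s > 0" and w: "w = u \<or> w = v" and y: "y \<in> \<Phi> (?P s)" for s w y
  proof -
    let ?w = "(s * \<kappa>) *\<^sub>R ?g w"
    have mem: "convex hull {- ?w, ?w} \<subseteq> \<Phi> (?P s)"
    proof (rule subset_if_support_fun_le[OF convex_body_hull maps[OF convex_body_par]])
      fix x
      have le: "s * \<kappa> * \<bar>inner x w\<bar> \<le> eta (?P s) x" for x
        using w s G0[of x] kappa_nonneg unfolding F[OF s] by (auto simp: distrib_left intro!: add_nonneg_nonneg)
      have "support_fun (convex hull {- ?w, ?w}) x \<le> \<bar>inner x ?w\<bar>"
      proof (rule support_fun_le[OF convex_body_hull])
        fix z assume "z \<in> convex hull {- ?w, ?w}"
        then obtain p q where "z = p *\<^sub>R (- ?w) + q *\<^sub>R ?w" "p \<ge> 0" "q \<ge> 0" "p + q = 1" unfolding convex_hull_2 by blast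
        then have "z = (q - p) *\<^sub>R ?w" "\<bar>q - p\<bar> \<le> 1"
          by (simp add: scaleR_diff_left del: scaleR_scaleR, linarith)
        then have "\<bar>inner x z\<bar> \<le> 1 * \<bar>inner x ?w\<bar>" by (simp only: inner_scaleR_right abs_mult) (intro mult_right_mono, auto)
        then show "inner x z \<le> \<bar>inner x ?w\<bar>" by linarith
      qed auto
      also have "\<dots> = s * \<kappa> * \<bar>inner (rot (- \<gamma>) *v x) w\<bar>"
        using s kappa_nonneg by (simp add: inner_rot abs_mult)
      also have "\<dots> \<le> H (?P s) x" unfolding H_eq_eta by (rule le)
      finally show "support_fun (convex hull {- ?w, ?w}) x \<le> H (?P s) x" .
    qed auto
    have "convex hull {- ?w, ?w, y} \<subseteq> \<Phi> (?P s)"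
      using mem y maps[OF convex_body_par] unfolding convex_body_def
      by (intro hull_minimal) (auto simp: subset_hull)
    then have "area (convex hull {- ?w, ?w, y}) \<le> s\<^sup>2 * D"
      using area_mono[OF convex_body_hull maps[OF convex_body_par]] area[of s] by (meson finite.intros insert_not_empty order_trans)
    moreover have "cross (?w - - ?w) (y - - ?w) = 2 * (s * \<kappa> * cross (?g w) y)"
      by (simp add: cross_def algebra_simps)
    ultimately show ?thesis using s kappa_nonneg by (simp add: area_triangle abs_mult)
  qed
  have "G x \<le> 0" for x
  proof (rule ccontr)
    assume pos: "\<not> G x \<le> 0"
    define E where "E = D * (\<bar>inner x u\<bar> + \<bar>inner x v\<bar>)"
    have key: "s * (\<kappa> * \<bar>cross u v\<bar> * G x) \<le> E" if s: "s > 0" for s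
    proof -
      obtain y where y: "y \<in> \<Phi> (?P s)" "inner (?g x) y = eta (?P s) x"
        using support_fun_attained[OF maps[OF convex_body_par]] unfolding eta_def by metis
      \<comment> \<open>Cramer's rule: \<open>y\<close> is expanded in the basis
        \<open>?g u\<close>, \<open>?g v\<close> and paired with \<open>?g x\<close>. Since
        \<open>y\<close> attains \<open>eta\<close> at \<open>x\<close>, bounding its two
        coordinates bounds \<open>eta\<close>.\<close>
      have "cross (?g u) (?g v) * inner (?g x) y = cross y (?g v) * inner (?g x) (?g u) + cross (?g u) y * inner (?g x) (?g v)"
        by (simp add: cross_def inner_vec_def sum_2 algebra_simps)
      then have "cross u v * eta (?P s) x = - cross (?g v) y * inner x u + cross (?g u) y * inner x v"
        using y(2) by (simp add: inner_rot rot_rot) (simp add: cross_def algebra_simps)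
      then have "\<bar>cross u v\<bar> * eta (?P s) x \<le> \<bar>cross (?g v) y\<bar> * \<bar>inner x u\<bar> + \<bar>cross (?g u) y\<bar> * \<bar>inner x v\<bar>"
        using even_nonneg[OF convex_body_par eta_par_even, of "s *\<^sub>R u" "s *\<^sub>R v" x]
        by (smt (verit) abs_mult abs_minus_cancel abs_triangle_ineq abs_of_nonneg)
      then have "s * \<kappa> * (\<bar>cross u v\<bar> * eta (?P s) x) \<le> s * \<kappa> * (\<bar>cross (?g v) y\<bar> * \<bar>inner x u\<bar> + \<bar>cross (?g u) y\<bar> * \<bar>inner x v\<bar>)"
        using s kappa_nonneg by (intro mult_left_mono) auto
      also have "\<dots> = (s * \<kappa> * \<bar>cross (?g v) y\<bar>) * \<bar>inner x u\<bar> + (s * \<kappa> * \<bar>cross (?g u) y\<bar>) * \<bar>inner x v\<bar>"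
        by (simp add: algebra_simps)
      also have "\<dots> \<le> (s\<^sup>2 * D) * \<bar>inner x u\<bar> + (s\<^sup>2 * D) * \<bar>inner x v\<bar>"
        using cr[OF s _ y(1)] by (intro add_mono mult_right_mono) auto
      also have "\<dots> = s * s * E" by (simp add: E_def power2_eq_square algebra_simps)
      finally have 1: "s * \<kappa> * (\<bar>cross u v\<bar> * eta (?P s) x) \<le> s * s * E" .
      have "s\<^sup>2 * G x \<le> eta (?P s) x" unfolding F[OF s] using s kappa_nonneg by simp
      then have "s * \<kappa> * (\<bar>cross u v\<bar> * (s\<^sup>2 * G x)) \<le> s * \<kappa> * (\<bar>cross u v\<bar> * eta (?P s) x)"
        using s kappa_nonneg by (intro mult_left_mono) auto
      with 1 have "s * s * (s * (\<kappa> * \<bar>cross u v\<bar> * G x)) \<le> s * s * E"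
        by (simp add: power2_eq_square mult_ac)
      then show ?thesis by (rule mult_left_le_imp_le) (use s in simp)
    qed
    define b where "b = \<kappa> * \<bar>cross u v\<bar> * G x"
    have b: "b > 0" using kappa_pos uv pos by (simp add: b_def)
    have "(\<bar>E\<bar> + 1) / b * b \<le> E" using key[of "(\<bar>E\<bar> + 1) / b"] b unfolding b_def[symmetric] by simp
    then show False using b by simp
  qed
  with G0 have "G x = 0" by (simp add: antisym)
  then show ?thesis by (simp add: G_def)
qed

end

section \<open>Triangles up to translation\<close>

text \<open>Up to sign, \<open>u'\<close> and \<open>v'\<close> are \<open>v\<close> and
  \<open>u\<close> turned by a quarter and divided by the determinant. In this basis
  \<open>x\<close> has the coordinates \<open>inner x u\<close> and \<open>inner x v\<close>, the
  ones that enter the support function of the triangle 0, u, v.\<close>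

lemma dual_basis:
  assumes "cross u v \<noteq> 0"
  obtains u' v' where "inner u' u = 1" "inner u' v = 0" "inner v' u = 0" "inner v' v = 1"
    "\<And>x. x = inner x u *\<^sub>R u' + inner x v *\<^sub>R v'"
proof
  define d where "d = cross u v"
  have d: "d \<noteq> 0" "d = u$1 * v$2 - u$2 * v$1" using assms by (auto simp: d_def cross_def)
  let ?u = "(1 / d) *\<^sub>R vector [v$2, - v$1] :: pt" and ?v = "(1 / d) *\<^sub>R vector [- u$2, u$1] :: pt"
  have e: "(1 / d) * (u$1 * v$2 - u$2 * v$1) = 1" using d by simp
  show "inner ?u u = 1" "inner ?v v = 1" "inner ?u v = 0" "inner ?v u = 0"
    using e by (simp_all add: inner_vec_def sum_2 vector_2 algebra_simps)
  show "x = inner x u *\<^sub>R ?u + inner x v *\<^sub>R ?v" for x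
  proof -
    have "x$1 * ((1 / d) * (u$1 * v$2 - u$2 * v$1)) = inner x u * (1 / d) * v$2 + inner x v * (1 / d) * - u$2"
      "x$2 * ((1 / d) * (u$1 * v$2 - u$2 * v$1)) = inner x u * (1 / d) * - v$1 + inner x v * (1 / d) * u$1"
      unfolding inner_vec_def sum_2 inner_real_def by algebra+
    then show ?thesis unfolding e by (simp add: vec_eq_iff forall_2 vector_2)
  qed
qed

lemma cross_scaleR_right: "cross u (s *\<^sub>R v) = s * cross u v"
  by (simp add: cross_def algebra_simps)

lemma cross_swap: "cross v u = - cross u v"
  by (simp add: cross_def algebra_simps)

text \<open>Gram-Schmidt in polar form: every positively oriented basis arises from the standard one
  by a rotation, scalings of the two sides and a shear.\<close>

lemma polar_basis:
  assumes "cross u v > 0"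
  obtains r \<theta> \<alpha> \<beta> where "r > 0" "\<beta> > 0" "u = r *\<^sub>R unit_dir \<theta>"
    "v = \<alpha> *\<^sub>R unit_dir \<theta> + \<beta> *\<^sub>R unit_dir (\<theta> + pi/2)"
proof -
  obtain r \<theta> where r: "r \<ge> 0" "u = r *\<^sub>R unit_dir \<theta>" by (rule polar_form)
  have "r \<noteq> 0" using assms r by (auto simp: cross_def)
  then have r0: "r > 0" using r by simp
  define \<alpha> where "\<alpha> = v$1 * cos \<theta> + v$2 * sin \<theta>"
  define \<beta> where "\<beta> = v$2 * cos \<theta> - v$1 * sin \<theta>"
  have "cross u v = r * \<beta>" by (simp add: r cross_def unit_dir_def vector_2 \<beta>_def algebra_simps)
  then have b: "\<beta> > 0" using assms r0 by (simp add: zero_less_mult_iff)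
  have one: "cos \<theta> * cos \<theta> + sin \<theta> * sin \<theta> = 1" using sin_cos_squared_add2[of \<theta>] by (simp add: power2_eq_square)
  have "\<alpha> * cos \<theta> - \<beta> * sin \<theta> = v$1 * (cos \<theta> * cos \<theta> + sin \<theta> * sin \<theta>)"
    "\<alpha> * sin \<theta> + \<beta> * cos \<theta> = v$2 * (cos \<theta> * cos \<theta> + sin \<theta> * sin \<theta>)"
    unfolding \<alpha>_def \<beta>_def by algebra+
  then have "v = \<alpha> *\<^sub>R unit_dir \<theta> + \<beta> *\<^sub>R unit_dir (\<theta> + pi/2)"
    unfolding one by (simp add: vec_eq_iff forall_2 unit_dir_def vector_2 cos_add sin_add)
  then show thesis using that r0 b r by blast
qed

lemma hull_redundant_vertex:
  assumes "m \<in> closed_segment p q"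
  shows "convex hull {m, r, p, q} = convex hull {p, q, r}"
proof -
  have "m \<in> convex hull {p, q, r}"
    using assms hull_mono[of "{p, q}" "{p, q, r}" convex] by (auto simp: segment_convex_hull)
  then have "convex hull (insert m {p, q, r}) = convex hull {p, q, r}" by (rule hull_redundant)
  moreover have "{m, r, p, q} = insert m {p, q, r}" by auto
  ultimately show ?thesis by simp
qed

context rotation_endo_frame
begin

text \<open>A quadrilateral is cut along its diagonal from \<open>p\<close> to \<open>q\<close>,
  which accounts for the last summand.\<close>

lemma eta_cut:
  assumes "m \<in> closed_segment a b" "m \<in> closed_segment p q"
  shows "eta (convex hull {p, q, a}) x + eta (convex hull {p, q, b}) x = eta (convex hull {p, q, a, b}) x + \<kappa> * \<bar>inner x (q - p)\<bar>"
proof -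
  have "eta (convex hull ({a} \<union> {b} \<union> {p, q})) x + eta (convex hull {p, q}) x
      = eta (convex hull ({a} \<union> {p, q})) x + eta (convex hull ({b} \<union> {p, q})) x"
    by (rule eta_crossing) (use assms in \<open>auto simp flip: segment_convex_hull\<close>)
  moreover have "{a} \<union> {b} \<union> {p, q} = {p, q, a, b}" "{a} \<union> {p, q} = {p, q, a}" "{b} \<union> {p, q} = {p, q, b}" by auto
  ultimately show ?thesis by (simp add: eta_segment)
qed

text \<open>The case of \<open>eta_cut\<close> with diagonal from \<open>m\<close> to
  \<open>r\<close>: its end \<open>m\<close> lies on the other diagonal, so the quadrilateral is a
  triangle.\<close>

lemma eta_split:
  assumes "m \<in> closed_segment p q"
  shows "eta (convex hull {p, q, r}) x = eta (convex hull {p, m, r}) x + eta (convex hull {m, q, r}) x - \<kappa> * \<bar>inner x (r - m)\<bar>"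
  using eta_cut[OF assms, of m r x] unfolding hull_redundant_vertex[OF assms] by (simp add: insert_commute)

text \<open>The diagonal from \<open>u\<close> to \<open>v\<close> cuts \<open>par u v\<close> into
  the triangle and a translate of its reflection.\<close>

lemma eta_triangle_sym:
  assumes "cross u v \<noteq> 0"
  shows "eta (convex hull {0, u, v}) x + eta (convex hull {0, u, v}) (- x)
    = \<kappa> * (\<bar>inner x u\<bar> + \<bar>inner x v\<bar> + \<bar>inner x u - inner x v\<bar>)"
proof -
  have "eta (convex hull {u, v, 0}) x + eta (convex hull {u, v, u + v}) x
    = eta (convex hull {u, v, 0, u + v}) x + \<kappa> * \<bar>inner x (v - u)\<bar>"
    by (rule eta_cut[of "(1/2) *\<^sub>R (u + v)"]) (auto simp: in_segment scaleR_add_right intro!: exI[of _ "1/2"])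
  moreover have "convex hull {u, v, 0, u + v} = par u v" by (simp add: par_def insert_commute)
  moreover have "eta (convex hull {u, v, u + v}) x = eta (convex hull {0, u, v}) (- x)"
  proof -
    have "(\<lambda>x. x + (u + v)) ` uminus ` {0, u, v} = {u, v, u + v}" by auto
    then show ?thesis
      using eta_hull_translation[of "uminus ` {0, u, v}" "u + v"] eta_hull_uminus[of "{0, u, v}" x] by simp
  qed
  ultimately show ?thesis
    by (simp add: eta_par[OF assms] insert_commute inner_diff_right algebra_simps abs_minus_commute)
qed

text \<open>Sublinearity bounds \<open>eta\<close> from above at the combined vector and at its
  negative. Where \<open>q\<close> is additive the two bounds add up to an equality, so each of them
  is one: \<open>eta\<close> is linear on every cone on which \<open>q\<close> is.\<close>

lemma eta_add_eq:
  assumes K: "convex_body K" and q: "\<And>x. eta K x + eta K (- x) = q x"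
    and st: "s \<ge> 0" "t \<ge> 0" and add: "q (s *\<^sub>R y + t *\<^sub>R z) = s * q y + t * q z"
  shows "eta K (s *\<^sub>R y + t *\<^sub>R z) = s * eta K y + t * eta K z"
proof -
  have "eta K (s *\<^sub>R y + t *\<^sub>R z) \<le> s * eta K y + t * eta K z"
    using eta_add_le[OF K, of "s *\<^sub>R y" "t *\<^sub>R z"] st by (simp add: eta_scaleR[OF K])
  moreover have "eta K (- (s *\<^sub>R y + t *\<^sub>R z)) \<le> s * eta K (- y) + t * eta K (- z)"
    using eta_add_le[OF K, of "s *\<^sub>R (- y)" "t *\<^sub>R (- z)"] st
    unfolding eta_scaleR[OF K st(1)] eta_scaleR[OF K st(2)] by simp
  moreover have "s * q y + t * q z = s * eta K y + t * eta K z + (s * eta K (- y) + t * eta K (- z))"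
    by (simp add: q[symmetric] algebra_simps)
  ultimately show ?thesis using q[of "s *\<^sub>R y + t *\<^sub>R z"] add by linarith
qed

text \<open>The nested maxima are the support functions of the triangle 0, u, v and of its
  reflection. The linear term \<open>t\<close> stays existential, since the coefficient
  \<open>a\<close> can be followed through cuts without knowing it.\<close>

definition tri_form :: "real \<Rightarrow> pt \<Rightarrow> pt \<Rightarrow> bool" where
  "tri_form a u v \<longleftrightarrow> (\<exists>t. \<forall>x. eta (convex hull {0, u, v}) x =
     a * max 0 (max (inner x u) (inner x v)) + (2 * \<kappa> - a) * max 0 (max (- inner x u) (- inner x v)) + inner x t)"

text \<open>The lines spanned by \<open>u'\<close>, \<open>v'\<close> and \<open>u' + v'\<close>
  bound six sectors on which \<open>q\<close>, and therefore \<open>?h\<close>, is linear. At these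
  three vectors \<open>q\<close> equals \<open>2 * \<kappa>\<close>, which gives the values at their
  negatives. So \<open>?h\<close> depends on three numbers, as many as \<open>a\<close> and
  \<open>t\<close> have.\<close>

lemma tri_form_exists:
  assumes uv: "cross u v \<noteq> 0"
  obtains a where "0 \<le> a" "a \<le> 2 * \<kappa>" "tri_form a u v"
proof -
  obtain u' v' where d: "inner u' u = 1" "inner u' v = 0" "inner v' u = 0" "inner v' v = 1"
    "\<And>x. x = inner x u *\<^sub>R u' + inner x v *\<^sub>R v'" using dual_basis[OF uv] by metis
  let ?h = "eta (convex hull {0, u, v})"
  define q where "q x = \<kappa> * (\<bar>inner x u\<bar> + \<bar>inner x v\<bar> + \<bar>inner x u - inner x v\<bar>)" for x
  have K: "convex_body (convex hull {0, u, v})" by (rule convex_body_hull) auto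
  have q: "?h x + ?h (- x) = q x" for x unfolding q_def by (rule eta_triangle_sym[OF uv])
  define p1 where "p1 = ?h u'"
  define p2 where "p2 = ?h (u' + v')"
  define p3 where "p3 = ?h v'"
  have m: "?h (- u') = 2 * \<kappa> - p1" "?h (- (u' + v')) = 2 * \<kappa> - p2" "?h (- v') = 2 * \<kappa> - p3"
    using q[of u'] q[of "u' + v'"] q[of v'] by (simp_all add: q_def p1_def p2_def p3_def d inner_add_left)
  \<comment> \<open>The gap in the subadditivity at \<open>u'\<close> and \<open>v'\<close>. The gap
    at their negatives is \<open>2 * \<kappa> - a\<close>, so both coefficients are
    nonnegative.\<close>
  define a where "a = p1 + p3 - p2"
  have "p2 \<le> p1 + p3" using eta_add_le[OF K, of u' v'] by (simp add: p1_def p2_def p3_def)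
  moreover have "2 * \<kappa> - p2 \<le> 2 * \<kappa> - p1 + (2 * \<kappa> - p3)"
    using eta_add_le[OF K, of "- u'" "- v'"] m by simp
  ultimately have a: "0 \<le> a" "a \<le> 2 * \<kappa>" by (auto simp: a_def)
  note sector = eta_add_eq[OF K q]
  \<comment> \<open>Read off on the sector between \<open>u'\<close> and \<open>u' + v'\<close>,
    where the second maximum vanishes.\<close>
  define t where "t = (p2 - p3) *\<^sub>R u + (p2 - p1) *\<^sub>R v"
  have "?h x = a * max 0 (max (inner x u) (inner x v)) + (2 * \<kappa> - a) * max 0 (max (- inner x u) (- inner x v)) + inner x t"
    for x
  proof -
    define \<alpha> where "\<alpha> = inner x u"
    define \<beta> where "\<beta> = inner x v"
    have x: "x = \<alpha> *\<^sub>R u' + \<beta> *\<^sub>R v'" using d(5)[of x] by (simp add: \<alpha>_def \<beta>_def)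
    have t: "inner x t = (p2 - p3) * \<alpha> + (p2 - p1) * \<beta>"
      by (simp add: t_def inner_add_right \<alpha>_def \<beta>_def)
    consider "0 \<le> \<beta>" "\<beta> \<le> \<alpha>" | "0 \<le> \<alpha>" "\<alpha> \<le> \<beta>" | "\<alpha> \<le> 0" "0 \<le> \<beta>" | "\<alpha> \<le> \<beta>" "\<beta> \<le> 0"
      | "\<beta> \<le> \<alpha>" "\<alpha> \<le> 0" | "\<beta> \<le> 0" "0 \<le> \<alpha>" by linarith
    then have "?h x = a * max 0 (max \<alpha> \<beta>) + (2 * \<kappa> - a) * max 0 (max (- \<alpha>) (- \<beta>)) + ((p2 - p3) * \<alpha> + (p2 - p1) * \<beta>)"
    proof cases
      case 1
      have "x = (\<alpha> - \<beta>) *\<^sub>R u' + \<beta> *\<^sub>R (u' + v')" by (simp add: x algebra_simps)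
      moreover have "?h ((\<alpha> - \<beta>) *\<^sub>R u' + \<beta> *\<^sub>R (u' + v')) = (\<alpha> - \<beta>) * p1 + \<beta> * p2"
        unfolding p1_def p2_def using 1 by (intro sector) (auto simp: q_def d inner_add_left algebra_simps)
      moreover have "max 0 (max \<alpha> \<beta>) = \<alpha>" "max 0 (max (- \<alpha>) (- \<beta>)) = 0" using 1 by auto
      ultimately show ?thesis by (simp add: a_def algebra_simps)
    next
      case 2
      have "x = (\<beta> - \<alpha>) *\<^sub>R v' + \<alpha> *\<^sub>R (u' + v')" by (simp add: x algebra_simps)
      moreover have "?h ((\<beta> - \<alpha>) *\<^sub>R v' + \<alpha> *\<^sub>R (u' + v')) = (\<beta> - \<alpha>) * p3 + \<alpha> * p2"
        unfolding p3_def p2_def using 2 by (intro sector) (auto simp: q_def d inner_add_left algebra_simps)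
      moreover have "max 0 (max \<alpha> \<beta>) = \<beta>" "max 0 (max (- \<alpha>) (- \<beta>)) = 0" using 2 by auto
      ultimately show ?thesis by (simp add: a_def algebra_simps)
    next
      case 3
      have "x = (- \<alpha>) *\<^sub>R (- u') + \<beta> *\<^sub>R v'" by (simp add: x)
      moreover have "?h ((- \<alpha>) *\<^sub>R (- u') + \<beta> *\<^sub>R v') = (- \<alpha>) * ?h (- u') + \<beta> * p3"
        unfolding p3_def using 3 by (intro sector) (auto simp: q_def d inner_add_left algebra_simps)
      moreover have "max 0 (max \<alpha> \<beta>) = \<beta>" "max 0 (max (- \<alpha>) (- \<beta>)) = - \<alpha>" using 3 by auto
      ultimately show ?thesis by (simp add: a_def m algebra_simps)
    next
      case 4
      have "x = (\<beta> - \<alpha>) *\<^sub>R (- u') + (- \<beta>) *\<^sub>R (- (u' + v'))" by (simp add: x algebra_simps)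
      moreover have "?h ((\<beta> - \<alpha>) *\<^sub>R (- u') + (- \<beta>) *\<^sub>R (- (u' + v'))) = (\<beta> - \<alpha>) * ?h (- u') + (- \<beta>) * ?h (- (u' + v'))"
        using 4 by (intro sector) (auto simp: q_def d inner_add_left algebra_simps)
      moreover have "max 0 (max \<alpha> \<beta>) = 0" "max 0 (max (- \<alpha>) (- \<beta>)) = - \<alpha>" using 4 by auto
      ultimately show ?thesis unfolding m by (simp add: a_def algebra_simps)
    next
      case 5
      have "x = (\<alpha> - \<beta>) *\<^sub>R (- v') + (- \<alpha>) *\<^sub>R (- (u' + v'))" by (simp add: x algebra_simps)
      moreover have "?h ((\<alpha> - \<beta>) *\<^sub>R (- v') + (- \<alpha>) *\<^sub>R (- (u' + v'))) = (\<alpha> - \<beta>) * ?h (- v') + (- \<alpha>) * ?h (- (u' + v'))"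
        using 5 by (intro sector) (auto simp: q_def d inner_add_left algebra_simps)
      moreover have "max 0 (max \<alpha> \<beta>) = 0" "max 0 (max (- \<alpha>) (- \<beta>)) = - \<beta>" using 5 by auto
      ultimately show ?thesis unfolding m by (simp add: a_def algebra_simps)
    next
      case 6
      have "x = \<alpha> *\<^sub>R u' + (- \<beta>) *\<^sub>R (- v')" by (simp add: x)
      moreover have "?h (\<alpha> *\<^sub>R u' + (- \<beta>) *\<^sub>R (- v')) = \<alpha> * p1 + (- \<beta>) * ?h (- v')"
        unfolding p1_def using 6 by (intro sector) (auto simp: q_def d inner_add_left algebra_simps)
      moreover have "max 0 (max \<alpha> \<beta>) = \<alpha>" "max 0 (max (- \<alpha>) (- \<beta>)) = - \<beta>" using 6 by auto
      ultimately show ?thesis by (simp add: a_def m algebra_simps)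
    qed
    then show ?thesis by (simp add: t \<alpha>_def \<beta>_def)
  qed
  then show thesis using a that unfolding tri_form_def by blast
qed

section \<open>One coefficient for all triangles\<close>

lemma tri_form_swap: "tri_form a u v \<Longrightarrow> tri_form a v u"
  unfolding tri_form_def by (simp add: insert_commute max.commute)

text \<open>With \<open>u\<close> as the new base vertex both maxima change by linear terms, which
  are absorbed in \<open>t\<close>. Thus sides can be scaled from any vertex.\<close>

lemma tri_form_translate:
  assumes "tri_form a u v"
  shows "tri_form a (v - u) (- u)"
proof -
  obtain t where t: "\<And>x. eta (convex hull {0, u, v}) x = a * max 0 (max (inner x u) (inner x v))
      + (2 * \<kappa> - a) * max 0 (max (- inner x u) (- inner x v)) + inner x t"
    using assms unfolding tri_form_def by blast
  have 1: "eta (convex hull {0, v - u, - u}) = eta (convex hull {0, u, v})"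
    using eta_hull_translation[of "{0, u, v}" "- u"] by (simp add: insert_commute)
  have m1: "max 0 (max (inner x (v - u)) (inner x (- u))) = max 0 (max (inner x u) (inner x v)) - inner x u"
    and m2: "max 0 (max (- inner x (v - u)) (- inner x (- u))) = max 0 (max (- inner x u) (- inner x v)) + inner x u" for x
    by (auto simp: max_def inner_diff_right)
  show ?thesis
    unfolding tri_form_def 1 m1 m2 t
    by (intro exI[of _ "t + (2 * a - 2 * \<kappa>) *\<^sub>R u"]) (simp add: inner_add_right inner_diff_right algebra_simps)
qed

lemma tri_form_rot:
  assumes "tri_form a u v"
  shows "tri_form a (rot \<theta> *v u) (rot \<theta> *v v)"
proof -
  obtain t where t: "\<And>x. eta (convex hull {0, u, v}) x = a * max 0 (max (inner x u) (inner x v))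
      + (2 * \<kappa> - a) * max 0 (max (- inner x u) (- inner x v)) + inner x t"
    using assms unfolding tri_form_def by blast
  have "eta (convex hull {0, rot \<theta> *v u, rot \<theta> *v v}) x = eta (convex hull {0, u, v}) (rot (- \<theta>) *v x)" for x
    using eta_hull_rot[of "{0, u, v}" \<theta> x] by simp
  then show ?thesis
    unfolding tri_form_def t by (intro exI[of _ "rot \<theta> *v t"]) (simp add: inner_rot)
qed

text \<open>Cutting off \<open>conv {u, s v, v}\<close> leaves the edge \<open>u\<close> untouched; the second difference of the
  support functions across the outer normal of this edge sees only its coefficient.\<close>
lemma tri_form_scale_less:
  assumes uv: "cross u v \<noteq> 0" and s: "0 < s" "s < 1" and a: "tri_form a u v" and a1: "tri_form a1 u (s *\<^sub>R v)"
  shows "a = a1"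
proof -
  obtain u' v' where d: "inner u' u = 1" "inner u' v = 0" "inner v' u = 0" "inner v' v = 1"
    "\<And>x. x = inner x u *\<^sub>R u' + inner x v *\<^sub>R v'" using dual_basis[OF uv] by metis
  have "cross (u - s *\<^sub>R v) ((1 - s) *\<^sub>R v) = (1 - s) * cross u v" by (simp add: cross_def algebra_simps)
  then obtain a2 where a2: "tri_form a2 (u - s *\<^sub>R v) ((1 - s) *\<^sub>R v)"
    using tri_form_exists[of "u - s *\<^sub>R v" "(1 - s) *\<^sub>R v"] uv s by auto
  obtain t where t: "\<And>x. eta (convex hull {0, u, v}) x = a * max 0 (max (inner x u) (inner x v))
      + (2 * \<kappa> - a) * max 0 (max (- inner x u) (- inner x v)) + inner x t"
    using a unfolding tri_form_def by blast
  obtain t1 where t1: "\<And>x. eta (convex hull {0, u, s *\<^sub>R v}) x = a1 * max 0 (max (inner x u) (inner x (s *\<^sub>R v)))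
      + (2 * \<kappa> - a1) * max 0 (max (- inner x u) (- inner x (s *\<^sub>R v))) + inner x t1"
    using a1 unfolding tri_form_def by blast
  obtain t2 where t2: "\<And>x. eta (convex hull {0, u - s *\<^sub>R v, (1 - s) *\<^sub>R v}) x =
      a2 * max 0 (max (inner x (u - s *\<^sub>R v)) (inner x ((1 - s) *\<^sub>R v)))
      + (2 * \<kappa> - a2) * max 0 (max (- inner x (u - s *\<^sub>R v)) (- inner x ((1 - s) *\<^sub>R v))) + inner x t2"
    using a2 unfolding tri_form_def by blast
  have "s *\<^sub>R v \<in> closed_segment 0 v" using s by (auto simp: in_segment intro!: exI[of _ s])
  from eta_split[OF this, of u]
  have split: "eta (convex hull {0, u, v}) x = eta (convex hull {0, u, s *\<^sub>R v}) x
      + eta (convex hull {u, s *\<^sub>R v, v}) x - \<kappa> * \<bar>inner x (u - s *\<^sub>R v)\<bar>" for x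
    by (simp add: insert_commute)
  have tr: "eta (convex hull {u, s *\<^sub>R v, v}) = eta (convex hull {0, u - s *\<^sub>R v, (1 - s) *\<^sub>R v})"
    using eta_hull_translation[of "{u, s *\<^sub>R v, v}" "- (s *\<^sub>R v)"] by (simp add: insert_commute algebra_simps)
  have e: "a * max 0 (max (inner x u) (inner x v))
      + (2 * \<kappa> - a) * max 0 (max (- inner x u) (- inner x v)) + inner x t =
      a1 * max 0 (max (inner x u) (s * inner x v))
      + (2 * \<kappa> - a1) * max 0 (max (- inner x u) (- (s * inner x v))) + inner x t1
      + (a2 * max 0 (max (inner x u - s * inner x v) ((1 - s) * inner x v))
      + (2 * \<kappa> - a2) * max 0 (max (- (inner x u - s * inner x v)) (- ((1 - s) * inner x v))) + inner x t2)
      - \<kappa> * \<bar>inner x u - s * inner x v\<bar>" for x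
    using split[of x] unfolding tr t t1 t2 inner_diff_right inner_scaleR_right .
  \<comment> \<open>The sample directions are \<open>- v'\<close>, the outer normal of the edge
    \<open>u\<close>, and its two neighbours at offset \<open>s *\<^sub>R u'\<close>. In E1 + E2 - 2
    * E3 the linear terms and everything with \<open>a2\<close> or \<kappa> cancel.\<close>
  have i: "inner (s *\<^sub>R u' - v') u = s" "inner (s *\<^sub>R u' - v') v = -1" "inner (- (s *\<^sub>R u') - v') u = - s"
    "inner (- (s *\<^sub>R u') - v') v = -1" "inner (- v') u = 0" "inner (- v') v = -1"
    by (simp_all add: inner_diff_left d)
  have lin: "inner (s *\<^sub>R u' - v') w + inner (- (s *\<^sub>R u') - v') w = 2 * inner (- v') w" for w
    by (simp add: inner_diff_left)
  have E1: "a * s + (2 * \<kappa> - a) * 1 + inner (s *\<^sub>R u' - v') t = a1 * s + (2 * \<kappa> - a1) * s + inner (s *\<^sub>R u' - v') t1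
      + (a2 * (2 * s) + (2 * \<kappa> - a2) * (1 - s) + inner (s *\<^sub>R u' - v') t2) - \<kappa> * (2 * s)"
    using e[of "s *\<^sub>R u' - v'"] s unfolding i by (simp add: max_def split: if_splits)
  have E2: "(2 * \<kappa> - a) * 1 + inner (- (s *\<^sub>R u') - v') t = (2 * \<kappa> - a1) * s + inner (- (s *\<^sub>R u') - v') t1
      + ((2 * \<kappa> - a2) * (1 - s) + inner (- (s *\<^sub>R u') - v') t2)"
    using e[of "- (s *\<^sub>R u') - v'"] s unfolding i by (simp add: max_def split: if_splits)
  have E3: "(2 * \<kappa> - a) * 1 + inner (- v') t = (2 * \<kappa> - a1) * s + inner (- v') t1
      + (a2 * s + (2 * \<kappa> - a2) * (1 - s) + inner (- v') t2) - \<kappa> * s"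
    using e[of "- v'"] s unfolding i by (simp add: max_def split: if_splits)
  have "a * s = a1 * s" using E1 E2 E3 lin[of t] lin[of t1] lin[of t2]
    by (simp only: left_diff_distrib right_diff_distrib mult.assoc mult_1_right mult_ac)
  then show ?thesis using s by simp
qed

lemma tri_form_scale:
  assumes uv: "cross u v \<noteq> 0" and s: "0 < s" and a: "tri_form a u v"
  shows "tri_form a u (s *\<^sub>R v)"
proof -
  have less: "tri_form a u (s *\<^sub>R v)" if uv: "cross u v \<noteq> 0" and s: "0 < s" "s < 1" and a: "tri_form a u v" for s v a
    using tri_form_exists[of u "s *\<^sub>R v"] tri_form_scale_less[OF uv s a] uv s by (metis cross_scaleR_right mult_eq_0_iff less_irrefl)
  \<comment> \<open>Cutting only yields factors below 1, so \<open>v\<close> and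
    \<open>s *\<^sub>R v\<close> are both compared with the shorter side
    \<open>r *\<^sub>R v\<close>.\<close>
  define r where "r = min 1 s / 2"
  have r: "0 < r" "r < 1" "r / s < 1" "0 < r / s" using s by (auto simp: r_def)
  have cs: "cross u (s *\<^sub>R v) \<noteq> 0" using uv s by (simp add: cross_scaleR_right)
  obtain b where b: "tri_form b u (s *\<^sub>R v)" using tri_form_exists[OF cs] by metis
  have "tri_form b u ((r / s) *\<^sub>R (s *\<^sub>R v))" by (rule less[OF cs r(4,3) b])
  then have "tri_form b u (r *\<^sub>R v)" using s by simp
  then have "a = b" by (rule tri_form_scale_less[OF uv r(1,2) a])
  then show ?thesis using b by simp
qed

lemma tri_form_scale_left:
  assumes uv: "cross u v \<noteq> 0" and s: "0 < s" and a: "tri_form a u v"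
  shows "tri_form a (s *\<^sub>R u) v"
proof -
  have "cross v u \<noteq> 0" using uv cross_swap[of u v] by simp
  from tri_form_scale[OF this s tri_form_swap[OF a]] show ?thesis by (rule tri_form_swap)
qed

text \<open>A shear is made of two scalings from different vertices: scaling by \<open>s\<close>
  from \<open>u\<close> moves \<open>v\<close> to \<open>u + s *\<^sub>R (v - u)\<close>, and
  scaling this side by 1/s from 0 gives \<open>v + r *\<^sub>R u\<close> when 1/s = 1 + r, which
  must be positive.\<close>

lemma tri_form_shear_gt:
  assumes uv: "cross u v \<noteq> 0" and r: "r > -1" and a: "tri_form a u v"
  shows "tri_form a u (v + r *\<^sub>R u)"
proof -
  define s where "s = 1 / (1 + r)"
  have s: "s > 0" "1 / s = 1 + r" using r by (auto simp: s_def)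
  have c1: "cross (v - u) (- u) \<noteq> 0" using uv by (simp add: cross_def algebra_simps)
  have "tri_form a (s *\<^sub>R (v - u)) (- u)"
    by (rule tri_form_scale_left[OF c1 s(1) tri_form_translate[OF a]])
  from tri_form_translate[OF tri_form_swap[OF this]]
  have "tri_form a (s *\<^sub>R (v - u) + u) u" by simp
  then have *: "tri_form a u (u + s *\<^sub>R (v - u))" by (simp add: tri_form_swap add.commute)
  have "cross u (u + s *\<^sub>R (v - u)) = s * cross u v" by (simp add: cross_def algebra_simps)
  then have "tri_form a u ((1 / s) *\<^sub>R (u + s *\<^sub>R (v - u)))"
    using uv s r by (intro tri_form_scale *) auto
  moreover have "(1 / s) *\<^sub>R (u + s *\<^sub>R (v - u)) = (1 / s) *\<^sub>R u + (v - u)"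
    using s(1) by (simp add: scaleR_add_right)
  moreover have "\<dots> = v + r *\<^sub>R u" unfolding s(2) by (simp add: scaleR_add_left)
  ultimately show ?thesis by simp
qed

text \<open>Lengthening \<open>u\<close> by the factor \<open>k\<close> brings the shear parameter
  to \<open>r / k\<close>, which exceeds -1.\<close>

lemma tri_form_shear:
  assumes uv: "cross u v \<noteq> 0" and a: "tri_form a u v"
  shows "tri_form a u (v + r *\<^sub>R u)"
proof -
  define k where "k = \<bar>r\<bar> + 1"
  have k: "k > 0" "r / k > -1" by (auto simp: k_def field_simps)
  have c: "cross (k *\<^sub>R u) v \<noteq> 0" using uv k by (auto simp: cross_def)
  have "tri_form a (k *\<^sub>R u) (v + (r / k) *\<^sub>R (k *\<^sub>R u))"
    by (rule tri_form_shear_gt[OF c k(2) tri_form_scale_left[OF uv k(1) a]])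
  then have *: "tri_form a (k *\<^sub>R u) (v + r *\<^sub>R u)" using k by simp
  have "cross (k *\<^sub>R u) (v + r *\<^sub>R u) = k * cross u v" by (simp add: cross_def algebra_simps)
  then have "tri_form a ((1 / k) *\<^sub>R (k *\<^sub>R u)) (v + r *\<^sub>R u)"
    using uv k by (intro tri_form_scale_left *) auto
  then show ?thesis using k by simp
qed

text \<open>By \<open>polar_basis\<close>, rotations, scalings and shears lead from one right
  triangle to every positively oriented one, and they keep the coefficient; swapping the sides
  handles the other orientation.\<close>

lemma tri_form_uniform:
  obtains a where "0 \<le> a" "a \<le> 2 * \<kappa>" "\<And>u v. cross u v \<noteq> 0 \<Longrightarrow> tri_form a u v"
proof -
  have c0: "cross (unit_dir 0) (unit_dir (pi/2)) = 1" by (simp add: cross_def unit_dir_def vector_2)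
  then obtain a where a: "0 \<le> a" "a \<le> 2 * \<kappa>" "tri_form a (unit_dir 0) (unit_dir (pi/2))"
    using tri_form_exists[of "unit_dir 0" "unit_dir (pi/2)"] by auto
  have pos: "tri_form a u v" if pos_uv: "cross u v > 0" for u v
  proof -
    obtain r \<theta> \<alpha> \<beta> where p: "r > 0" "\<beta> > 0" "u = r *\<^sub>R unit_dir \<theta>"
      "v = \<alpha> *\<^sub>R unit_dir \<theta> + \<beta> *\<^sub>R unit_dir (\<theta> + pi/2)" using polar_basis[OF pos_uv] by metis
    have c: "cross (unit_dir \<theta>) (unit_dir (\<theta> + pi/2)) = 1"
      using c0 cross_rot[of \<theta> "unit_dir 0" "unit_dir (pi/2)"] by (simp add: rot_unit_dir)
    have "tri_form a (unit_dir \<theta>) (unit_dir (\<theta> + pi/2))"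
      using tri_form_rot[OF a(3), of \<theta>] by (simp add: rot_unit_dir)
    then have "tri_form a (unit_dir \<theta>) (\<beta> *\<^sub>R unit_dir (\<theta> + pi/2))" using c p by (intro tri_form_scale) auto
    then have "tri_form a (unit_dir \<theta>) (\<beta> *\<^sub>R unit_dir (\<theta> + pi/2) + \<alpha> *\<^sub>R unit_dir \<theta>)"
      using c p by (intro tri_form_shear) (auto simp: cross_scaleR_right)
    then have "tri_form a (unit_dir \<theta>) v" using p(4) by (simp add: add.commute)
    moreover have "cross (unit_dir \<theta>) v \<noteq> 0" using that unfolding p(3) by (auto simp: cross_def algebra_simps)
    ultimately show ?thesis unfolding p(3) using p by (intro tri_form_scale_left)
  qed
  have "tri_form a u v" if "cross u v \<noteq> 0" for u v
  proof (cases "cross u v > 0")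
    case False
    then show ?thesis using that cross_swap[of u v] by (intro tri_form_swap[OF pos]) auto
  qed (rule pos)
  then show thesis using a that by blast
qed

end

section \<open>The Steiner point of the image of a triangle\<close>

lemma rectangle_crossing:
  fixes P S :: pt
  assumes "0 \<le> x" "x < 1" "0 \<le> y" "y < 1"
  obtains m where "m \<in> closed_segment (P + y *\<^sub>R S) (S + x *\<^sub>R P)" "m \<in> closed_segment 0 (P + S)"
proof
  \<comment> \<open>The parameter at which the coordinates along \<open>P\<close> and
    \<open>S\<close> agree, which puts the point on the diagonal; \<open>x\<close> and
    \<open>y\<close> below 1 keep the denominator positive.\<close>
  define l where "l = (1 - y) / ((1 - y) + (1 - x))"
  have l: "0 \<le> l" "l \<le> 1" using assms by (auto simp: l_def field_simps)
  have "l * ((1 - y) + (1 - x)) = 1 - y" using assms by (simp add: l_def)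
  then have e: "(1 - l) * y + l = (1 - l) + l * x" by (simp add: algebra_simps)
  let ?\<mu> = "(1 - l) + l * x"
  have mu: "0 \<le> ?\<mu>" "?\<mu> \<le> 1" using l assms mult_left_mono[of x 1 l] by auto
  have "(1 - l) *\<^sub>R (P + y *\<^sub>R S) + l *\<^sub>R (S + x *\<^sub>R P) = ((1 - l) + l * x) *\<^sub>R P + ((1 - l) * y + l) *\<^sub>R S"
    by (simp only: scaleR_add_right scaleR_add_left scaleR_scaleR add_ac)
  also have "\<dots> = ?\<mu> *\<^sub>R (P + S)" unfolding e by (simp only: scaleR_add_right)
  finally have f: "?\<mu> *\<^sub>R (P + S) = (1 - l) *\<^sub>R (P + y *\<^sub>R S) + l *\<^sub>R (S + x *\<^sub>R P)" by simp
  show "?\<mu> *\<^sub>R (P + S) \<in> closed_segment (P + y *\<^sub>R S) (S + x *\<^sub>R P)"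
    unfolding in_segment using l f by metis
  show "?\<mu> *\<^sub>R (P + S) \<in> closed_segment 0 (P + S)"
    unfolding in_segment using mu by (intro exI[of _ ?\<mu>]) simp
qed

context rotation_endo_frame
begin

definition tri_steiner :: "pt \<Rightarrow> pt \<Rightarrow> pt \<Rightarrow> pt" where
  "tri_steiner p q r = steiner (eta (convex hull {p, q, r}))"

lemma tri_steiner_commute: "tri_steiner p q r = tri_steiner q p r" "tri_steiner p q r = tri_steiner p r q"
  by (simp_all add: tri_steiner_def insert_commute)

lemma convex_body_triangle: "convex_body (convex hull {p, q, r})"
  by (rule convex_body_hull) auto

lemma steiner_eta_segment: "steiner (\<lambda>x. \<kappa> * \<bar>inner x v\<bar>) = 0"
  by (rule steiner_even) (auto intro!: continuous_intros)

lemma tri_steiner_degenerate [simp]: "tri_steiner p p q = 0" "tri_steiner p q p = 0" "tri_steiner q p p = 0"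
proof -
  have *: "eta (convex hull {p, q}) = (\<lambda>x. \<kappa> * \<bar>inner x (q - p)\<bar>)" for p q by (rule ext) (rule eta_segment)
  show "tri_steiner p p q = 0" "tri_steiner p q p = 0" "tri_steiner q p p = 0"
    using * by (simp_all add: tri_steiner_def insert_commute steiner_eta_segment)
qed

text \<open>The diagonal contributes an even function, which \<open>steiner\<close> annihilates, so
  a cut becomes plain additivity.\<close>

lemma steiner_eta_quad:
  assumes "m \<in> closed_segment a b" "m \<in> closed_segment p q"
  shows "steiner (eta (convex hull {p, q, a, b})) = tri_steiner p q a + tri_steiner p q b"
proof -
  have "(\<lambda>x. eta (convex hull {p, q, a}) x + eta (convex hull {p, q, b}) x)
    = (\<lambda>x. eta (convex hull {p, q, a, b}) x + \<kappa> * \<bar>inner x (q - p)\<bar>)"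
    by (rule ext) (rule eta_cut[OF assms])
  then have "steiner (\<lambda>x. eta (convex hull {p, q, a}) x + eta (convex hull {p, q, b}) x)
    = steiner (\<lambda>x. eta (convex hull {p, q, a, b}) x + \<kappa> * \<bar>inner x (q - p)\<bar>)" by simp
  moreover have "convex_body (convex hull {p, q, a, b})" by (rule convex_body_hull) auto
  ultimately show ?thesis
    by (simp add: steiner_add continuous_on_eta convex_body_triangle continuous_intros tri_steiner_def steiner_eta_segment)
qed

text \<open>Both diagonals triangulate the same quadrilateral; the dissections below are built from
  such flips.\<close>

lemma tri_steiner_quad:
  assumes "m \<in> closed_segment a b" "m \<in> closed_segment p q"
  shows "tri_steiner p q a + tri_steiner p q b = tri_steiner a b p + tri_steiner a b q"
  using steiner_eta_quad[OF assms] steiner_eta_quad[OF assms(2,1)] by (simp add: insert_commute)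

text \<open>A flip with diagonals from \<open>p\<close> to \<open>q\<close> and from
  \<open>m\<close> to \<open>r\<close>, in which the triangle \<open>p\<close>, \<open>q\<close>,
  \<open>m\<close> is degenerate and contributes 0.\<close>

lemma tri_steiner_split:
  assumes "m \<in> closed_segment p q"
  shows "tri_steiner p q r = tri_steiner p m r + tri_steiner m q r"
proof -
  have "tri_steiner p q m = tri_steiner p q p" using hull_redundant_vertex[OF assms, of p]
    by (simp add: tri_steiner_def insert_commute del: tri_steiner_degenerate)
  moreover have "tri_steiner m r p + tri_steiner m r q = tri_steiner p q m + tri_steiner p q r" by (rule tri_steiner_quad[OF assms]) simp
  moreover have "tri_steiner m r p = tri_steiner p m r" "tri_steiner m r q = tri_steiner m q r" by (metis tri_steiner_commute)+
  ultimately show ?thesis by simp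
qed

lemma tri_steiner_translation: "tri_steiner (p + d) (q + d) (r + d) = tri_steiner p q r"
  unfolding tri_steiner_def using eta_hull_translation[of "{p, q, r}" d] by simp

lemma tri_steiner_rot: "tri_steiner (rot a *v p) (rot a *v q) (rot a *v r) = rot a *v tri_steiner p q r"
proof -
  have "eta (convex hull {rot a *v p, rot a *v q, rot a *v r}) = (\<lambda>x. eta (convex hull {p, q, r}) (rot (- a) *v x))"
    using eta_hull_rot[of "{p, q, r}" a] by auto
  then show ?thesis
    unfolding tri_steiner_def by (simp add: steiner_rot continuous_on_eta convex_body_triangle)
qed

lemma tri_steiner_uminus: "tri_steiner (- p) (- q) (- r) = - tri_steiner p q r"
  using tri_steiner_rot[of pi p q r] by (simp add: rot_pi)

lemma tri_steiner_parallelogram: "tri_steiner u v 0 + tri_steiner u v (u + v) = 0"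
proof -
  have m: "(1/2) *\<^sub>R (u + v) \<in> closed_segment 0 (u + v)" "(1/2) *\<^sub>R (u + v) \<in> closed_segment u v"
    by (auto simp: in_segment scaleR_add_right intro!: exI[of _ "1/2"])
  have "steiner (eta (par u v)) = 0"
    by (rule steiner_even) (auto intro!: continuous_on_eta convex_body_par eta_par_even)
  then show ?thesis using steiner_eta_quad[OF m] by (simp add: par_def insert_commute)
qed

lemma steiner_eta_continuous:
  assumes K: "convex_body K" and e: "e > 0"
  shows "\<exists>d>0. \<forall>L. convex_body L \<longrightarrow> hausdorff_dist K L < d \<longrightarrow> dist (steiner (eta K)) (steiner (eta L)) < e"
proof -
  obtain d where d: "d > 0" "\<And>L x. convex_body L \<Longrightarrow> hausdorff_dist K L < d \<Longrightarrow> norm x = 1 \<Longrightarrow> dist (H K x) (H L x) < e / 4"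
    using H_continuous[OF K, of "e / 4"] e by auto
  have "dist (steiner (eta K)) (steiner (eta L)) < e" if L: "convex_body L" "hausdorff_dist K L < d" for L
  proof -
    have "norm (steiner (eta K) - steiner (eta L)) \<le> 2 * (e / 4)"
      using d(2)[OF L] K L
      by (intro steiner_bound continuous_on_eta) (auto simp: eta_def dist_real_def intro: less_imp_le)
    then show ?thesis using e by (simp add: dist_norm)
  qed
  then show ?thesis using d(1) by blast
qed

lemma continuous_on_zt:
  fixes S :: "real set"
  assumes "continuous_on S p" "continuous_on S q" "continuous_on S r"
  shows "continuous_on S (\<lambda>s. tri_steiner (p s) (q s) (r s))"
proof -
  have "continuous_on S (\<lambda>s. steiner (eta (convex hull ((\<lambda>p. p s) ` {p, q, r}))))"
    by (rule continuous_on_hull_image) (use assms steiner_eta_continuous in auto)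
  then show ?thesis by (simp add: tri_steiner_def)
qed

text \<open>With \<open>?B\<close> on the side opposite to 0, the large triangle splits into
  translates of the triangles of sizes \<open>s\<close> and \<open>t\<close> and a parallelogram 0,
  \<open>?A\<close>, \<open>?B\<close>, \<open>?D\<close>, whose contribution vanishes by
  symmetry.\<close>

lemma tri_steiner_scale_add:
  assumes s: "s > 0" "t > 0"
  shows "tri_steiner 0 ((s + t) *\<^sub>R u) ((s + t) *\<^sub>R v) = tri_steiner 0 (s *\<^sub>R u) (s *\<^sub>R v) + tri_steiner 0 (t *\<^sub>R u) (t *\<^sub>R v)"
proof -
  let ?U = "(s + t) *\<^sub>R u" and ?V = "(s + t) *\<^sub>R v" and ?A = "s *\<^sub>R u" and ?D = "t *\<^sub>R v"
  let ?B = "?A + ?D"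
  define l where "l = s / (s + t)"
  have l: "0 \<le> l" "l \<le> 1" "l * (s + t) = s" "(1 - l) * (s + t) = t" using s by (auto simp: l_def field_simps)
  have A: "?A \<in> closed_segment 0 ?U"
    unfolding in_segment using l by (intro exI[of _ l]) simp
  have D: "?D \<in> closed_segment 0 ?V"
    unfolding in_segment using l by (intro exI[of _ "1 - l"]) simp
  have B: "?B \<in> closed_segment ?V ?U"
    unfolding in_segment using l by (intro exI[of _ l]) simp
  have m: "l *\<^sub>R ?A + ?D \<in> closed_segment ?D ?B" "l *\<^sub>R ?A + ?D \<in> closed_segment ?A ?V"
  proof -
    show "l *\<^sub>R ?A + ?D \<in> closed_segment ?D ?B"
      unfolding in_segment using l by (intro exI[of _ l]) (simp add: algebra_simps)
    have "(1 - l) *\<^sub>R ?V = ?D" using l by simp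
    then show "l *\<^sub>R ?A + ?D \<in> closed_segment ?A ?V"
      unfolding in_segment using l by (intro exI[of _ "1 - l"]) simp
  qed
  have 1: "tri_steiner 0 ?U ?V = tri_steiner 0 ?A ?V + tri_steiner ?A ?U ?V" by (rule tri_steiner_split[OF A])
  have 2: "tri_steiner ?V ?U ?A = tri_steiner ?V ?B ?A + tri_steiner ?B ?U ?A" by (rule tri_steiner_split[OF B])
  have 3: "tri_steiner 0 ?V ?A = tri_steiner 0 ?D ?A + tri_steiner ?D ?V ?A" by (rule tri_steiner_split[OF D])
  have 4: "tri_steiner ?A ?V ?D + tri_steiner ?A ?V ?B = tri_steiner ?D ?B ?A + tri_steiner ?D ?B ?V" by (rule tri_steiner_quad[OF m])
  have 5: "tri_steiner ?A ?D 0 + tri_steiner ?A ?D ?B = 0" by (rule tri_steiner_parallelogram)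
  have 6: "tri_steiner ?B ?U ?A = tri_steiner 0 (t *\<^sub>R u) (t *\<^sub>R v)"
    using tri_steiner_translation[of ?D ?A "t *\<^sub>R u" 0] tri_steiner_translation[of "t *\<^sub>R v" ?A "t *\<^sub>R u" 0]
    by (simp add: scaleR_add_left add_ac) (metis tri_steiner_commute)
  have 7: "tri_steiner ?D ?B ?V = tri_steiner 0 (s *\<^sub>R u) (s *\<^sub>R v)"
    using tri_steiner_translation[of 0 ?D "s *\<^sub>R u" "s *\<^sub>R v"] by (simp add: scaleR_add_left add_ac)
  note c = tri_steiner_commute
  have "tri_steiner 0 ?U ?V = tri_steiner 0 ?V ?A + tri_steiner ?V ?U ?A" using 1 c by metis
  also have "\<dots> = tri_steiner 0 ?D ?A + (tri_steiner ?A ?V ?D + tri_steiner ?A ?V ?B) + tri_steiner ?B ?U ?A"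
    unfolding 2 3 using c by (simp add: add_ac)
  also have "\<dots> = (tri_steiner ?A ?D 0 + tri_steiner ?A ?D ?B) + tri_steiner ?D ?B ?V + tri_steiner ?B ?U ?A"
    unfolding 4 using c by (simp add: add_ac)
  finally show ?thesis unfolding 5 6 7 by simp
qed

lemma tri_steiner_scale:
  assumes s: "s > 0"
  shows "tri_steiner 0 (s *\<^sub>R u) (s *\<^sub>R v) = s *\<^sub>R tri_steiner 0 u v"
proof -
  have "(\<lambda>s. tri_steiner 0 (s *\<^sub>R u) (s *\<^sub>R v)) s = s *\<^sub>R (\<lambda>s. tri_steiner 0 (s *\<^sub>R u) (s *\<^sub>R v)) 1"
    by (rule additive_ray) (auto intro!: tri_steiner_scale_add s continuous_on_zt continuous_intros)
  then show ?thesis by simp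
qed

text \<open>The parallelogram is first halved by the diagonal from 0 to \<open>P + S\<close>; both
  halves are split at the points \<open>?M\<close> and \<open>?H\<close> on their outer sides, and a
  flip in 0, \<open>?M\<close>, \<open>?Q\<close>, \<open>?H\<close> gives the four
  triangles.\<close>

lemma tri_steiner_rectangle:
  assumes "0 \<le> x" "x < 1" "0 \<le> y" "y < 1"
  shows "tri_steiner 0 P (P + y *\<^sub>R S) + tri_steiner 0 (P + y *\<^sub>R S) (S + x *\<^sub>R P)
    + tri_steiner (P + y *\<^sub>R S) (P + S) (S + x *\<^sub>R P) + tri_steiner 0 (S + x *\<^sub>R P) S = 0"
proof -
  let ?M = "P + y *\<^sub>R S" and ?H = "S + x *\<^sub>R P" and ?Q = "P + S"
  have M: "?M \<in> closed_segment P ?Q"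
    unfolding in_segment using assms by (intro exI[of _ y]) (simp add: algebra_simps)
  have H: "?H \<in> closed_segment S ?Q"
    unfolding in_segment using assms by (intro exI[of _ x]) (simp add: algebra_simps)
  obtain m where m: "m \<in> closed_segment ?M ?H" "m \<in> closed_segment 0 ?Q"
    using rectangle_crossing[OF assms] by metis
  have h: "(1/2) *\<^sub>R ?Q \<in> closed_segment P S" "(1/2) *\<^sub>R ?Q \<in> closed_segment 0 ?Q"
    by (auto simp: in_segment scaleR_add_right intro!: exI[of _ "1/2"])
  have 1: "tri_steiner 0 ?Q P + tri_steiner 0 ?Q S = 0"
    using tri_steiner_quad[OF h] tri_steiner_parallelogram[of P S] by simp
  have 2: "tri_steiner P ?Q 0 = tri_steiner P ?M 0 + tri_steiner ?M ?Q 0" by (rule tri_steiner_split[OF M])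
  have 3: "tri_steiner S ?Q 0 = tri_steiner S ?H 0 + tri_steiner ?H ?Q 0" by (rule tri_steiner_split[OF H])
  have 4: "tri_steiner 0 ?Q ?M + tri_steiner 0 ?Q ?H = tri_steiner ?M ?H 0 + tri_steiner ?M ?H ?Q" by (rule tri_steiner_quad[OF m])
  have c: "tri_steiner P ?Q 0 = tri_steiner 0 ?Q P" "tri_steiner S ?Q 0 = tri_steiner 0 ?Q S" "tri_steiner P ?M 0 = tri_steiner 0 P ?M" "tri_steiner ?M ?Q 0 = tri_steiner 0 ?Q ?M"
    "tri_steiner S ?H 0 = tri_steiner 0 ?H S" "tri_steiner ?H ?Q 0 = tri_steiner 0 ?Q ?H" "tri_steiner ?M ?H 0 = tri_steiner 0 ?M ?H" "tri_steiner ?M ?H ?Q = tri_steiner ?M ?Q ?H"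
    by (metis tri_steiner_commute)+
  have "0 = (tri_steiner 0 P ?M + tri_steiner 0 ?Q ?M) + (tri_steiner 0 ?H S + tri_steiner 0 ?Q ?H)"
    using 1 2 3 unfolding c by simp
  also have "\<dots> = tri_steiner 0 P ?M + tri_steiner 0 ?H S + (tri_steiner 0 ?Q ?M + tri_steiner 0 ?Q ?H)" by (simp add: add_ac)
  also have "\<dots> = tri_steiner 0 P ?M + tri_steiner 0 ?H S + (tri_steiner 0 ?M ?H + tri_steiner ?M ?Q ?H)" using 4 unfolding c by simp
  finally show ?thesis by (simp add: add_ac)
qed

text \<open>The hypotenuse runs from 0 to \<open>unit_dir \<theta>\<close> and the right angle lies
  on the first axis. At pi/2 the triangle degenerates to a segment, which is why the value there is
  0.\<close>

definition right_tri_steiner :: "real \<Rightarrow> pt" where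
  "right_tri_steiner \<theta> = tri_steiner 0 (cos \<theta> *\<^sub>R unit_dir 0) (unit_dir \<theta>)"

text \<open>The classical proof picture of the addition theorem for sine and cosine: a rectangle cut into
  four right triangles.\<close>
lemma right_tri_steiner_add:
  assumes "0 < \<theta>" "0 < \<eta>" "\<theta> + \<eta> \<le> pi/2"
  shows "right_tri_steiner (\<theta> + \<eta>) = rot \<theta> *v right_tri_steiner \<eta> + rot \<eta> *v right_tri_steiner \<theta>"
proof -
  have pos: "cos \<theta> > 0" "cos \<eta> > 0" "sin \<theta> > 0" "sin \<eta> > 0"
    using assms by (auto intro!: cos_gt_zero_pi sin_gt_zero)
  have cge: "cos (\<theta> + \<eta>) \<ge> 0" using assms by (intro cos_ge_zero) auto
  define X where "X = cos \<theta> * cos \<eta>"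
  define Y where "Y = sin (\<theta> + \<eta>)"
  have X: "X > 0" and Y: "Y > 0" using pos by (auto simp: X_def Y_def sin_add add_pos_pos)
  \<comment> \<open>\<open>x\<close> and \<open>y\<close> are chosen so that
    \<open>S + x *\<^sub>R P\<close> is \<open>unit_dir (\<theta> + \<eta>)\<close> and
    \<open>P + y *\<^sub>R S\<close> is the foot of its perpendicular on the ray at angle
    \<open>\<eta>\<close>.\<close>
  define x where "x = cos (\<theta> + \<eta>) / X"
  define y where "y = cos \<theta> * sin \<eta> / Y"
  have xy: "0 \<le> x" "x < 1" "0 \<le> y" "y < 1"
    using X Y cge pos by (auto simp: x_def y_def divide_less_eq) (auto simp: X_def Y_def cos_add sin_add)
  let ?e = "unit_dir 0" and ?f = "unit_dir (pi/2)"
  define P where "P = X *\<^sub>R ?e"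
  define S where "S = Y *\<^sub>R ?f"
  have M: "P + y *\<^sub>R S = cos \<theta> *\<^sub>R unit_dir \<eta>"
    using Y by (simp add: P_def S_def X_def y_def vec_eq_iff forall_2 unit_dir_def vector_2)
  have Hh: "S + x *\<^sub>R P = unit_dir (\<theta> + \<eta>)"
    using X by (simp add: P_def S_def Y_def x_def vec_eq_iff forall_2 unit_dir_def vector_2)
  have 1: "tri_steiner 0 P (P + y *\<^sub>R S) = cos \<theta> *\<^sub>R right_tri_steiner \<eta>"
    unfolding M right_tri_steiner_def using tri_steiner_scale[OF pos(1), of "cos \<eta> *\<^sub>R ?e" "unit_dir \<eta>"]
    by (simp add: P_def X_def)
  have 2: "tri_steiner 0 (P + y *\<^sub>R S) (S + x *\<^sub>R P) = rot \<eta> *v right_tri_steiner \<theta>"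
    unfolding M Hh right_tri_steiner_def tri_steiner_rot[symmetric] by (simp add: matrix_vector_mult_scaleR rot_unit_dir add.commute)
  \<comment> \<open>The triangle at the corner \<open>P + S\<close> has hypotenuse sin \<theta> and
    is the triangle of angle \<eta> turned by a quarter.\<close>
  have 3: "tri_steiner (P + y *\<^sub>R S) (P + S) (S + x *\<^sub>R P) = sin \<theta> *\<^sub>R (rot (pi/2) *v right_tri_steiner \<eta>)"
  proof -
    have "P + S = sin \<theta> *\<^sub>R (rot (pi/2) *v (cos \<eta> *\<^sub>R ?e)) + (P + y *\<^sub>R S)"
      unfolding M by (simp add: P_def S_def X_def Y_def vec_eq_iff forall_2 unit_dir_def vector_2 rot_apply sin_add algebra_simps)
    moreover have "S + x *\<^sub>R P = sin \<theta> *\<^sub>R (rot (pi/2) *v unit_dir \<eta>) + (P + y *\<^sub>R S)"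
      unfolding M Hh by (simp add: vec_eq_iff forall_2 unit_dir_def vector_2 rot_apply sin_add cos_add algebra_simps)
    ultimately have "tri_steiner (P + y *\<^sub>R S) (P + S) (S + x *\<^sub>R P)
        = tri_steiner 0 (sin \<theta> *\<^sub>R (rot (pi/2) *v (cos \<eta> *\<^sub>R ?e))) (sin \<theta> *\<^sub>R (rot (pi/2) *v unit_dir \<eta>))"
      using tri_steiner_translation[of 0 "P + y *\<^sub>R S"] by (metis add_0)
    also have "\<dots> = sin \<theta> *\<^sub>R tri_steiner (rot (pi/2) *v 0) (rot (pi/2) *v (cos \<eta> *\<^sub>R ?e)) (rot (pi/2) *v unit_dir \<eta>)"
      using pos by (simp add: tri_steiner_scale)
    finally show ?thesis unfolding tri_steiner_rot right_tri_steiner_def .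
  qed
  \<comment> \<open>This triangle is, up to translation, the point reflection of the one of angle
    \<theta> + \<eta>, hence the sign.\<close>
  have 4: "tri_steiner 0 (S + x *\<^sub>R P) S = - right_tri_steiner (\<theta> + \<eta>)"
  proof -
    have "S = - (cos (\<theta> + \<eta>) *\<^sub>R ?e) + unit_dir (\<theta> + \<eta>)"
      by (simp add: S_def Y_def vec_eq_iff forall_2 unit_dir_def vector_2)
    then have "tri_steiner 0 (S + x *\<^sub>R P) S = tri_steiner (- unit_dir (\<theta> + \<eta>) + unit_dir (\<theta> + \<eta>)) (- 0 + unit_dir (\<theta> + \<eta>))
        (- (cos (\<theta> + \<eta>) *\<^sub>R ?e) + unit_dir (\<theta> + \<eta>))"
      unfolding Hh by simp
    also have "\<dots> = - tri_steiner (unit_dir (\<theta> + \<eta>)) 0 (cos (\<theta> + \<eta>) *\<^sub>R ?e)"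
      unfolding tri_steiner_translation tri_steiner_uminus ..
    finally show ?thesis unfolding right_tri_steiner_def using tri_steiner_commute by metis
  qed
  have "cos \<theta> *\<^sub>R right_tri_steiner \<eta> + rot \<eta> *v right_tri_steiner \<theta> + sin \<theta> *\<^sub>R (rot (pi/2) *v right_tri_steiner \<eta>) + - right_tri_steiner (\<theta> + \<eta>) = 0"
    using tri_steiner_rectangle[OF xy, of P S] unfolding 1 2 3 4 .
  then show ?thesis using rot_eq_cos_sin[of \<theta> "right_tri_steiner \<eta>"] by (simp add: algebra_simps)
qed

lemma right_tri_steiner_eq_0:
  assumes "0 < \<theta>" "\<theta> \<le> pi/2"
  shows "right_tri_steiner \<theta> = 0"
proof -
  let ?N = "\<lambda>\<theta>. rot (- \<theta>) *v right_tri_steiner \<theta>"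
  have "?N \<theta> = (\<theta> / (pi/2)) *\<^sub>R ?N (pi/2)"
  proof (rule additive_interval)
    fix s t :: real assume st: "0 < s" "0 < t" "s + t \<le> pi/2"
    show "?N (s + t) = ?N s + ?N t"
      unfolding right_tri_steiner_add[OF st] by (simp add: matrix_vector_right_distrib rot_rot add.commute)
  next
    show "continuous_on {0<..pi/2} ?N"
      unfolding rot_eq_cos_sin[of "- _"] right_tri_steiner_def
      by (intro continuous_intros continuous_on_zt
           bounded_linear.continuous_on[OF matrix_vector_mul_bounded_linear])
  qed (use assms in auto)
  moreover have "right_tri_steiner (pi/2) = 0" by (simp add: right_tri_steiner_def)
  ultimately have "?N \<theta> = 0" by simp
  then have "rot \<theta> *v (?N \<theta>) = 0" by simp
  then show ?thesis by (simp add: rot_rot)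
qed

text \<open>The vertex 0 of the reference triangle is moved to the end of the leg of length
  \<open>q\<close>, and the rotation by t - pi/2 brings the right angle to \<open>m\<close>. So the
  angle there has cosine q / r, with r the hypotenuse.\<close>

lemma tri_steiner_right:
  assumes "p > 0" "q > 0"
  shows "tri_steiner m (m + p *\<^sub>R unit_dir t) (m + q *\<^sub>R unit_dir (t + pi/2)) = 0"
proof -
  define r where "r = sqrt (p\<^sup>2 + q\<^sup>2)"
  have pq: "p\<^sup>2 + q\<^sup>2 > 0" using assms by (simp add: add_pos_pos)
  have r: "r > 0" "r\<^sup>2 = p\<^sup>2 + q\<^sup>2" using pq by (auto simp: r_def)
  have "(q / r)\<^sup>2 + (p / r)\<^sup>2 = (p\<^sup>2 + q\<^sup>2) / r\<^sup>2"
    by (simp add: power_divide add_divide_distrib)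
  then have "(q / r)\<^sup>2 + (p / r)\<^sup>2 = 1" unfolding r(2) using assms by simp
  moreover have "q / r \<ge> 0" "p / r \<ge> 0" using assms r by auto
  ultimately obtain \<phi> where \<phi>: "0 \<le> \<phi>" "\<phi> \<le> pi/2" "q / r = cos \<phi>" "p / r = sin \<phi>"
    using sincos_total_pi_half by metis
  have "\<phi> \<noteq> 0" using \<phi>(4) assms r by auto
  then have "right_tri_steiner \<phi> = 0" using \<phi> by (intro right_tri_steiner_eq_0) auto
  then have "tri_steiner 0 (r *\<^sub>R (cos \<phi> *\<^sub>R unit_dir 0)) (r *\<^sub>R unit_dir \<phi>) = 0"
    using tri_steiner_scale[OF r(1), of "cos \<phi> *\<^sub>R unit_dir 0" "unit_dir \<phi>"] by (simp add: right_tri_steiner_def)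
  then have "tri_steiner (rot (t - pi/2) *v 0) (rot (t - pi/2) *v (r *\<^sub>R (cos \<phi> *\<^sub>R unit_dir 0)))
      (rot (t - pi/2) *v (r *\<^sub>R unit_dir \<phi>)) = 0" unfolding tri_steiner_rot by simp
  then have "tri_steiner (0 + (m + q *\<^sub>R unit_dir (t + pi/2))) (rot (t - pi/2) *v (r *\<^sub>R (cos \<phi> *\<^sub>R unit_dir 0)) + (m + q *\<^sub>R unit_dir (t + pi/2)))
      (rot (t - pi/2) *v (r *\<^sub>R unit_dir \<phi>) + (m + q *\<^sub>R unit_dir (t + pi/2))) = 0" unfolding tri_steiner_translation by simp
  moreover have c: "r * cos \<phi> = q" "r * sin \<phi> = p" using r by (simp_all flip: \<phi>(3,4))
  have "rot (t - pi/2) *v (r *\<^sub>R (cos \<phi> *\<^sub>R unit_dir 0)) = - (q *\<^sub>R unit_dir (t + pi/2))"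
    unfolding c(1)[symmetric]
    by (simp add: matrix_vector_mult_scaleR rot_unit_dir) (simp add: unit_dir_def vec_eq_iff forall_2 vector_2 cos_add sin_add cos_diff sin_diff)
  moreover have "rot (t - pi/2) *v (r *\<^sub>R unit_dir \<phi>) = p *\<^sub>R unit_dir t - q *\<^sub>R unit_dir (t + pi/2)"
    unfolding c[symmetric]
    by (simp add: matrix_vector_mult_scaleR rot_unit_dir)
      (simp add: unit_dir_def vec_eq_iff forall_2 vector_2 cos_add sin_add cos_diff sin_diff algebra_simps)
  ultimately have "tri_steiner (m + q *\<^sub>R unit_dir (t + pi/2)) m (m + p *\<^sub>R unit_dir t) = 0" by (simp add: add.commute)
  then show ?thesis using tri_steiner_commute by metis
qed

text \<open>The altitude from \<open>v\<close> meets the line of \<open>u\<close> at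
  \<open>\<alpha> *\<^sub>R w\<close>. Triangles with this altitude as a side are right-angled or
  degenerate; the position of the foot decides whether the given triangle is their sum or their
  difference.\<close>

lemma tri_steiner_pos_eq_0:
  assumes "cross u v > 0"
  shows "tri_steiner 0 u v = 0"
proof -
  obtain r \<theta> \<alpha> \<beta> where p: "r > 0" "\<beta> > 0" "u = r *\<^sub>R unit_dir \<theta>"
    "v = \<alpha> *\<^sub>R unit_dir \<theta> + \<beta> *\<^sub>R unit_dir (\<theta> + pi/2)" using polar_basis[OF assms] by metis
  define w where "w = unit_dir \<theta>"
  have foot: "tri_steiner (\<alpha> *\<^sub>R w) (s *\<^sub>R w) v = 0" for s
  proof -
    consider "s > \<alpha>" | "s = \<alpha>" | "s < \<alpha>" by linarith
    then show ?thesis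
    proof cases
      case 1
      then show ?thesis
        using tri_steiner_right[of "s - \<alpha>" \<beta> "\<alpha> *\<^sub>R w" \<theta>] p by (simp add: w_def algebra_simps)
    next
      case 3
      \<comment> \<open>Beyond the foot the legs are taken in the opposite order, so that the second
        is again a quarter turn ahead of the first.\<close>
      have e: "unit_dir (\<theta> + pi/2 + pi/2) = - w" by (simp add: w_def unit_dir_def vec_eq_iff forall_2 vector_2 add.assoc)
      have "tri_steiner (\<alpha> *\<^sub>R w) (\<alpha> *\<^sub>R w + \<beta> *\<^sub>R unit_dir (\<theta> + pi/2)) (\<alpha> *\<^sub>R w + (\<alpha> - s) *\<^sub>R unit_dir (\<theta> + pi/2 + pi/2)) = 0"
        using 3 p by (intro tri_steiner_right) auto
      then have "tri_steiner (\<alpha> *\<^sub>R w) v (s *\<^sub>R w) = 0" unfolding e p(4) by (simp add: w_def algebra_simps)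
      then show ?thesis using tri_steiner_commute by metis
    qed simp
  qed
  have seg: "b *\<^sub>R w \<in> closed_segment (a *\<^sub>R w) (c *\<^sub>R w)" if "a \<le> b" "b \<le> c" "a < c" for a b c
  proof -
    define l where "l = (b - a) / (c - a)"
    have l: "0 \<le> l" "l \<le> 1" "l * (c - a) = b - a" using that by (auto simp: l_def)
    then have "b = (1 - l) * a + l * c" by (simp add: algebra_simps)
    then have "b *\<^sub>R w = (1 - l) *\<^sub>R (a *\<^sub>R w) + l *\<^sub>R (c *\<^sub>R w)" by (simp add: scaleR_add_left)
    then show ?thesis using l unfolding in_segment by blast
  qed
  have f0: "tri_steiner (\<alpha> *\<^sub>R w) 0 v = 0" using foot[of 0] by simp
  have fu: "tri_steiner (\<alpha> *\<^sub>R w) u v = 0" using foot[of r] p by (simp add: w_def)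
  have f0': "tri_steiner 0 (\<alpha> *\<^sub>R w) v = 0" and fu': "tri_steiner u (\<alpha> *\<^sub>R w) v = 0"
    using f0 fu tri_steiner_commute(1) by metis+
  have u: "u = r *\<^sub>R w" using p by (simp add: w_def)
  consider "\<alpha> < 0" | "0 \<le> \<alpha>" "\<alpha> \<le> r" | "\<alpha> > r" by linarith
  then show ?thesis
  proof cases
    case 1
    from tri_steiner_split[OF seg[of \<alpha> 0 r], of v] show ?thesis using 1 p f0 fu by (simp add: u)
  next
    case 2
    from tri_steiner_split[OF seg[of 0 \<alpha> r], of v] show ?thesis using 2 p f0' fu by (simp add: u)
  next
    case 3
    from tri_steiner_split[OF seg[of 0 r \<alpha>], of v] show ?thesis using 3 p f0' fu' by (simp add: u)
  qed
qed

lemma tri_steiner_eq_0: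
  assumes "cross u v \<noteq> 0"
  shows "tri_steiner 0 u v = 0"
proof (cases "cross u v > 0")
  case False
  then show ?thesis using tri_steiner_pos_eq_0[of v u] assms cross_swap[of u v] tri_steiner_commute by simp
qed (rule tri_steiner_pos_eq_0)

end

section \<open>From triangles to convex bodies\<close>

lemma steiner_point_rot:
  assumes "convex_body K"
  shows "steiner_point ((\<lambda>x. rot a *v x) ` K) = rot a *v steiner_point K"
proof -
  have "support_fun ((\<lambda>x. rot a *v x) ` K) = (\<lambda>x. support_fun K (rot (- a) *v x))"
    by (rule ext) (simp add: support_fun_matrix_image assms transpose_rot)
  then show ?thesis by (simp add: steiner_point_eq steiner_rot continuous_on_support_fun assms)
qed

lemma steiner_point_hausdorff:
  assumes "convex_body K" "convex_body L"
  shows "norm (steiner_point K - steiner_point L) \<le> 2 * hausdorff_dist K L"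
  unfolding steiner_point_eq using assms
  by (intro steiner_bound continuous_on_support_fun support_fun_le_hausdorff)

lemma steiner_point_Un_Int:
  assumes "convex_body K" "convex_body L" "convex_body (K \<union> L)" "K \<inter> L \<noteq> {}"
  shows "steiner_point (K \<union> L) + steiner_point (K \<inter> L) = steiner_point K + steiner_point L"
proof -
  have "convex_body (K \<inter> L)" using assms by (intro convex_body_Int_nonempty)
  moreover have "(\<lambda>x. support_fun (K \<union> L) x + support_fun (K \<inter> L) x) = (\<lambda>x. support_fun K x + support_fun L x)"
    using assms by (intro ext support_fun_Un_Int) (auto simp: convex_body_def)
  ultimately show ?thesis
    unfolding steiner_point_eq using assms by (simp add: continuous_on_support_fun flip: steiner_add)
qed

lemma steiner_point_segment: "steiner_point (convex hull {p, q}) = (1/2) *\<^sub>R (p + q)"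
proof -
  have "support_fun (convex hull {p, q}) x = 1/2 * \<bar>inner x (q - p)\<bar> + inner x ((1/2) *\<^sub>R (p + q))" for x
    by (simp add: support_fun_hull inner_diff_right inner_add_right max_def abs_if field_simps)
  then have "steiner_point (convex hull {p, q}) = steiner (\<lambda>x. 1/2 * \<bar>inner x (q - p)\<bar> + inner x ((1/2) *\<^sub>R (p + q)))"
    unfolding steiner_point_eq by presburger
  also have "\<dots> = steiner (\<lambda>x. 1/2 * \<bar>inner x (q - p)\<bar>) + steiner (\<lambda>x. inner x ((1/2) *\<^sub>R (p + q)))"
    by (rule steiner_add) (auto intro!: continuous_intros)
  also have "steiner (\<lambda>x. 1/2 * \<bar>inner x (q - p)\<bar>) = 0"
    by (rule steiner_even) (auto intro!: continuous_intros)
  finally show ?thesis unfolding steiner_inner by simp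
qed

text \<open>The right-hand side of the theorem, kept in the shape of the statement so that it can be
  folded there.\<close>

definition combination :: "real \<Rightarrow> real \<Rightarrow> real^2^2 \<Rightarrow> pt set \<Rightarrow> pt set" where
  "combination a b g K = (\<lambda>x. a *\<^sub>R (g *v x)) ` ((\<lambda>x. x - steiner_point K) ` K)
     + (\<lambda>x. b *\<^sub>R (g *v x)) ` ((\<lambda>x. - x + steiner_point K) ` K)"

lemma combination_aux:
  assumes K: "convex_body K" and ab: "a \<ge> 0" "b \<ge> 0"
  shows "convex_body (combination a b (rot \<gamma>) K)"
    and "support_fun (combination a b (rot \<gamma>) K) x = a * support_fun K (rot (- \<gamma>) *v x)
      + b * support_fun K (- (rot (- \<gamma>) *v x)) - (a - b) * inner (rot (- \<gamma>) *v x) (steiner_point K)"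
proof -
  let ?s = "steiner_point K" and ?A = "\<lambda>L. (\<lambda>x. rot \<gamma> *v x) ` L"
  let ?K1 = "(\<lambda>x. x + (- ?s)) ` K" and ?K2 = "(\<lambda>x. x + ?s) ` uminus ` K"
  have eq: "combination a b (rot \<gamma>) K = (\<lambda>x. a *\<^sub>R x) ` ?A ?K1 + (\<lambda>x. b *\<^sub>R x) ` ?A ?K2"
    unfolding combination_def image_image by simp
  have neg: "convex_body (uminus ` K)"
    by (rule convex_body_linear_image[OF bounded_linear.linear[OF bounded_linear_minus[OF bounded_linear_ident]] K])
  have b1: "convex_body ?K1" "convex_body ?K2" by (intro convex_body_translation K neg)+
  have b2: "convex_body (?A ?K1)" "convex_body (?A ?K2)" by (intro convex_body_linear_image b1 matrix_vector_mul_linear)+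
  have b3: "convex_body ((\<lambda>x. a *\<^sub>R x) ` ?A ?K1)" "convex_body ((\<lambda>x. b *\<^sub>R x) ` ?A ?K2)"
    by (intro convex_body_scaleR b2)+
  show "convex_body (combination a b (rot \<gamma>) K)" unfolding eq by (intro convex_body_plus b3)
  show "support_fun (combination a b (rot \<gamma>) K) x = a * support_fun K (rot (- \<gamma>) *v x)
      + b * support_fun K (- (rot (- \<gamma>) *v x)) - (a - b) * inner (rot (- \<gamma>) *v x) (steiner_point K)"
    unfolding eq support_fun_plus[OF b3] support_fun_scaleR_image[OF b2(1) ab(1)] support_fun_scaleR_image[OF b2(2) ab(2)]
      support_fun_matrix_image[OF b1(1)] support_fun_matrix_image[OF b1(2)] transpose_rot
      support_fun_translation[OF K] support_fun_translation[OF neg] support_fun_uminus_image[OF K]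
    by (simp add: algebra_simps)
qed

context rotation_endo_frame
begin

text \<open>The error of the claimed formula, read in the frame of \<open>eta\<close>. Each summand
  is additive under cuts, and so is the error.\<close>

definition defect :: "real \<Rightarrow> pt set \<Rightarrow> pt \<Rightarrow> real" where
  "defect a K x = eta K x - a * support_fun K x - (2 * \<kappa> - a) * support_fun K (- x)
     + (a - (2 * \<kappa> - a)) * inner x (steiner_point K)"

lemma defect_crossing:
  assumes fin: "finite A" "finite B" "finite C" and ne: "A \<noteq> {}" "B \<noteq> {}" "C \<noteq> {}"
    and cross: "\<And>a b. a \<in> convex hull A \<Longrightarrow> b \<in> convex hull B \<Longrightarrow> closed_segment a b \<inter> convex hull C \<noteq> {}"
  shows "defect a (convex hull (A \<union> B \<union> C)) x + defect a (convex hull C) x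
    = defect a (convex hull (A \<union> C)) x + defect a (convex hull (B \<union> C)) x"
proof -
  let ?K = "convex hull (A \<union> C)" and ?L = "convex hull (B \<union> C)" and ?U = "convex hull (A \<union> B \<union> C)" and ?I = "convex hull C"
  have b: "convex_body ?K" "convex_body ?L" "convex_body ?U"
    using fin ne by (auto intro!: convex_body_hull)
  have U: "?K \<union> ?L = ?U" and I: "?K \<inter> ?L = ?I" by (rule hull_Un_crossing[OF ne cross] hull_Int_crossing[OF ne cross]; assumption)+
  have s: "support_fun ?U y + support_fun ?I y = support_fun ?K y + support_fun ?L y" for y
    using support_fun_Un_Int[OF b(1,2), of y] b(3) unfolding U I by (simp add: convex_body_def)
  have "steiner_point ?U + steiner_point ?I = steiner_point ?K + steiner_point ?L"
    using steiner_point_Un_Int[OF b(1,2)] b(3) ne unfolding U I by simp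
  then have "inner x (steiner_point ?U) + inner x (steiner_point ?I) = inner x (steiner_point ?K) + inner x (steiner_point ?L)"
    by (metis inner_add_right)
  moreover have "eta ?U x + eta ?I x = eta ?K x + eta ?L x" by (rule eta_crossing[OF fin ne cross])
  moreover have lin: "e - a * p - c * q + d * r + (e' - a * p' - c * q' + d * r')
      = (e + e') - a * (p + p') - c * (q + q') + d * (r + r')" for e p q r e' p' q' r' c d :: real
    by (simp add: algebra_simps)
  ultimately show ?thesis unfolding defect_def lin using s[of x] s[of "- x"] by presburger
qed

text \<open>The coefficients add up to \<open>2 * \<kappa>\<close>, which cancels the even part; the
  odd part cancels because the Steiner point is the midpoint.\<close>

lemma defect_segment: "defect a (convex hull {p, q}) x = 0"
proof -
  define y where "y = inner x q - inner x p"
  have 1: "support_fun (convex hull {p, q}) x = (\<bar>y\<bar> + (inner x p + inner x q)) / 2"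
    and 2: "support_fun (convex hull {p, q}) (- x) = (\<bar>y\<bar> - (inner x p + inner x q)) / 2"
    by (auto simp: support_fun_hull y_def max_def abs_if)
  have 3: "inner x (steiner_point (convex hull {p, q})) = (inner x p + inner x q) / 2"
    by (simp add: steiner_point_segment inner_add_right)
  show ?thesis unfolding defect_def 1 2 3 eta_segment inner_diff_right y_def[symmetric]
    by (simp add: field_simps)
qed

text \<open>For a proper triangle \<open>steiner\<close> is applied to the formula of
  \<open>tri_form\<close>: the left side gives 0 by \<open>tri_steiner_eq_0\<close>, and the linear
  term gives its own vector, which is thereby a multiple of the Steiner point.\<close>

lemma defect_triangle:
  assumes a: "\<And>u v. cross u v \<noteq> 0 \<Longrightarrow> tri_form a u v"
  shows "defect a (convex hull {p, q, r}) x = 0"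
proof (cases "cross (q - p) (r - p) = 0")
  case True
  \<comment> \<open>One of three collinear points lies between the other two; the range of
    \<open>t\<close> tells which.\<close>
  have "\<exists>p' q'. convex hull {p, q, r} = convex hull {p', q'}"
  proof (cases "q = p")
    case True
    then show ?thesis by auto
  next
    case False
    then obtain t where t: "r - p = t *\<^sub>R (q - p)" using cross_eq_0_imp[OF True] by auto
    have red: "convex hull {p', q', r'} = convex hull {p', q'}" if "r' \<in> closed_segment p' q'" for p' q' r' :: pt
      using hull_redundant[of r' convex "{p', q'}"] that by (simp add: segment_convex_hull insert_commute)
    consider "t < 0" | "0 \<le> t" "t \<le> 1" | "t > 1" by linarith
    then show ?thesis
    proof cases
      case 1
      have "r = p + t *\<^sub>R (q - p)" using t by (simp add: algebra_simps)
      moreover define l where "l = 1 / (1 - t)"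
      moreover have "(1 - l) *\<^sub>R q + l *\<^sub>R (p + t *\<^sub>R (q - p)) = p + (1 - l * (1 - t)) *\<^sub>R (q - p)"
        by (simp add: algebra_simps)
      ultimately have "p = (1 - l) *\<^sub>R q + l *\<^sub>R r" "0 \<le> l" "l \<le> 1" using 1 by auto
      then have "p \<in> closed_segment q r" unfolding in_segment by blast
      from red[OF this] show ?thesis by (auto simp: insert_commute)
    next
      case 2
      have "r = (1 - t) *\<^sub>R p + t *\<^sub>R q" using t by (simp add: algebra_simps)
      then have "r \<in> closed_segment p q" unfolding in_segment using 2 by blast
      from red[OF this] show ?thesis by blast
    next
      case 3
      have "r = p + t *\<^sub>R (q - p)" using t by (simp add: algebra_simps)
      moreover define l where "l = 1 / t"
      moreover have "(1 - l) *\<^sub>R p + l *\<^sub>R (p + t *\<^sub>R (q - p)) = p + (l * t) *\<^sub>R (q - p)"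
        by (simp add: algebra_simps)
      ultimately have "q = (1 - l) *\<^sub>R p + l *\<^sub>R r" "0 \<le> l" "l \<le> 1" using 3 by auto
      then have "q \<in> closed_segment p r" unfolding in_segment by blast
      from red[OF this] show ?thesis by (auto simp: insert_commute)
    qed
  qed
  then show ?thesis using defect_segment by metis
next
  case False
  let ?T = "convex hull {p, q, r}"
  define u where "u = q - p"
  define v where "v = r - p"
  define b where "b = 2 * \<kappa> - a"
  obtain t where t: "\<And>x. eta (convex hull {0, u, v}) x = a * max 0 (max (inner x u) (inner x v))
      + b * max 0 (max (- inner x u) (- inner x v)) + inner x t"
    using a[OF False] unfolding tri_form_def u_def v_def b_def by blast
  have tr: "eta ?T = eta (convex hull {0, u, v})"
    using eta_hull_translation[of "{0, u, v}" p] by (simp add: u_def v_def)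
  have T: "convex_body ?T" by (rule convex_body_triangle)
  have s: "support_fun ?T x = max 0 (max (inner x u) (inner x v)) + inner x p" for x
    by (simp add: support_fun_hull u_def v_def inner_diff_right max_def)
  have s': "support_fun ?T (- x) = max 0 (max (- inner x u) (- inner x v)) - inner x p" for x
    by (simp add: support_fun_hull u_def v_def inner_diff_right max_def)
  define t' where "t' = t - (a - b) *\<^sub>R p"
  have e: "eta ?T x = a * support_fun ?T x + b * support_fun ?T (- x) + inner x t'" for x
    unfolding tr t s s' t'_def by (simp add: inner_diff_right algebra_simps)
  have "0 = steiner (eta ?T)" using tri_steiner_eq_0[OF False] unfolding tr tri_steiner_def u_def v_def by simp
  also have "eta ?T = (\<lambda>x. a * support_fun ?T x + b * support_fun ?T (- x) + inner x t')" using e by blast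
  also have "steiner \<dots> = steiner (\<lambda>x. a * support_fun ?T x + b * support_fun ?T (- x)) + steiner (\<lambda>x. inner x t')"
    using T by (intro steiner_add) (auto intro!: continuous_intros)
  also have "steiner (\<lambda>x. a * support_fun ?T x + b * support_fun ?T (- x))
      = steiner (\<lambda>x. a * support_fun ?T x) + steiner (\<lambda>x. b * support_fun ?T (- x))"
    using T by (intro steiner_add) (auto intro!: continuous_intros)
  also have "\<dots> = a *\<^sub>R steiner_point ?T - b *\<^sub>R steiner_point ?T"
    using T by (simp add: steiner_cmul steiner_uminus continuous_on_support_fun steiner_point_eq)
  finally have t'_eq: "t' = b *\<^sub>R steiner_point ?T - a *\<^sub>R steiner_point ?T"
    unfolding steiner_inner by (metis add_eq_0_iff minus_diff_eq)
  show ?thesis unfolding defect_def e b_def[symmetric] t'_eq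
    by (simp add: inner_diff_right algebra_simps)
qed

text \<open>By Radon's theorem, a point set with at least four elements either has a redundant point or
  contains two crossing segments.\<close>
lemma defect_polygon:
  assumes a: "\<And>u v. cross u v \<noteq> 0 \<Longrightarrow> tri_form a u v"
  shows "finite S \<Longrightarrow> S \<noteq> {} \<Longrightarrow> defect a (convex hull S) x = 0"
proof (induction "card S" arbitrary: S rule: less_induct)
  case less
  show ?case
  proof (cases "card S \<le> 3")
    case True
    have "\<exists>p q r. S = {p, q, r}"
    proof -
      have "card S \<noteq> 0" using less by simp
      then have "card S = 1 \<or> card S = 2 \<or> card S = 3" using True by linarith
      then show ?thesis
      proof (elim disjE)
        assume "card S = 1" then show ?thesis by (auto simp: card_1_singleton_iff)
      next
        assume "card S = 2" then show ?thesis by (auto simp: card_2_iff)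
      next
        assume "card S = 3" then show ?thesis by (auto simp: card_3_iff)
      qed
    qed
    then show ?thesis using defect_triangle[OF a] by blast
  next
    case False
    then obtain T where T: "T \<subseteq> S" "card T = 4" "finite T"
      using obtain_subset_with_card_n[of 4 S] by auto
    have "affine_dependent T" using T by (intro affine_dependent_biggerset) auto
    then obtain M N where MN: "M \<subseteq> T" "N \<subseteq> T" "M \<inter> N = {}" "convex hull M \<inter> convex hull N \<noteq> {}"
      using Radon by metis
    have fin: "finite M" "finite N" using MN(1,2) T(3) by (auto intro: finite_subset)
    have ne: "M \<noteq> {}" "N \<noteq> {}" using MN by auto
    have "card M + card N = card (M \<union> N)" using fin MN by (simp add: card_Un_disjoint)
    also have "\<dots> \<le> 4" using MN T card_mono[of T "M \<union> N"] by auto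
    finally have le: "card M + card N \<le> 4" .
    have redundant: "defect a (convex hull S) x = 0"
      if R: "card M = 1" "M \<subseteq> T" "N \<subseteq> T" "M \<inter> N = {}" "convex hull M \<inter> convex hull N \<noteq> {}" for M N
    proof -
      obtain p where p: "M = {p}" using R by (auto simp: card_1_singleton_iff)
      have "N \<subseteq> S - {p}" using R p T by auto
      moreover have pN: "p \<in> convex hull N" using R p by auto
      moreover have "N \<noteq> {}" using pN by auto
      ultimately have ne: "S - {p} \<noteq> {}" and mem: "p \<in> convex hull (S - {p})" using hull_mono by blast+
      from mem have "convex hull (insert p (S - {p})) = convex hull (S - {p})" by (rule hull_redundant)
      moreover have "insert p (S - {p}) = S" using R p T by auto
      moreover have "card (S - {p}) < card S" using R p T less by (intro psubset_card_mono) auto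
      ultimately show ?thesis using less ne by (metis finite_Diff)
    qed
    \<comment> \<open>Both parts are nonempty with at most four points together, so if neither is a
      single point they are two pairs.\<close>
    consider "card M = 1" | "card N = 1" | "card M = 2"
    proof -
      have "card M > 0" "card N > 0" using fin ne by auto
      then have "card M = 1 \<or> card N = 1 \<or> card M = 2" using le by linarith
      then show thesis using that by blast
    qed
    then show ?thesis
    proof cases
      case 1 then show ?thesis using redundant MN by blast
    next
      case 2 then show ?thesis using redundant[of N M] MN by blast
    next
      case 3
      then obtain c d where cd: "M = {c, d}" "c \<noteq> d" by (auto simp: card_2_iff)
      let ?C = "S - {c, d}"
      \<comment> \<open>The other pair survives in \<open>?C\<close>, so the segment from
        \<open>c\<close> to \<open>d\<close> meets its hull, and cutting along that hull involves
        only sets smaller than \<open>S\<close>.\<close>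
      have NC: "N \<subseteq> ?C" using MN T cd by auto
      have C: "finite ?C" "?C \<noteq> {}" using NC ne less by auto
      have in_S: "c \<in> S" "d \<in> S" using cd MN T by auto
      have "closed_segment c d \<inter> convex hull ?C \<noteq> {}"
        using MN(4) hull_mono[OF NC, of convex] unfolding cd(1) segment_convex_hull by blast
      then have val: "defect a (convex hull ({c} \<union> {d} \<union> ?C)) x + defect a (convex hull ?C) x
        = defect a (convex hull ({c} \<union> ?C)) x + defect a (convex hull ({d} \<union> ?C)) x"
        using C by (intro defect_crossing) auto
      have "{c} \<union> {d} \<union> ?C = S" using in_S by auto
      moreover have "defect a (convex hull D) x = 0" if "D \<subset> S" "D \<noteq> {}" for D
        using less that by (meson finite_subset psubset_card_mono psubset_imp_subset)
      moreover have "?C \<subset> S" "{c} \<union> ?C \<subset> S" "{d} \<union> ?C \<subset> S" using in_S cd by auto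
      ultimately show ?thesis using val C by simp
    qed
  qed
qed

lemma defect_continuous:
  assumes K: "convex_body K" and e: "e > 0" and x: "norm x = 1"
  shows "\<exists>d>0. \<forall>L. convex_body L \<longrightarrow> hausdorff_dist K L < d \<longrightarrow> \<bar>defect a K x - defect a L x\<bar> < e"
proof -
  define b where "b = 2 * \<kappa> - a"
  \<comment> \<open>A Lipschitz constant for the support function and Steiner terms: the factor 2 is
    that of \<open>steiner_point_hausdorff\<close>, and the 1 makes it positive.\<close>
  define M where "M = \<bar>a\<bar> + \<bar>b\<bar> + 2 * \<bar>a - b\<bar> + 1"
  have M: "M > 0" by (simp add: M_def add_nonneg_pos)
  obtain d where d: "d > 0" "\<And>L. convex_body L \<Longrightarrow> hausdorff_dist K L < d \<Longrightarrow> dist (H K (rot \<gamma> *v x)) (H L (rot \<gamma> *v x)) < e / 2"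
    using H_continuous[OF K, of "e / 2"] e x by (metis half_gt_zero norm_rot)
  have "\<bar>defect a K x - defect a L x\<bar> < e" if L: "convex_body L" "hausdorff_dist K L < min d (e / (2 * M))" for L
  proof -
    let ?h = "hausdorff_dist K L"
    have 1: "\<bar>eta K x - eta L x\<bar> < e / 2" using d(2)[of L] L by (simp add: eta_def dist_real_def)
    have 2: "\<bar>support_fun K x - support_fun L x\<bar> \<le> ?h" "\<bar>support_fun K (- x) - support_fun L (- x)\<bar> \<le> ?h"
      using K L x by (intro support_fun_le_hausdorff; simp)+
    have "\<bar>inner x (steiner_point K - steiner_point L)\<bar> \<le> norm x * norm (steiner_point K - steiner_point L)"
      by (rule Cauchy_Schwarz_ineq2)
    then have 3: "\<bar>inner x (steiner_point K) - inner x (steiner_point L)\<bar> \<le> 2 * ?h"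
      using steiner_point_hausdorff[OF K L(1)] x by (simp add: inner_diff_right)
    have h0: "?h \<ge> 0" using 2 by linarith
    have "\<bar>a * (support_fun K x - support_fun L x)\<bar> \<le> \<bar>a\<bar> * ?h"
      "\<bar>b * (support_fun K (- x) - support_fun L (- x))\<bar> \<le> \<bar>b\<bar> * ?h"
      "\<bar>(a - b) * (inner x (steiner_point K) - inner x (steiner_point L))\<bar> \<le> \<bar>a - b\<bar> * (2 * ?h)"
      unfolding abs_mult using 2 3 by (intro mult_left_mono; simp)+
    moreover have "defect a K x - defect a L x = (eta K x - eta L x) - a * (support_fun K x - support_fun L x)
        - b * (support_fun K (- x) - support_fun L (- x)) + (a - b) * (inner x (steiner_point K) - inner x (steiner_point L))"
      unfolding defect_def b_def[symmetric] by (simp add: algebra_simps)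
    ultimately have "\<bar>defect a K x - defect a L x\<bar> < e / 2 + (\<bar>a\<bar> * ?h + \<bar>b\<bar> * ?h + \<bar>a - b\<bar> * (2 * ?h))"
      using 1 by linarith
    also have "\<dots> \<le> e / 2 + M * ?h" using h0 by (simp add: M_def algebra_simps)
    also have "M * ?h \<le> M * (e / (2 * M))" using L M by (intro mult_left_mono) auto
    also have "e / 2 + M * (e / (2 * M)) = e" using M by simp
    finally show ?thesis by simp
  qed
  moreover have "min d (e / (2 * M)) > 0" using d M e by simp
  ultimately show ?thesis by blast
qed

text \<open>At unit vectors the error is continuous in the body and vanishes on the dense set of
  polygons; homogeneity in \<open>x\<close> does the rest.\<close>

lemma defect_eq_0:
  assumes a: "\<And>u v. cross u v \<noteq> 0 \<Longrightarrow> tri_form a u v" and K: "convex_body K"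
  shows "defect a K x = 0"
proof -
  have unit: "defect a K x = 0" if x: "norm x = 1" for x
  proof (rule ccontr)
    assume "defect a K x \<noteq> 0"
    then obtain d where d: "d > 0" "\<And>L. convex_body L \<Longrightarrow> hausdorff_dist K L < d \<Longrightarrow> \<bar>defect a K x - defect a L x\<bar> < \<bar>defect a K x\<bar>"
      using defect_continuous[OF K _ x, of "\<bar>defect a K x\<bar>" a] by auto
    obtain S where S: "finite S" "S \<noteq> {}" "hausdorff_dist K (convex hull S) \<le> d / 2"
      using hausdorff_dense_polygons[OF K, of "d / 2"] d by auto
    then show False using d(2)[OF convex_body_hull[OF S(1,2)]] d(1) defect_polygon[OF a S(1,2), of x] by auto
  qed
  obtain r t where r: "r \<ge> 0" "x = r *\<^sub>R unit_dir t" by (rule polar_form)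
  have "defect a K (r *\<^sub>R y) = r * defect a K y" for y
    using support_fun_scale[OF K r(1), of "- y"]
    by (simp add: defect_def eta_scaleR[OF K r(1)] support_fun_scale[OF K r(1)] algebra_simps)
  then show ?thesis using unit r by simp
qed

lemma Phi_eq_combination:
  obtains a b where "a \<ge> 0" "b \<ge> 0" "a + b > 0" "\<And>K. convex_body K \<Longrightarrow> \<Phi> K = combination a b (rot \<gamma>) K"
proof -
  obtain a where a: "0 \<le> a" "a \<le> 2 * \<kappa>" "\<And>u v. cross u v \<noteq> 0 \<Longrightarrow> tri_form a u v"
    by (rule tri_form_uniform) (rule that)
  have ab: "a \<ge> 0" "2 * \<kappa> - a \<ge> 0" using a by auto
  have "\<Phi> K = combination a (2 * \<kappa> - a) (rot \<gamma>) K" if K: "convex_body K" for K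
  proof (rule convex_body_eqI)
    show "H K x = support_fun (combination a (2 * \<kappa> - a) (rot \<gamma>) K) x" for x
      unfolding combination_aux(2)[OF K ab] H_eq_eta
      using defect_eq_0[OF a(3) K, of "rot (- \<gamma>) *v x"] by (simp add: defect_def)
  qed (use K maps combination_aux(1)[OF K ab] in auto)
  then show thesis using that[OF ab] kappa_pos by simp
qed

end

lemma (in rotation_endo) ex_combination:
  "\<exists>g \<in> SO2. \<exists>a b. a \<ge> 0 \<and> b \<ge> 0 \<and> a + b > 0 \<and> (\<forall>K. convex_body K \<longrightarrow> \<Phi> K = combination a b g K)"
proof -
  obtain \<kappa> \<gamma> where "\<kappa> \<ge> 0" "\<And>p q x. H (convex hull {p, q}) (rot \<gamma> *v x) = \<kappa> * \<bar>inner x (q - p)\<bar>"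
    using H_segment by blast
  then interpret rotation_endo_frame \<Phi> \<kappa> \<gamma> by unfold_locales auto
  show ?thesis using Phi_eq_combination SO2_eq_range_rot by (metis rangeI)
qed

section \<open>The converse: covariance and area bounds\<close>

lemma combination_rot:
  assumes K: "convex_body K" and ab: "a \<ge> 0" "b \<ge> 0"
  shows "combination a b (rot \<gamma>) ((\<lambda>x. rot t *v x) ` K) = (\<lambda>x. rot t *v x) ` combination a b (rot \<gamma>) K"
proof (rule convex_body_eqI)
  have tK: "convex_body ((\<lambda>x. rot t *v x) ` K)"
    by (intro convex_body_linear_image K matrix_vector_mul_linear)
  show "convex_body (combination a b (rot \<gamma>) ((\<lambda>x. rot t *v x) ` K))"
    by (rule combination_aux(1)[OF tK ab])
  show "convex_body ((\<lambda>x. rot t *v x) ` combination a b (rot \<gamma>) K)"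
    by (intro convex_body_linear_image combination_aux(1) K ab matrix_vector_mul_linear)
  show "support_fun (combination a b (rot \<gamma>) ((\<lambda>x. rot t *v x) ` K)) x
      = support_fun ((\<lambda>x. rot t *v x) ` combination a b (rot \<gamma>) K) x" for x
    unfolding combination_aux(2)[OF tK ab] support_fun_matrix_image[OF combination_aux(1)[OF K ab]]
      combination_aux(2)[OF K ab] support_fun_matrix_image[OF K] transpose_rot steiner_point_rot[OF K]
    \<comment> \<open>Plane rotations commute, which is why every angle \<gamma> is compatible with
      covariance.\<close>
    by (simp add: rot_rot rot_minus inner_rot add.commute)
qed

text \<open>Fixing the point of one summand at \<open>k\<close> leaves a translate of the other one
  inside the Minkowski sum.\<close>

lemma area_combination_ge:
  assumes K: "convex_body K" and ab: "a \<ge> 0" "b \<ge> 0"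
  shows "area (combination a b (rot \<gamma>) K) \<ge> a\<^sup>2 * area K" "area (combination a b (rot \<gamma>) K) \<ge> b\<^sup>2 * area K"
proof -
  obtain k where k: "k \<in> K" using K unfolding convex_body_def by blast
  let ?s = "steiner_point K"
  have *: "r\<^sup>2 * area K \<le> area (combination a b (rot \<gamma>) K)"
    if "(\<lambda>x. r *\<^sub>R (rot \<gamma> *v x) + d) ` K \<subseteq> combination a b (rot \<gamma>) K" for r d
  proof -
    have e: "(\<lambda>x. r *\<^sub>R (rot \<gamma> *v x) + d) ` K = (\<lambda>x. r *\<^sub>R x + d) ` (\<lambda>x. rot \<gamma> *v x) ` K"
      by (simp add: image_image)
    have "convex_body ((\<lambda>x. r *\<^sub>R (rot \<gamma> *v x) + d) ` K)"
      using convex_body_translation[OF convex_body_scaleR[OF convex_body_linear_image[OF matrix_vector_mul_linear K]], of d r "rot \<gamma>"]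
      by (simp add: image_image)
    then have "area ((\<lambda>x. r *\<^sub>R (rot \<gamma> *v x) + d) ` K) \<le> area (combination a b (rot \<gamma>) K)"
      by (intro area_mono combination_aux(1) K ab that)
    then show ?thesis unfolding e area_affine area_rot[OF K] .
  qed
  have "a *\<^sub>R (rot \<gamma> *v x) + (a *\<^sub>R (rot \<gamma> *v (- ?s)) + b *\<^sub>R (rot \<gamma> *v (- k + ?s))) \<in> combination a b (rot \<gamma>) K" if "x \<in> K" for x
  proof -
    have "a *\<^sub>R (rot \<gamma> *v (x - ?s)) + b *\<^sub>R (rot \<gamma> *v (- k + ?s)) \<in> combination a b (rot \<gamma>) K"
      unfolding combination_def using that k by (intro set_plus_intro) auto
    moreover have "a *\<^sub>R (rot \<gamma> *v (x - ?s)) = a *\<^sub>R (rot \<gamma> *v x) + a *\<^sub>R (rot \<gamma> *v (- ?s))"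
      by (metis diff_conv_add_uminus matrix_vector_right_distrib scaleR_add_right)
    ultimately show ?thesis by (simp add: add.assoc)
  qed
  then show "area (combination a b (rot \<gamma>) K) \<ge> a\<^sup>2 * area K" by (intro *) blast
  have "(- b) *\<^sub>R (rot \<gamma> *v x) + (a *\<^sub>R (rot \<gamma> *v (k - ?s)) + b *\<^sub>R (rot \<gamma> *v ?s)) \<in> combination a b (rot \<gamma>) K" if "x \<in> K" for x
  proof -
    have "a *\<^sub>R (rot \<gamma> *v (k - ?s)) + b *\<^sub>R (rot \<gamma> *v (- x + ?s)) \<in> combination a b (rot \<gamma>) K"
      unfolding combination_def using that k by (intro set_plus_intro) auto
    moreover have "b *\<^sub>R (rot \<gamma> *v (- x + ?s)) = (- b) *\<^sub>R (rot \<gamma> *v x) + b *\<^sub>R (rot \<gamma> *v ?s)"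
      by (simp only: matrix_vector_right_distrib rot_minus scaleR_add_right scaleR_minus_left scaleR_minus_right)
    ultimately show ?thesis by (simp only: add.left_commute)
  qed
  then have "(- b)\<^sup>2 * area K \<le> area (combination a b (rot \<gamma>) K)" by (intro *) blast
  then show "area (combination a b (rot \<gamma>) K) \<ge> b\<^sup>2 * area K" by simp
qed

text \<open>After a point \<open>k\<close> of the body is moved to 0 and the frame is turned
  upright, the body lies in a box with half-sides \<open>w1\<close> and \<open>w2\<close>; this
  gives the factor 4.\<close>

lemma area_le_widths:
  assumes L: "convex_body L"
    and w: "\<And>x y. x \<in> L \<Longrightarrow> y \<in> L \<Longrightarrow> \<bar>inner (unit_dir t) (x - y)\<bar> \<le> w1"
      "\<And>x y. x \<in> L \<Longrightarrow> y \<in> L \<Longrightarrow> \<bar>inner (unit_dir (t + pi/2)) (x - y)\<bar> \<le> w2"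
  shows "area L \<le> 4 * (w1 * w2)"
proof -
  obtain k where k: "k \<in> L" using L unfolding convex_body_def by blast
  have w0: "w1 \<ge> 0" "w2 \<ge> 0" using w[OF k k] by auto
  let ?L = "(\<lambda>x. rot (- t) *v x) ` (\<lambda>x. x + (- k)) ` L"
  let ?B = "cbox (vector [- w1, - w2]) (vector [w1, w2]) :: pt set"
  have L1: "convex_body ((\<lambda>x. x + (- k)) ` L)" by (rule convex_body_translation[OF L])
  have "?L \<subseteq> ?B"
  proof
    fix y assume "y \<in> ?L"
    then obtain x where x: "x \<in> L" "y = rot (- t) *v (x - k)" by auto
    have "y$1 = inner (unit_dir t) (x - k)" "y$2 = inner (unit_dir (t + pi/2)) (x - k)"
      unfolding x by (simp_all add: rot_apply vector_2 unit_dir_def inner_vec_def sum_2 cos_add sin_add)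
    then show "y \<in> ?B" using w[OF x(1) k] by (simp add: mem_box_cart forall_2 vector_2 abs_le_iff)
  qed
  moreover have B: "convex_body ?B"
    unfolding convex_body_def using w0 by (simp add: interval_ne_empty_cart forall_2 vector_2)
  ultimately have "area ?L \<le> area ?B"
    by (intro area_mono convex_body_linear_image L1 matrix_vector_mul_linear)
  moreover have "area ?L = area L" unfolding area_rot[OF L1] area_translation ..
  moreover have "area ?B = 4 * (w1 * w2)"
    unfolding area_eq_content[OF B] using w0
    by (subst content_cbox_cart) (simp_all add: interval_ne_empty_cart forall_2 vector_2 UNIV_2)
  ultimately show ?thesis by simp
qed

text \<open>A diameter and a point farthest from its line span a triangle in \<open>K\<close>, and both widths of \<open>K\<close>
  in this frame are controlled by it.\<close>
lemma area_combination_le: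
  assumes K: "convex_body K" and ab: "a \<ge> 0" "b \<ge> 0"
  shows "area (combination a b (rot \<gamma>) K) \<le> 16 * (a + b)\<^sup>2 * area K"
proof -
  have cK: "compact K" "K \<noteq> {}" using K by (auto simp: convex_body_def)
  obtain p q where pq: "p \<in> K" "q \<in> K" "dist q p = diameter K"
    using diameter_compact_attained[OF cK] by metis
  obtain d t where d: "d \<ge> 0" "q - p = d *\<^sub>R unit_dir t" by (rule polar_form)
  have diam: "norm (x - y) \<le> d" if "x \<in> K" "y \<in> K" for x y
    using diameter_bounded_bound[OF compact_imp_bounded[OF cK(1)] that] pq(3) d by (simp add: dist_norm)
  let ?n = "unit_dir (t + pi/2)"
  have "\<exists>r\<in>K. \<forall>x\<in>K. \<bar>inner ?n (x - p)\<bar> \<le> \<bar>inner ?n (r - p)\<bar>"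
    using cK by (intro continuous_attains_sup) (auto intro!: continuous_intros)
  then obtain r where r: "r \<in> K" "\<And>x. x \<in> K \<Longrightarrow> \<bar>inner ?n (x - p)\<bar> \<le> \<bar>inner ?n (r - p)\<bar>" by blast
  define h where "h = \<bar>inner ?n (r - p)\<bar>"
  have "convex hull {p, q, r} \<subseteq> K" using K pq r unfolding convex_body_def by (intro hull_minimal) auto
  then have "area (convex hull {p, q, r}) \<le> area K" by (intro area_mono convex_body_hull K) auto
  moreover have "cross (q - p) (r - p) = d * inner ?n (r - p)"
    unfolding d by (simp add: cross_def unit_dir_def vector_2 inner_vec_def sum_2 cos_add sin_add algebra_simps)
  ultimately have dh: "d * h / 2 \<le> area K" using d by (simp add: area_triangle h_def abs_mult)
  have w1: "\<bar>inner (unit_dir t) (x - y)\<bar> \<le> d" if "x \<in> K" "y \<in> K" for x y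
    using Cauchy_Schwarz_ineq2[of "unit_dir t" "x - y"] diam[OF that] by simp
  have w2: "\<bar>inner ?n (x - y)\<bar> \<le> 2 * h" if "x \<in> K" "y \<in> K" for x y
    using r(2)[OF that(1)] r(2)[OF that(2)] unfolding h_def[symmetric] by (simp add: inner_diff_right)
  \<comment> \<open>Widths add under Minkowski sums and do not change under reflection, so the two
    summands contribute \<open>a\<close> and \<open>b\<close> times the width of
    \<open>K\<close>.\<close>
  have w: "\<bar>inner (unit_dir (t' + \<gamma>)) (x - y)\<bar> \<le> (a + b) * w"
    if wK: "\<And>x y. x \<in> K \<Longrightarrow> y \<in> K \<Longrightarrow> \<bar>inner (unit_dir t') (x - y)\<bar> \<le> w"
      and x: "x \<in> combination a b (rot \<gamma>) K" and y: "y \<in> combination a b (rot \<gamma>) K" for t' w x y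
  proof -
    let ?s = "steiner_point K" and ?g = "\<lambda>x. rot \<gamma> *v x"
    obtain x1 x2 where x12: "x1 \<in> K" "x2 \<in> K" "x = a *\<^sub>R ?g (x1 - ?s) + b *\<^sub>R ?g (- x2 + ?s)"
      using x unfolding combination_def by (auto elim!: set_plus_elim)
    obtain y1 y2 where y12: "y1 \<in> K" "y2 \<in> K" "y = a *\<^sub>R ?g (y1 - ?s) + b *\<^sub>R ?g (- y2 + ?s)"
      using y unfolding combination_def by (auto elim!: set_plus_elim)
    have g: "inner (unit_dir (t' + \<gamma>)) (?g z) = inner (unit_dir t') z" for z
      using inner_rot[of \<gamma> z "unit_dir (t' + \<gamma>)"] by (simp add: rot_unit_dir inner_commute)
    have "inner (unit_dir (t' + \<gamma>)) (x - y) = a * inner (unit_dir t') (x1 - y1) + b * inner (unit_dir t') (y2 - x2)"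
      unfolding x12(3) y12(3) inner_diff_right inner_add_right inner_scaleR_right g by (simp add: inner_diff_right inner_add_right algebra_simps)
    also have "\<bar>\<dots>\<bar> \<le> a * \<bar>inner (unit_dir t') (x1 - y1)\<bar> + b * \<bar>inner (unit_dir t') (y2 - x2)\<bar>"
      using ab by (intro order_trans[OF abs_triangle_ineq]) (simp add: abs_mult)
    also have "\<dots> \<le> a * w + b * w" using ab wK x12 y12 by (intro add_mono mult_left_mono) auto
    finally show ?thesis by (simp add: algebra_simps)
  qed
  have "area (combination a b (rot \<gamma>) K) \<le> 4 * (((a + b) * d) * ((a + b) * (2 * h)))"
  proof (rule area_le_widths[OF combination_aux(1)[OF K ab], where t="t + \<gamma>"])
    fix x y assume xy: "x \<in> combination a b (rot \<gamma>) K" "y \<in> combination a b (rot \<gamma>) K"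
    show "\<bar>inner (unit_dir (t + \<gamma>)) (x - y)\<bar> \<le> (a + b) * d" by (rule w[OF w1 xy])
    have e: "t + \<gamma> + pi/2 = t + pi/2 + \<gamma>" by simp
    show "\<bar>inner (unit_dir (t + \<gamma> + pi/2)) (x - y)\<bar> \<le> (a + b) * (2 * h)" unfolding e by (rule w[OF w2 xy])
  qed
  \<comment> \<open>The constant 16 collects 4 from the box, 2 from the width \<open>2 * h\<close>
    and 2 from the area \<open>d * h / 2\<close> of the triangle.\<close>
  also have "\<dots> = 16 * (a + b)\<^sup>2 * (d * h / 2)" by (simp add: power2_eq_square)
  also have "\<dots> \<le> 16 * (a + b)\<^sup>2 * area K" using dh by (intro mult_left_mono) auto
  finally show ?thesis .
qed

theorem theorem6p4:
  fixes \<Phi> :: "pt set \<Rightarrow> pt set"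
  assumes maps: "\<forall>K. convex_body K \<longrightarrow> convex_body (\<Phi> K)"
    and cont: "hausdorff_continuous \<Phi>"
    and tinv: "translation_invariant \<Phi>"
    and val: "minkowski_valuation \<Phi>"
  shows "(VC \<Phi> \<and> SO2_covariant \<Phi>) \<longleftrightarrow>
    (\<exists>g \<in> SO2. \<exists>a b :: real. a \<ge> 0 \<and> b \<ge> 0 \<and> a + b > 0 \<and>
       (\<forall>K. convex_body K \<longrightarrow>
          \<Phi> K = (\<lambda>x. a *\<^sub>R (g *v x)) ` ((\<lambda>x. x - steiner_point K) ` K)
               + (\<lambda>x. b *\<^sub>R (g *v x)) ` ((\<lambda>x. - x + steiner_point K) ` K)))"
  unfolding combination_def[symmetric]
proof
  assume "VC \<Phi> \<and> SO2_covariant \<Phi>"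
  then interpret rotation_endo \<Phi> using assms by unfold_locales auto
  show "\<exists>g \<in> SO2. \<exists>a b. a \<ge> 0 \<and> b \<ge> 0 \<and> a + b > 0 \<and> (\<forall>K. convex_body K \<longrightarrow> \<Phi> K = combination a b g K)"
    by (rule ex_combination)
next
  assume "\<exists>g \<in> SO2. \<exists>a b. a \<ge> 0 \<and> b \<ge> 0 \<and> a + b > 0 \<and> (\<forall>K. convex_body K \<longrightarrow> \<Phi> K = combination a b g K)"
  then obtain \<gamma> a b where ab: "a \<ge> 0" "b \<ge> 0" "a + b > 0"
    and \<Phi>: "\<And>K. convex_body K \<Longrightarrow> \<Phi> K = combination a b (rot \<gamma>) K"
    unfolding SO2_eq_range_rot by blast
  have "SO2_covariant \<Phi>"
    unfolding SO2_covariant_def SO2_eq_range_rot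
  proof (intro allI impI)
    fix K g assume K: "convex_body K" and "g \<in> range rot"
    then obtain t where g: "g = rot t" by blast
    have "convex_body ((\<lambda>x. rot t *v x) ` K)" by (intro convex_body_linear_image K matrix_vector_mul_linear)
    then show "\<Phi> ((\<lambda>x. g *v x) ` K) = (\<lambda>x. g *v x) ` \<Phi> K"
      unfolding g by (simp only: \<Phi> K combination_rot[OF K ab(1,2)])
  qed
  moreover have "VC \<Phi>"
    unfolding VC_def
  \<comment> \<open>The sum contains a translate of a copy of \<open>K\<close> scaled by either
    coefficient; the larger one is positive because a + b is.\<close>
  proof (rule exI[of _ "(max a b)\<^sup>2"], rule exI[of _ "16 * (a + b)\<^sup>2"], intro conjI allI impI)
    show "(max a b)\<^sup>2 > 0" "16 * (a + b)\<^sup>2 > 0" using ab by (auto simp: max_def)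
    fix K assume K: "convex_body K"
    show "(max a b)\<^sup>2 * area K \<le> area (\<Phi> K)"
      using area_combination_ge[OF K ab(1,2), of \<gamma>] unfolding \<Phi>[OF K] max_def by simp
    show "area (\<Phi> K) \<le> 16 * (a + b)\<^sup>2 * area K"
      unfolding \<Phi>[OF K] by (rule area_combination_le[OF K ab(1,2)])
  qed
  ultimately show "VC \<Phi> \<and> SO2_covariant \<Phi>" by blast
qed

end
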